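(* Let $X_0$ be a compact metrizable space, $\mathfrak A=C(X_0)$, and let $G$ be a unimodular, amenable, second-countable locally compact group acting on $\mathfrak A$ by $\theta:G\to\mathrm{Aut}(\mathfrak A)$ so that $(\mathfrak A,G,\theta)$ is a uniquely ergodic $C^*$-dynamical system with unique invariant state $\omega_0$. Let $\alpha\in\mathrm{Aut}(\mathfrak A)$ commute with every $\theta_g$, let $u=(u_g)_{g\in G}$ be a continuous $1$-cocycle, let $(\mathfrak A\rtimes_\alpha\mathbb Z,G,\Phi^u)$ be the associated skew product, and let $\omega=\omega_0\circ E$. Then $(\mathfrak A\rtimes_\alpha\mathbb Z,G,\Phi^u)$ is uniquely ergodic, with unique $G$-invariant state $\omega$, if and only if for every $n\in\mathbb Z$ with $n\neq 0$ the $1$-cocycle $(u_g^{(n)})_{g\in G}$ is not a (measurable) coboundary.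
   Context: A $C^*$-dynamical system $(\mathfrak B,G,\beta)$ is a unital $C^*$-algebra $\mathfrak B$ with a group homomorphism $\beta:G\to\mathrm{Aut}(\mathfrak B)$ such that $g\mapsto\beta_g(b)$ is norm continuous for every $b\in\mathfrak B$. It is uniquely ergodic if there is exactly one $G$-invariant state (state $\varphi$ with $\varphi\circ\beta_g=\varphi$ for all $g$). $\mu_0$ is the Borel probability measure on $X_0$ with $\omega_0(f)=\int f\,d\mu_0$. $\theta_g$ also denotes the homeomorphism of $X_0$ with $(\theta_g(a))(x)=a(\theta_g(x))$, and the induced automorphism of $L^\infty(X_0,\mu_0)$. A continuous $1$-cocycle is a continuous function $u:G\times X_0\to\mathbb T$ which, writing $u_g:=u(g,\cdot)\in C(X_0)$, satisfies $u_{gh}=\theta_g(u_h)u_g$ for all $g,h\in G$. It is a (measurable) coboundary if there is a $\mathbb T$-valued $w\in L^\infty(X_0,\mu_0)$ with $u_g=\theta_g(w^* )w$ in $L^\infty(X_0,\mu_0)$ for all $g\in G$. $\mathfrak A\rtimes_\alpha\mathbb Z$ is the universal crossed product, generated by $\mathfrak A$ and a unitary $V$ with $VaV^*=\alpha(a)$ for $a\in\mathfrak A$. $E:\mathfrak A\rtimes_\alpha\mathbb Z\to\mathfrak A$ is the canonical conditional expectation, $E(aV^n)=a\,\delta_{n,0}$. For $g\in G$, $\Phi^u_g$ is the automorphism of $\mathfrak A\rtimes_\alpha\mathbb Z$ with $\Phi^u_g(a)=\theta_g(a)$ for $a\in\mathfrak A$ and $\Phi^u_g(V)=u_gV$. For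 $n\in\mathbb Z$ the $1$-cocycle $(u_g^{(n)})_{g\in G}$ is $u_g^{(0)}=1$, $u_g^{(n)}=u_g\alpha(u_g)\cdots\alpha^{n-1}(u_g)$ for $n>0$, and $u_g^{(n)}=\alpha^{n}(u_g^* )\alpha^{n+1}(u_g^* )\cdots\alpha^{-1}(u_g^* )$ for $n<0$; thus $\Phi^u_g(V^n)=u_g^{(n)}V^n$. *)

theory Defs
  imports "HOL-Analysis.Analysis" "HOL-Probability.Probability_Measure" "HOL-Algebra.Module"
begin

section \<open>Unital C*-algebras, states and C*-dynamical systems\<close>

definition complex_field :: "complex ring" where
  "complex_field = \<lparr>carrier = UNIV, mult = (*), one = 1, zero = 0, add = (+)\<rparr>"

record 'a star_alg = "(complex, 'a) module" +
  star :: "'a \<Rightarrow> 'a"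

record 'a cstar_alg = "'a star_alg" +
  cnorm :: "'a \<Rightarrow> real"

definition star_algebra :: "('a, 'm) star_alg_scheme \<Rightarrow> bool" where
  "star_algebra A \<longleftrightarrow>
     ring A \<and> module complex_field A \<and>
     (\<forall>c. \<forall>a\<in>carrier A. \<forall>b\<in>carrier A.
        (c \<odot>\<^bsub>A\<^esub> a) \<otimes>\<^bsub>A\<^esub> b = c \<odot>\<^bsub>A\<^esub> (a \<otimes>\<^bsub>A\<^esub> b) \<and>
        a \<otimes>\<^bsub>A\<^esub> (c \<odot>\<^bsub>A\<^esub> b) = c \<odot>\<^bsub>A\<^esub> (a \<otimes>\<^bsub>A\<^esub> b)) \<and>
     (\<forall>a\<in>carrier A. star A a \<in> carrier A \<and> star A (star A a) = a) \<and>
     (\<forall>c. \<forall>a\<in>carrier A. star A (c \<odot>\<^bsub>A\<^esub> a) = cnj c \<odot>\<^bsub>A\<^esub> star A a) \<and>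
     (\<forall>a\<in>carrier A. \<forall>b\<in>carrier A.
        star A (a \<oplus>\<^bsub>A\<^esub> b) = star A a \<oplus>\<^bsub>A\<^esub> star A b \<and>
        star A (a \<otimes>\<^bsub>A\<^esub> b) = star A b \<otimes>\<^bsub>A\<^esub> star A a)"

definition cstar_seminorm :: "('a, 'm) star_alg_scheme \<Rightarrow> ('a \<Rightarrow> real) \<Rightarrow> bool" where
  "cstar_seminorm A p \<longleftrightarrow>
     (\<forall>a\<in>carrier A. 0 \<le> p a) \<and>
     (\<forall>c. \<forall>a\<in>carrier A. p (c \<odot>\<^bsub>A\<^esub> a) = cmod c * p a) \<and>
     (\<forall>a\<in>carrier A. \<forall>b\<in>carrier A. p (a \<oplus>\<^bsub>A\<^esub> b) \<le> p a + p b) \<and>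
     (\<forall>a\<in>carrier A. \<forall>b\<in>carrier A. p (a \<otimes>\<^bsub>A\<^esub> b) \<le> p a * p b) \<and>
     (\<forall>a\<in>carrier A. p (star A a \<otimes>\<^bsub>A\<^esub> a) = (p a)\<^sup>2)"

definition cauchy_seqs :: "('a, 'm) star_alg_scheme \<Rightarrow> ('a \<Rightarrow> real) \<Rightarrow> (nat \<Rightarrow> 'a) set" where
  "cauchy_seqs A p =
     {s. (\<forall>k. s k \<in> carrier A) \<and>
         (\<forall>e>0. \<exists>N. \<forall>j\<ge>N. \<forall>k\<ge>N. p (s j \<ominus>\<^bsub>A\<^esub> s k) < e)}"

definition cstar_algebra :: "('a, 'm) cstar_alg_scheme \<Rightarrow> bool" where
  "cstar_algebra A \<longleftrightarrow>
     star_algebra A \<and> cstar_seminorm A (cnorm A) \<and>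
     (\<forall>a\<in>carrier A. cnorm A a = 0 \<longrightarrow> a = \<zero>\<^bsub>A\<^esub>) \<and>
     (\<forall>s\<in>cauchy_seqs A (cnorm A). \<exists>a\<in>carrier A. (\<lambda>k. cnorm A (s k \<ominus>\<^bsub>A\<^esub> a)) \<longlonglongrightarrow> 0)"

text \<open>Functionals and automorphisms are only constrained on the carrier; their values elsewhere
  are irrelevant.\<close>

definition star_automorphism :: "('a, 'm) star_alg_scheme \<Rightarrow> ('a \<Rightarrow> 'a) \<Rightarrow> bool" where
  "star_automorphism A \<sigma> \<longleftrightarrow>
     bij_betw \<sigma> (carrier A) (carrier A) \<and>
     (\<forall>c. \<forall>a\<in>carrier A. \<sigma> (c \<odot>\<^bsub>A\<^esub> a) = c \<odot>\<^bsub>A\<^esub> \<sigma> a) \<and>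
     (\<forall>a\<in>carrier A. \<sigma> (star A a) = star A (\<sigma> a)) \<and>
     (\<forall>a\<in>carrier A. \<forall>b\<in>carrier A.
        \<sigma> (a \<oplus>\<^bsub>A\<^esub> b) = \<sigma> a \<oplus>\<^bsub>A\<^esub> \<sigma> b \<and> \<sigma> (a \<otimes>\<^bsub>A\<^esub> b) = \<sigma> a \<otimes>\<^bsub>A\<^esub> \<sigma> b)"

definition aut_power :: "('a, 'm) star_alg_scheme \<Rightarrow> ('a \<Rightarrow> 'a) \<Rightarrow> int \<Rightarrow> 'a \<Rightarrow> 'a" where
  "aut_power A \<sigma> n =
     (if 0 \<le> n then \<sigma> ^^ nat n else inv_into (carrier A) \<sigma> ^^ nat (- n))"

text \<open>A state is a positive linear functional of norm one. As the algebra is unital, having norm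
  one amounts to being contractive and sending the unit to 1.\<close>

definition state :: "('a, 'm) cstar_alg_scheme \<Rightarrow> ('a \<Rightarrow> complex) \<Rightarrow> bool" where
  "state A \<phi> \<longleftrightarrow>
     (\<forall>c. \<forall>a\<in>carrier A. \<phi> (c \<odot>\<^bsub>A\<^esub> a) = c * \<phi> a) \<and>
     (\<forall>a\<in>carrier A. \<forall>b\<in>carrier A. \<phi> (a \<oplus>\<^bsub>A\<^esub> b) = \<phi> a + \<phi> b) \<and>
     (\<forall>a\<in>carrier A. \<phi> (star A a \<otimes>\<^bsub>A\<^esub> a) \<in> \<real> \<and> 0 \<le> Re (\<phi> (star A a \<otimes>\<^bsub>A\<^esub> a))) \<and>
     (\<forall>a\<in>carrier A. cmod (\<phi> a) \<le> cnorm A a) \<and>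
     \<phi> \<one>\<^bsub>A\<^esub> = 1"

text \<open>Groups are written additively because that is how HOL provides topological groups; the
  class \<open>group_add\<close> does not assume commutativity.\<close>

definition cstar_dynamical_system ::
    "('a, 'm) cstar_alg_scheme \<Rightarrow> ('g::topological_group_add \<Rightarrow> 'a \<Rightarrow> 'a) \<Rightarrow> bool" where
  "cstar_dynamical_system A \<beta> \<longleftrightarrow>
     cstar_algebra A \<and>
     (\<forall>g. star_automorphism A (\<beta> g)) \<and>
     (\<forall>g h. \<forall>a\<in>carrier A. \<beta> (g + h) a = \<beta> g (\<beta> h a)) \<and>
     (\<forall>a\<in>carrier A. \<forall>g. ((\<lambda>h. cnorm A (\<beta> h a \<ominus>\<^bsub>A\<^esub> \<beta> g a)) \<longlongrightarrow> 0) (at g))"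

definition invariant_state ::
    "('a, 'm) cstar_alg_scheme \<Rightarrow> ('g \<Rightarrow> 'a \<Rightarrow> 'a) \<Rightarrow> ('a \<Rightarrow> complex) \<Rightarrow> bool" where
  "invariant_state A \<beta> \<phi> \<longleftrightarrow> state A \<phi> \<and> (\<forall>g. \<forall>a\<in>carrier A. \<phi> (\<beta> g a) = \<phi> a)"

definition uniquely_ergodic :: "('a, 'm) cstar_alg_scheme \<Rightarrow> ('g \<Rightarrow> 'a \<Rightarrow> 'a) \<Rightarrow> bool" where
  "uniquely_ergodic A \<beta> \<longleftrightarrow>
     (\<exists>\<phi>. invariant_state A \<beta> \<phi> \<and>
       (\<forall>\<psi>. invariant_state A \<beta> \<psi> \<longrightarrow> (\<forall>a\<in>carrier A. \<psi> a = \<phi> a)))"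


section \<open>Enveloping C*-algebras\<close>

definition universal_norm :: "('a, 'm) star_alg_scheme \<Rightarrow> 'a \<Rightarrow> real" where
  "universal_norm A a = (SUP p\<in>{p. cstar_seminorm A p}. p a)"

definition null_rel ::
    "('a, 'm) star_alg_scheme \<Rightarrow> ('a \<Rightarrow> real) \<Rightarrow> ((nat \<Rightarrow> 'a) \<times> (nat \<Rightarrow> 'a)) set" where
  "null_rel A p =
     {(s, t). s \<in> cauchy_seqs A p \<and> t \<in> cauchy_seqs A p \<and> (\<lambda>k. p (s k \<ominus>\<^bsub>A\<^esub> t k)) \<longlonglongrightarrow> 0}"

definition seq_class :: "('a, 'm) star_alg_scheme \<Rightarrow> (nat \<Rightarrow> 'a) \<Rightarrow> (nat \<Rightarrow> 'a) set" where
  "seq_class A s = null_rel A (universal_norm A) `` {s}"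

definition repr :: "(nat \<Rightarrow> 'a) set \<Rightarrow> nat \<Rightarrow> 'a" where
  "repr C = (SOME s. s \<in> C)"

text \<open>The enveloping C*-algebra of a unital *-algebra: its separated completion in the universal
  C*-seminorm, realised by equivalence classes of Cauchy sequences.\<close>

definition enveloping_cstar_alg :: "('a, 'm) star_alg_scheme \<Rightarrow> (nat \<Rightarrow> 'a) set cstar_alg" where
  "enveloping_cstar_alg A =
     \<lparr>carrier = cauchy_seqs A (universal_norm A) // null_rel A (universal_norm A),
      mult = (\<lambda>C D. seq_class A (\<lambda>k. repr C k \<otimes>\<^bsub>A\<^esub> repr D k)),
      one = seq_class A (\<lambda>_. \<one>\<^bsub>A\<^esub>),
      zero = seq_class A (\<lambda>_. \<zero>\<^bsub>A\<^esub>),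
      add = (\<lambda>C D. seq_class A (\<lambda>k. repr C k \<oplus>\<^bsub>A\<^esub> repr D k)),
      smult = (\<lambda>c C. seq_class A (\<lambda>k. c \<odot>\<^bsub>A\<^esub> repr C k)),
      star = (\<lambda>C. seq_class A (\<lambda>k. star A (repr C k))),
      cnorm = (\<lambda>C. lim (\<lambda>k. universal_norm A (repr C k)))\<rparr>"


section \<open>Continuous functions and the crossed product by an automorphism\<close>

text \<open>The algebra of all continuous functions; used for compact spaces only, so that the supremum
  norm is finite.\<close>

definition cont_alg :: "('x::topological_space \<Rightarrow> complex) cstar_alg" where
  "cont_alg =
     \<lparr>carrier = {f. continuous_on UNIV f},
      mult = (\<lambda>f g x. f x * g x),
      one = (\<lambda>_. 1),
      zero = (\<lambda>_. 0),
      add = (\<lambda>f g x. f x + g x),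
      smult = (\<lambda>c f x. c * f x),
      star = (\<lambda>f x. cnj (f x)),
      cnorm = (\<lambda>f. SUP x. cmod (f x))\<rparr>"

text \<open>A finitely supported family \<open>f\<close> stands for the finite sum of the terms \<open>f n V\<^sup>n\<close>.
  Since \<open>V a = \<alpha> a V\<close>, one has \<open>(a V\<^sup>m) (b V\<^sup>k) = a (\<alpha>\<^sup>m b) V\<^bsup>m + k\<^esup>\<close>, and the adjoint of
  \<open>a V\<^sup>m\<close> is \<open>\<alpha>\<^bsup>- m\<^esup> (cnj a) V\<^bsup>- m\<^esup>\<close>.\<close>

definition alg_crossed_product ::
    "(('x::topological_space \<Rightarrow> complex) \<Rightarrow> ('x \<Rightarrow> complex)) \<Rightarrow> (int \<Rightarrow> 'x \<Rightarrow> complex) star_alg" where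
  "alg_crossed_product \<alpha> =
     \<lparr>carrier = {f. (\<forall>n. f n \<in> carrier cont_alg) \<and> finite {n. f n \<noteq> (\<lambda>_. 0)}},
      mult = (\<lambda>f g n x. \<Sum>m | f m \<noteq> (\<lambda>_. 0). f m x * aut_power cont_alg \<alpha> m (g (n - m)) x),
      one = (\<lambda>n x. if n = 0 then 1 else 0),
      zero = (\<lambda>n x. 0),
      add = (\<lambda>f g n x. f n x + g n x),
      smult = (\<lambda>c f n x. c * f n x),
      star = (\<lambda>f n. aut_power cont_alg \<alpha> n (\<lambda>y. cnj (f (- n) y)))\<rparr>"

definition crossed_product ::
    "(('x::topological_space \<Rightarrow> complex) \<Rightarrow> ('x \<Rightarrow> complex)) \<Rightarrow>
     (nat \<Rightarrow> int \<Rightarrow> 'x \<Rightarrow> complex) set cstar_alg" where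
  "crossed_product \<alpha> = enveloping_cstar_alg (alg_crossed_product \<alpha>)"

text \<open>The canonical conditional expectation: the continuous extension of \<open>f \<mapsto> f 0\<close>.\<close>

definition canonical_expectation :: "(nat \<Rightarrow> int \<Rightarrow> 'x \<Rightarrow> complex) set \<Rightarrow> 'x \<Rightarrow> complex" where
  "canonical_expectation C = (\<lambda>x. lim (\<lambda>k. repr C k 0 x))"


section \<open>Cocycles and skew products\<close>

definition continuous_cocycle ::
    "('g::topological_group_add \<Rightarrow> ('x::topological_space \<Rightarrow> complex) \<Rightarrow> 'x \<Rightarrow> complex) \<Rightarrow>
     ('g \<Rightarrow> 'x \<Rightarrow> complex) \<Rightarrow> bool" where
  "continuous_cocycle \<theta> u \<longleftrightarrow>
     continuous_on UNIV (\<lambda>(g, x). u g x) \<and>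
     (\<forall>g x. cmod (u g x) = 1) \<and>
     (\<forall>g h x. u (g + h) x = \<theta> g (u h) x * u g x)"

definition cocycle_power ::
    "(('x::topological_space \<Rightarrow> complex) \<Rightarrow> ('x \<Rightarrow> complex)) \<Rightarrow> ('g \<Rightarrow> 'x \<Rightarrow> complex) \<Rightarrow>
     int \<Rightarrow> 'g \<Rightarrow> 'x \<Rightarrow> complex" where
  "cocycle_power \<alpha> u n g x =
     (if 0 \<le> n then \<Prod>k\<in>{0..<n}. aut_power cont_alg \<alpha> k (u g) x
      else \<Prod>k\<in>{n..<0}. aut_power cont_alg \<alpha> k (\<lambda>y. cnj (u g y)) x)"

text \<open>The continuous extension of the *-automorphism of the algebraic crossed product that sends
  \<open>a V\<^sup>n\<close> to \<open>(\<theta> g a) u\<^sub>g\<^bsup>(n)\<^esup> V\<^sup>n\<close>; in particular it sends \<open>V\<close> to \<open>u\<^sub>g V\<close>.\<close>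

definition skew_product ::
    "('g \<Rightarrow> ('x::topological_space \<Rightarrow> complex) \<Rightarrow> 'x \<Rightarrow> complex) \<Rightarrow>
     (('x \<Rightarrow> complex) \<Rightarrow> ('x \<Rightarrow> complex)) \<Rightarrow> ('g \<Rightarrow> 'x \<Rightarrow> complex) \<Rightarrow>
     'g \<Rightarrow> (nat \<Rightarrow> int \<Rightarrow> 'x \<Rightarrow> complex) set \<Rightarrow> (nat \<Rightarrow> int \<Rightarrow> 'x \<Rightarrow> complex) set" where
  "skew_product \<theta> \<alpha> u g C =
     seq_class (alg_crossed_product \<alpha>)
       (\<lambda>k n x. \<theta> g (repr C k n) x * cocycle_power \<alpha> u n g x)"

definition gelfand_homeo ::
    "(('x::topological_space \<Rightarrow> complex) \<Rightarrow> ('x \<Rightarrow> complex)) \<Rightarrow> 'x \<Rightarrow> 'x" where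
  "gelfand_homeo \<sigma> =
     (THE T. (\<exists>T'. homeomorphism UNIV UNIV T T') \<and>
             (\<forall>a\<in>carrier cont_alg. \<forall>x. \<sigma> a x = a (T x)))"

text \<open>The unitary \<open>w\<close> in \<open>L\<^sup>\<infinity>\<close> is given by a Borel representative, which may be chosen circle-valued
  everywhere.\<close>

definition measurable_coboundary ::
    "('g \<Rightarrow> ('x::topological_space \<Rightarrow> complex) \<Rightarrow> 'x \<Rightarrow> complex) \<Rightarrow> 'x measure \<Rightarrow>
     ('g \<Rightarrow> 'x \<Rightarrow> complex) \<Rightarrow> bool" where
  "measurable_coboundary \<theta> \<mu> v \<longleftrightarrow>
     (\<exists>w\<in>borel_measurable \<mu>. (\<forall>x. cmod (w x) = 1) \<and>
        (\<forall>g. AE x in \<mu>. v g x = cnj (w (gelfand_homeo (\<theta> g) x)) * w x))"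


section \<open>Unimodular and amenable groups\<close>

text \<open>The groups considered are second countable, so regularity of Haar measure is automatic.\<close>

definition left_haar_measure :: "'g::topological_group_add measure \<Rightarrow> bool" where
  "left_haar_measure M \<longleftrightarrow>
     sets M = sets borel \<and> emeasure M UNIV \<noteq> 0 \<and>
     (\<forall>K. compact K \<longrightarrow> emeasure M K < \<infinity>) \<and>
     (\<forall>g. \<forall>B\<in>sets borel. emeasure M ((\<lambda>x. g + x) ` B) = emeasure M B)"

definition unimodular :: "'g::topological_group_add itself \<Rightarrow> bool" where
  "unimodular _ \<longleftrightarrow>
     (\<exists>M :: 'g measure. left_haar_measure M \<and>
        (\<forall>g. \<forall>B\<in>sets borel. emeasure M ((\<lambda>x. x + g) ` B) = emeasure M B))"

text \<open>Amenability: a left-invariant mean on \<open>L\<^sup>\<infinity>\<close> of the group with respect to Haar measure, presented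
  as a functional on bounded Borel functions. Positivity for functions that are nonnegative almost
  everywhere makes it depend only on almost everywhere classes.\<close>

definition amenable :: "'g::topological_group_add itself \<Rightarrow> bool" where
  "amenable _ \<longleftrightarrow>
     (\<exists>(M :: 'g measure) (m :: ('g \<Rightarrow> real) \<Rightarrow> real).
        left_haar_measure M \<and> m (\<lambda>_. 1) = 1 \<and>
        (let L = {f \<in> borel_measurable M. bounded (range f)} in
          (\<forall>f\<in>L. (AE x in M. 0 \<le> f x) \<longrightarrow> 0 \<le> m f) \<and>
          (\<forall>f\<in>L. \<forall>h\<in>L. m (\<lambda>x. f x + h x) = m f + m h) \<and>
          (\<forall>c. \<forall>f\<in>L. m (\<lambda>x. c * f x) = c * m f) \<and>
          (\<forall>g. \<forall>f\<in>L. m (\<lambda>x. f (g + x)) = m f)))"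

end

theory Submission
  imports Defs
begin

text \<open>States of the crossed product correspond to positive unital functionals on the algebraic crossed
  product: the GNS seminorm of such a functional is a C*-seminorm, because the algebra is spanned by
  isometries.

  Let \<open>\<psi>\<close> be an invariant functional. On \<open>C(X\<^sub>0)\<close> it is \<open>\<omega>\<^sub>0\<close>, and by Cauchy-Schwarz \<open>a \<mapsto> \<psi> (a V\<^sup>n)\<close>
  is bounded in \<open>L\<^sup>2(\<mu>\<^sub>0)\<close>, hence of the form \<open>\<integral> a h\<close>. Invariance says \<open>u\<^sub>g\<^bsup>(n)\<^esup> h = \<theta>\<^sub>g(h)\<close>, so \<open>|h|\<close> is
  invariant and, by ergodicity of \<open>\<mu>\<^sub>0\<close>, constant. If the constant is not zero, normalising \<open>h\<^sup>*\<close> exhibits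
  \<open>u\<^bsup>(n)\<^esup>\<close> as a coboundary. Conversely, \<open>u\<^sub>g\<^bsup>(n)\<^esup> = \<theta>\<^sub>g(w\<^sup>*) w\<close> makes a vector state of the regular
  representation built from \<open>w\<close> invariant, and this state does not vanish on \<open>C(X\<^sub>0) V\<^sup>n\<close>.\<close>

section \<open>Positive functionals and GNS seminorms\<close>

text \<open>The universal norm is a supremum over all C*-seminorms, with no formula to compute it
  from. Two facts about it carry the transfer to the dense star-algebra: it is finite, and it
  dominates every positive unital functional. Isometries settle both, since any C*-seminorm is at
  most 1 on them and left multiplication by them preserves the GNS seminorm. The coefficients of a
  state can then be studied one degree at a time. The state that breaks uniqueness comes from
  \<open>W = w V^n\<close>. The relation \<open>u_g^(n) = \<theta>_g(cnj w) w\<close> says exactly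
  that W is fixed by the skew product. As \<open>w\<close> is only measurable, W need not lie in the
  C*-algebra, but it is a unitary over L^inf, and f -> E((1 + W) f star(1 + W)) / 2 followed by the
  integral is positive, invariant and, for nonzero n, unital. Expanding the product gives the four
  terms of \<open>twist\<close>; its coefficient at \<open>a V^n\<close> is half the integral of
  \<open>a cnj w\<close>, which cannot vanish for every continuous \<open>a\<close>.\<close>

lemma nonneg_form_bound:
  fixes p q r s :: complex
  assumes "\<And>z. p + z * q + cnj z * r + z * cnj z * s \<in> \<real> \<and> 0 \<le> Re (p + z * q + cnj z * r + z * cnj z * s)"
    and s: "s \<in> \<real>" "0 \<le> Re s"
  shows "r = cnj q" and "(cmod q)\<^sup>2 \<le> Re p * Re s"
proof -
  have H: "Im (p + z * q + cnj z * r + z * cnj z * s) = 0"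
          "0 \<le> Re (p + z * q + cnj z * r + z * cnj z * s)" for z
    using assms(1)[of z] complex_is_Real_iff by blast+
  have ims: "Im s = 0" using s complex_is_Real_iff by blast
  have p0: "Im p = 0" "0 \<le> Re p" using H[of 0] by auto
  \<comment> \<open>Real-valuedness at z = 1 compares the imaginary parts of \<open>q\<close> and
    \<open>r\<close>, at z = i their real parts.\<close>
  have "Im r = - Im q" using H(1)[of 1] p0 ims by simp
  moreover have "Re r = Re q" using H(1)[of \<i>] p0 ims by simp
  ultimately show r: "r = cnj q" by (simp add: complex_eq_iff)
  have K: "0 \<le> Re p + 2 * Re (z * q) + (cmod z)\<^sup>2 * Re s" for z
  proof -
    have "Re (p + z * q + cnj z * r + z * cnj z * s) = Re p + 2 * Re (z * q) + (cmod z)\<^sup>2 * Re s"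
      unfolding r cmod_power2 by (simp add: ims power2_eq_square algebra_simps)
    then show ?thesis using H(2)[of z] by linarith
  qed
  show "(cmod q)\<^sup>2 \<le> Re p * Re s"
  proof (cases "Re s = 0")
    case True
    have "cmod q = 0"
    proof (rule ccontr)
      assume "cmod q \<noteq> 0"
      then have pos: "(cmod q)\<^sup>2 > 0" by simp
      \<comment> \<open>Without the quadratic term the bound \<open>K\<close> is affine in z; this
        \<open>t\<close> makes its value at \<open>- t * cnj q\<close> equal to -1.\<close>
      define t where "t = (Re p + 1) / (2 * (cmod q)\<^sup>2)"
      have "Re (- of_real t * cnj q * q) = - (t * (cmod q)\<^sup>2)"
        unfolding cmod_power2 by (simp add: power2_eq_square algebra_simps)
      then have "0 \<le> Re p - 2 * (t * (cmod q)\<^sup>2)" using K[of "- of_real t * cnj q"] True by simp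
      moreover have "2 * (t * (cmod q)\<^sup>2) = Re p + 1" using pos by (simp add: t_def field_simps)
      ultimately show False by simp
    qed
    then show ?thesis using True by simp
  next
    case False
    then have pos: "Re s > 0" using s by simp
    \<comment> \<open>The minimiser of the quadratic expression in \<open>K\<close>.\<close>
    define z where "z = - cnj q / of_real (Re s)"
    have 1: "Re (z * q) = - ((cmod q)\<^sup>2 / Re s)"
      unfolding z_def by (simp add: cmod_power2 field_simps) (simp add: power2_eq_square)
    have 2: "(cmod z)\<^sup>2 * Re s = (cmod q)\<^sup>2 / Re s"
      using pos unfolding z_def by (simp add: norm_divide power2_eq_square field_simps)
    show ?thesis using K[of z] pos unfolding 1 2 by (simp add: field_simps)
  qed
qed

section \<open>Calculus in a unital star-algebra\<close>

locale star_alg =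
  fixes A :: "('a, 'm) star_alg_scheme" (structure)
  assumes star_algebra: "star_algebra A"
begin

sublocale ring A
  using star_algebra by (simp add: star_algebra_def)

lemma module_complex: "module complex_field A"
  using star_algebra by (simp add: star_algebra_def)

lemma smult_closed [simp, intro]: "a \<in> carrier A \<Longrightarrow> c \<odot> a \<in> carrier A"
  using module.smult_closed[OF module_complex, of c a] by (simp add: complex_field_def)

lemma smult_add_left: "a \<in> carrier A \<Longrightarrow> (c + d) \<odot> a = c \<odot> a \<oplus> d \<odot> a"
  using module.smult_l_distr[OF module_complex, of c d a] by (simp add: complex_field_def)

lemma smult_add_right: "a \<in> carrier A \<Longrightarrow> b \<in> carrier A \<Longrightarrow> c \<odot> (a \<oplus> b) = c \<odot> a \<oplus> c \<odot> b"
  using module.smult_r_distr[OF module_complex, of c a b] by (simp add: complex_field_def)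

lemma smult_smult: "a \<in> carrier A \<Longrightarrow> c \<odot> (d \<odot> a) = (c * d) \<odot> a"
  using module.smult_assoc1[OF module_complex, of c d a] by (simp add: complex_field_def)

lemma smult_1 [simp]: "a \<in> carrier A \<Longrightarrow> 1 \<odot> a = a"
  using module.smult_one[OF module_complex, of a] by (simp add: complex_field_def)

lemma smult_mult_left: "a \<in> carrier A \<Longrightarrow> b \<in> carrier A \<Longrightarrow> (c \<odot> a) \<otimes> b = c \<odot> (a \<otimes> b)"
  and smult_mult_right: "a \<in> carrier A \<Longrightarrow> b \<in> carrier A \<Longrightarrow> a \<otimes> (c \<odot> b) = c \<odot> (a \<otimes> b)"
  and star_closed [simp, intro]: "a \<in> carrier A \<Longrightarrow> star A a \<in> carrier A"
  and star_star [simp]: "a \<in> carrier A \<Longrightarrow> star A (star A a) = a"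
  and star_smult: "a \<in> carrier A \<Longrightarrow> star A (c \<odot> a) = cnj c \<odot> star A a"
  and star_add: "a \<in> carrier A \<Longrightarrow> b \<in> carrier A \<Longrightarrow> star A (a \<oplus> b) = star A a \<oplus> star A b"
  and star_mult: "a \<in> carrier A \<Longrightarrow> b \<in> carrier A \<Longrightarrow> star A (a \<otimes> b) = star A b \<otimes> star A a"
  using star_algebra by (auto simp: star_algebra_def)

lemma smult_0 [simp]: "a \<in> carrier A \<Longrightarrow> 0 \<odot> a = \<zero>"
  using smult_add_left[of a 0 0] by (metis add.r_cancel_one' add_0 smult_closed)

lemma minus_eq_smult: "a \<in> carrier A \<Longrightarrow> \<ominus> a = (- 1) \<odot> a"
  using smult_add_left[of a "- 1" 1] by (simp add: minus_equality)

lemma diff_eq: "a \<in> carrier A \<Longrightarrow> b \<in> carrier A \<Longrightarrow> a \<ominus> b = a \<oplus> (- 1) \<odot> b"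
  by (simp add: a_minus_def minus_eq_smult)

lemma star_one [simp]: "star A \<one> = \<one>"
  using star_mult[of \<one> "star A \<one>"] by simp

lemma star_diff: "a \<in> carrier A \<Longrightarrow> b \<in> carrier A \<Longrightarrow> star A (a \<ominus> b) = star A a \<ominus> star A b"
  by (simp add: diff_eq star_add star_smult)

lemma mult_diff:
  assumes "a \<in> carrier A" "b \<in> carrier A" "c \<in> carrier A" "d \<in> carrier A"
  shows "a \<otimes> b \<ominus> c \<otimes> d = a \<otimes> (b \<ominus> d) \<oplus> (a \<ominus> c) \<otimes> d"
  using assms by algebra

lemma add_diff:
  assumes "a \<in> carrier A" "b \<in> carrier A" "c \<in> carrier A" "d \<in> carrier A"
  shows "(a \<oplus> b) \<ominus> (c \<oplus> d) = (a \<ominus> c) \<oplus> (b \<ominus> d)"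
  using assms by algebra

lemma smult_diff:
  "a \<in> carrier A \<Longrightarrow> b \<in> carrier A \<Longrightarrow> c \<odot> a \<ominus> c \<odot> b = c \<odot> (a \<ominus> b)"
  by (simp add: diff_eq smult_add_right smult_smult mult.commute)

lemma diff_telescope:
  assumes "a \<in> carrier A" "b \<in> carrier A" "c \<in> carrier A"
  shows "a \<ominus> c = (a \<ominus> b) \<oplus> (b \<ominus> c)"
  using assms by algebra

end

text \<open>The contractivity clause of \<open>state\<close> is omitted because a star-algebra
  carries no norm of its own; \<open>algebraic_state_bounded\<close> recovers it for the universal
  norm.\<close>

definition algebraic_state :: "('a, 'm) star_alg_scheme \<Rightarrow> ('a \<Rightarrow> complex) \<Rightarrow> bool" where
  "algebraic_state A \<psi> \<longleftrightarrow>
     (\<forall>c. \<forall>a\<in>carrier A. \<psi> (c \<odot>\<^bsub>A\<^esub> a) = c * \<psi> a) \<and>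
     (\<forall>a\<in>carrier A. \<forall>b\<in>carrier A. \<psi> (a \<oplus>\<^bsub>A\<^esub> b) = \<psi> a + \<psi> b) \<and>
     (\<forall>a\<in>carrier A. \<psi> (star A a \<otimes>\<^bsub>A\<^esub> a) \<in> \<real> \<and> 0 \<le> Re (\<psi> (star A a \<otimes>\<^bsub>A\<^esub> a))) \<and>
     \<psi> \<one>\<^bsub>A\<^esub> = 1"

text \<open>The length of the vector given by \<open>a\<close> in the GNS space of
  \<open>\<psi>\<close>.\<close>

definition state_seminorm :: "('a, 'm) star_alg_scheme \<Rightarrow> ('a \<Rightarrow> complex) \<Rightarrow> 'a \<Rightarrow> real" where
  "state_seminorm A \<psi> a = sqrt (Re (\<psi> (star A a \<otimes>\<^bsub>A\<^esub> a)))"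

text \<open>A bound known for isometries survives scaling and addition, so rule induction spreads it
  over the whole span.\<close>

inductive_set isometry_span :: "('a, 'm) star_alg_scheme \<Rightarrow> 'a set" for A :: "('a, 'm) star_alg_scheme" where
  isometry: "a \<in> carrier A \<Longrightarrow> star A a \<otimes>\<^bsub>A\<^esub> a = \<one>\<^bsub>A\<^esub> \<Longrightarrow> a \<in> isometry_span A"
| smult: "a \<in> isometry_span A \<Longrightarrow> c \<odot>\<^bsub>A\<^esub> a \<in> isometry_span A"
| add: "a \<in> isometry_span A \<Longrightarrow> b \<in> isometry_span A \<Longrightarrow> a \<oplus>\<^bsub>A\<^esub> b \<in> isometry_span A"

locale star_alg_state = star_alg +
  fixes \<psi>
  assumes algebraic_state: "algebraic_state A \<psi>"
begin

lemma \<psi>_smult: "a \<in> carrier A \<Longrightarrow> \<psi> (c \<odot> a) = c * \<psi> a"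
  and \<psi>_add: "a \<in> carrier A \<Longrightarrow> b \<in> carrier A \<Longrightarrow> \<psi> (a \<oplus> b) = \<psi> a + \<psi> b"
  and \<psi>_real: "a \<in> carrier A \<Longrightarrow> \<psi> (star A a \<otimes> a) \<in> \<real>"
  and \<psi>_nonneg: "a \<in> carrier A \<Longrightarrow> 0 \<le> Re (\<psi> (star A a \<otimes> a))"
  and \<psi>_one: "\<psi> \<one> = 1"
  using algebraic_state by (auto simp: algebraic_state_def)

abbreviation "q \<equiv> state_seminorm A \<psi>"

lemma form_expand:
  assumes [simp]: "a \<in> carrier A" "b \<in> carrier A"
  shows "\<psi> (star A (a \<oplus> z \<odot> b) \<otimes> (a \<oplus> z \<odot> b)) =
    \<psi> (star A a \<otimes> a) + z * \<psi> (star A a \<otimes> b) + cnj z * \<psi> (star A b \<otimes> a) + z * cnj z * \<psi> (star A b \<otimes> b)"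
  by (simp add: star_add star_smult l_distr r_distr smult_mult_left smult_mult_right \<psi>_add \<psi>_smult smult_smult
      algebra_simps)

text \<open>Positivity of \<open>\<psi>\<close> at \<open>a + z b\<close> for every complex z is
  exactly the hypothesis of \<open>nonneg_form_bound\<close>.\<close>

lemma
  assumes [simp]: "a \<in> carrier A" "b \<in> carrier A"
  shows hermitian_form: "\<psi> (star A b \<otimes> a) = cnj (\<psi> (star A a \<otimes> b))"
    and cauchy_schwarz: "cmod (\<psi> (star A a \<otimes> b)) \<le> q a * q b"
proof -
  have *: "\<psi> (star A a \<otimes> a) + z * \<psi> (star A a \<otimes> b) + cnj z * \<psi> (star A b \<otimes> a) + z * cnj z * \<psi> (star A b \<otimes> b) \<in> \<real> \<and>
    0 \<le> Re (\<psi> (star A a \<otimes> a) + z * \<psi> (star A a \<otimes> b) + cnj z * \<psi> (star A b \<otimes> a) + z * cnj z * \<psi> (star A b \<otimes> b))" for z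
    unfolding form_expand[symmetric, OF assms] by (simp add: \<psi>_real \<psi>_nonneg)
  show "\<psi> (star A b \<otimes> a) = cnj (\<psi> (star A a \<otimes> b))"
    by (rule nonneg_form_bound(1)[OF *]) (simp_all add: \<psi>_real \<psi>_nonneg)
  have "(cmod (\<psi> (star A a \<otimes> b)))\<^sup>2 \<le> Re (\<psi> (star A a \<otimes> a)) * Re (\<psi> (star A b \<otimes> b))"
    by (rule nonneg_form_bound(2)[OF *]) (simp_all add: \<psi>_real \<psi>_nonneg)
  then show "cmod (\<psi> (star A a \<otimes> b)) \<le> q a * q b"
    unfolding state_seminorm_def real_sqrt_mult[symmetric] by (rule real_le_rsqrt)
qed

lemma q_square: "a \<in> carrier A \<Longrightarrow> (q a)\<^sup>2 = Re (\<psi> (star A a \<otimes> a))"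
  by (simp add: state_seminorm_def \<psi>_nonneg)

lemma q_nonneg [simp]: "a \<in> carrier A \<Longrightarrow> 0 \<le> q a"
  by (simp add: state_seminorm_def \<psi>_nonneg)

lemma q_smult: "a \<in> carrier A \<Longrightarrow> q (c \<odot> a) = cmod c * q a"
proof -
  assume a: "a \<in> carrier A"
  have "\<psi> (star A (c \<odot> a) \<otimes> (c \<odot> a)) = of_real ((cmod c)\<^sup>2) * \<psi> (star A a \<otimes> a)"
    unfolding complex_norm_square
    using a by (simp add: star_smult smult_mult_left smult_mult_right \<psi>_smult mult_ac)
  then show ?thesis by (simp add: state_seminorm_def real_sqrt_mult)
qed

lemma q_add: 
  assumes [simp]: "a \<in> carrier A" "b \<in> carrier A"
  shows "q (a \<oplus> b) \<le> q a + q b"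
proof -
  have "(q (a \<oplus> b))\<^sup>2 = (q a)\<^sup>2 + 2 * Re (\<psi> (star A a \<otimes> b)) + (q b)\<^sup>2"
    using form_expand[of a b 1] hermitian_form[of a b] by (simp add: q_square)
  also have "\<dots> \<le> (q a)\<^sup>2 + 2 * (q a * q b) + (q b)\<^sup>2"
    using cauchy_schwarz[of a b] complex_Re_le_cmod[of "\<psi> (star A a \<otimes> b)"] by simp
  also have "\<dots> = (q a + q b)\<^sup>2" by (simp add: power2_sum)
  finally show ?thesis by (rule power2_le_imp_le) simp
qed

lemma q_one: "q \<one> = 1"
  by (simp add: state_seminorm_def \<psi>_one)

text \<open>An isometry \<open>b\<close> satisfies star(b c) (b c) = star(c) c, so it preserves
  \<open>q\<close> and K = 1 works. Hence the GNS representation acts by bounded operators although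
  no norm on the algebra is available.\<close>

lemma isometry_span_bounded:
  "b \<in> isometry_span A \<Longrightarrow> b \<in> carrier A \<and> (\<exists>K\<ge>0. \<forall>c\<in>carrier A. q (b \<otimes> c) \<le> K * q c)"
proof (induction rule: isometry_span.induct)
  case (isometry b)
  have "q (b \<otimes> c) = q c" if [simp]: "c \<in> carrier A" for c
  proof -
    have "star A (b \<otimes> c) \<otimes> (b \<otimes> c) = star A c \<otimes> (star A b \<otimes> b) \<otimes> c"
      using isometry(1) by (simp add: star_mult m_assoc)
    then show ?thesis using isometry by (simp add: state_seminorm_def)
  qed
  then show ?case using isometry(1) by (auto intro!: exI[of _ 1])
next
  case (smult b d)
  then obtain K where "b \<in> carrier A" "K \<ge> 0" "\<And>c. c \<in> carrier A \<Longrightarrow> q (b \<otimes> c) \<le> K * q c" by blast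
  then show ?case
    by (auto intro!: exI[of _ "cmod d * K"] mult_left_mono simp: smult_mult_left q_smult mult.assoc)
next
  case (add a b)
  then obtain K L where *: "a \<in> carrier A" "K \<ge> 0" "\<And>c. c \<in> carrier A \<Longrightarrow> q (a \<otimes> c) \<le> K * q c" 
     "b \<in> carrier A" "L \<ge> 0" "\<And>c. c \<in> carrier A \<Longrightarrow> q (b \<otimes> c) \<le> L * q c" by blast
  have "q ((a \<oplus> b) \<otimes> c) \<le> (K + L) * q c" if "c \<in> carrier A" for c
    using *(1,4) *(3)[OF that] *(6)[OF that] that q_add[of "a \<otimes> c" "b \<otimes> c"]
    by (simp add: l_distr distrib_right)
  then show ?case using * by (auto intro!: exI[of _ "K + L"])
qed

text \<open>The operator norm of left multiplication by \<open>b\<close> on the GNS space.\<close>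

definition gns_norm where
  "gns_norm b = Sup ((\<lambda>c. q (b \<otimes> c)) ` {c \<in> carrier A. q c \<le> 1})"

end

locale isometry_star_alg = star_alg +
  assumes isometry_span: "carrier A \<subseteq> isometry_span A"

locale isometry_star_alg_state = isometry_star_alg A + star_alg_state A \<psi> for A (structure) and \<psi>
begin

lemma gns_bdd:
  assumes b: "b \<in> carrier A"
  shows "bdd_above ((\<lambda>c. q (b \<otimes> c)) ` {c \<in> carrier A. q c \<le> 1})"
proof -
  obtain K where K: "K \<ge> 0" "\<And>c. c \<in> carrier A \<Longrightarrow> q (b \<otimes> c) \<le> K * q c"
    using isometry_span_bounded[OF subsetD[OF isometry_span b]] by blast
  have "q (b \<otimes> c) \<le> K" if "c \<in> carrier A" "q c \<le> 1" for c
    using K(2)[OF that(1)] mult_left_mono[OF that(2) K(1)] by simp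
  then show ?thesis by (intro bdd_aboveI2[where M = K]) simp
qed

lemma gns_norm_bound:
  assumes b: "b \<in> carrier A" and c: "c \<in> carrier A"
  shows "q (b \<otimes> c) \<le> gns_norm b * q c"
proof (cases "q c = 0")
  case True
  \<comment> \<open>A null vector cannot be rescaled to length 1; the bound from the isometry span
    shows that \<open>b\<close> maps it to a null vector.\<close>
  obtain K where K: "K \<ge> 0" "\<And>c. c \<in> carrier A \<Longrightarrow> q (b \<otimes> c) \<le> K * q c"
    using isometry_span_bounded[OF subsetD[OF isometry_span b]] by blast
  show ?thesis using K(2)[OF c] True by simp
next
  case False
  then have pos: "q c > 0" using c by (simp add: less_le)
  have "q (b \<otimes> (of_real (inverse (q c)) \<odot> c)) \<le> gns_norm b"
    unfolding gns_norm_def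
    by (rule cSup_upper[OF imageI gns_bdd[OF b]]) (use c pos in \<open>simp add: q_smult norm_inverse\<close>)
  then have "inverse (q c) * q (b \<otimes> c) \<le> gns_norm b"
    using b c pos by (simp add: smult_mult_right q_smult norm_inverse)
  then show ?thesis using pos by (simp add: field_simps)
qed

lemma gns_norm_nonneg: "b \<in> carrier A \<Longrightarrow> 0 \<le> gns_norm b"
  using order_trans[OF q_nonneg gns_norm_bound[of b \<one>]] by (simp add: q_one)

lemma gns_norm_le:
  assumes "0 \<le> M" and "\<And>c. c \<in> carrier A \<Longrightarrow> q (b \<otimes> c) \<le> M * q c"
  shows "gns_norm b \<le> M"
  unfolding gns_norm_def
proof (rule cSUP_least)
  have "\<zero> \<in> {c \<in> carrier A. q c \<le> 1}" using q_smult[of \<one> 0] by simp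
  then show "{c \<in> carrier A. q c \<le> 1} \<noteq> {}" by blast
  fix c assume "c \<in> {c \<in> carrier A. q c \<le> 1}"
  then show "q (b \<otimes> c) \<le> M" using assms(2)[of c] mult_left_mono[of "q c" 1 M] assms(1) by auto
qed

lemma gns_norm_smult_le:
  "b \<in> carrier A \<Longrightarrow> gns_norm (c \<odot> b) \<le> cmod c * gns_norm b"
  by (rule gns_norm_le)
    (simp_all add: gns_norm_nonneg smult_mult_left q_smult gns_norm_bound mult_left_mono mult.assoc)

lemma gns_norm_mult_le:
  assumes [simp]: "a \<in> carrier A" "b \<in> carrier A"
  shows "gns_norm (a \<otimes> b) \<le> gns_norm a * gns_norm b"
proof (rule gns_norm_le)
  show "0 \<le> gns_norm a * gns_norm b" by (simp add: gns_norm_nonneg)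
  fix c assume [simp]: "c \<in> carrier A"
  have "q (a \<otimes> b \<otimes> c) \<le> gns_norm a * q (b \<otimes> c)" by (simp add: gns_norm_bound m_assoc)
  also have "\<dots> \<le> gns_norm a * (gns_norm b * q c)"
    by (intro mult_left_mono gns_norm_bound gns_norm_nonneg) simp_all
  finally show "q (a \<otimes> b \<otimes> c) \<le> gns_norm a * gns_norm b * q c" by (simp add: mult.assoc)
qed

text \<open>The squared length of \<open>b c\<close> is the inner product of \<open>c\<close> with
  star(b) b c; Cauchy-Schwarz does the rest. Both the adjoint estimate and the C*-identity rest on
  this.\<close>

lemma q_mult_square_le:
  assumes [simp]: "b \<in> carrier A" "c \<in> carrier A"
  shows "(q (b \<otimes> c))\<^sup>2 \<le> q c * q (star A b \<otimes> (b \<otimes> c))"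
proof -
  have "star A (b \<otimes> c) \<otimes> (b \<otimes> c) = star A c \<otimes> (star A b \<otimes> (b \<otimes> c))"
    by (simp add: star_mult m_assoc)
  then show ?thesis
    using cauchy_schwarz[of c "star A b \<otimes> (b \<otimes> c)"] complex_Re_le_cmod[of "\<psi> (star A (b \<otimes> c) \<otimes> (b \<otimes> c))"]
    by (simp add: q_square)
qed

text \<open>Applying \<open>q_mult_square_le\<close> to the adjoint bounds the square of
  \<open>?x\<close> by a multiple of \<open>?x\<close> itself, and one factor cancels.\<close>

lemma gns_norm_star_le:
  assumes [simp]: "b \<in> carrier A"
  shows "gns_norm (star A b) \<le> gns_norm b"
proof (rule gns_norm_le)
  show "0 \<le> gns_norm b" by (simp add: gns_norm_nonneg)
  fix c assume [simp]: "c \<in> carrier A"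
  let ?x = "q (star A b \<otimes> c)"
  have "?x\<^sup>2 \<le> q c * q (b \<otimes> (star A b \<otimes> c))"
    using q_mult_square_le[of "star A b" c] by simp
  also have "\<dots> \<le> q c * (gns_norm b * ?x)"
    by (intro mult_left_mono gns_norm_bound) simp_all
  finally have *: "?x * ?x \<le> (gns_norm b * q c) * ?x" by (simp add: power2_eq_square mult_ac)
  show "?x \<le> gns_norm b * q c"
  proof (cases "?x = 0")
    case False
    then have "?x > 0" by (simp add: less_le)
    with * show ?thesis by simp
  qed (simp add: gns_norm_nonneg)
qed

lemma gns_norm_cstar:
  assumes [simp]: "a \<in> carrier A"
  shows "gns_norm (star A a \<otimes> a) = (gns_norm a)\<^sup>2"
proof (rule antisym)
  have "gns_norm (star A a \<otimes> a) \<le> gns_norm (star A a) * gns_norm a" by (simp add: gns_norm_mult_le)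
  also have "\<dots> \<le> (gns_norm a)\<^sup>2"
    unfolding power2_eq_square by (intro mult_right_mono gns_norm_star_le gns_norm_nonneg) simp_all
  finally show "gns_norm (star A a \<otimes> a) \<le> (gns_norm a)\<^sup>2" .
  \<comment> \<open>With the square root on the right, the estimate is a plain operator bound and
    \<open>gns_norm_le\<close> applies vector by vector.\<close>
  have "gns_norm a \<le> sqrt (gns_norm (star A a \<otimes> a))"
  proof (rule gns_norm_le)
    show "0 \<le> sqrt (gns_norm (star A a \<otimes> a))" by (simp add: gns_norm_nonneg)
    fix c assume [simp]: "c \<in> carrier A"
    have "(q (a \<otimes> c))\<^sup>2 \<le> q c * q (star A a \<otimes> a \<otimes> c)"
      using q_mult_square_le[of a c] by (simp add: m_assoc)
    also have "\<dots> \<le> q c * (gns_norm (star A a \<otimes> a) * q c)"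
      by (intro mult_left_mono gns_norm_bound) simp_all
    also have "\<dots> = (sqrt (gns_norm (star A a \<otimes> a)) * q c)\<^sup>2"
      by (simp add: gns_norm_nonneg power_mult_distrib power2_eq_square[of "q c"])
    finally show "q (a \<otimes> c) \<le> sqrt (gns_norm (star A a \<otimes> a)) * q c"
      by (rule power2_le_imp_le) (simp add: gns_norm_nonneg)
  qed
  then have "(gns_norm a)\<^sup>2 \<le> (sqrt (gns_norm (star A a \<otimes> a)))\<^sup>2"
    by (intro power_mono gns_norm_nonneg assms)
  then show "(gns_norm a)\<^sup>2 \<le> gns_norm (star A a \<otimes> a)" by (simp add: gns_norm_nonneg)
qed

lemma gns_norm_cstar_seminorm: "cstar_seminorm A gns_norm"
  unfolding cstar_seminorm_def
proof (intro conjI ballI allI)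
  fix c b assume [simp]: "b \<in> carrier A"
  show "gns_norm (c \<odot> b) = cmod c * gns_norm b"
  proof (cases "c = 0")
    case True
    then show ?thesis using gns_norm_smult_le[of b 0] gns_norm_nonneg[of \<zero>] by simp
  next
    case False
    have "gns_norm b = gns_norm (inverse c \<odot> (c \<odot> b))" using False by (simp add: smult_smult)
    also have "\<dots> \<le> cmod (inverse c) * gns_norm (c \<odot> b)" by (rule gns_norm_smult_le) simp
    finally have "cmod c * gns_norm b \<le> gns_norm (c \<odot> b)"
      using False by (simp add: norm_divide field_simps)
    then show ?thesis using gns_norm_smult_le[of b c] by simp
  qed
next
  fix a b assume [simp]: "a \<in> carrier A" "b \<in> carrier A"
  show "gns_norm (a \<oplus> b) \<le> gns_norm a + gns_norm b"
  proof (rule gns_norm_le)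
    show "0 \<le> gns_norm a + gns_norm b" by (simp add: gns_norm_nonneg)
    fix c assume [simp]: "c \<in> carrier A"
    show "q ((a \<oplus> b) \<otimes> c) \<le> (gns_norm a + gns_norm b) * q c"
      using q_add[of "a \<otimes> c" "b \<otimes> c"] gns_norm_bound[of a c] gns_norm_bound[of b c]
      by (simp add: l_distr distrib_right)
  qed
qed (simp_all add: gns_norm_nonneg gns_norm_mult_le gns_norm_cstar)

text \<open>The unit is the cyclic vector, it has length 1, and \<open>\<psi> b\<close> is its
  matrix coefficient.\<close>

lemma cmod_\<psi>_le_gns_norm: "b \<in> carrier A \<Longrightarrow> cmod (\<psi> b) \<le> gns_norm b"
  using cauchy_schwarz[of \<one> b] gns_norm_bound[of b \<one>] by (simp add: q_one)

end


section \<open>States of enveloping C*-algebras\<close>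

text \<open>Weaker than \<open>star_automorphism\<close>: pulling a C*-seminorm back along such a
  map already yields a C*-seminorm, and contractivity follows from that.\<close>

definition star_endomorphism :: "('a, 'm) star_alg_scheme \<Rightarrow> ('a \<Rightarrow> 'a) \<Rightarrow> bool" where
  "star_endomorphism A \<tau> \<longleftrightarrow>
     (\<forall>a\<in>carrier A. \<tau> a \<in> carrier A) \<and>
     (\<forall>c. \<forall>a\<in>carrier A. \<tau> (c \<odot>\<^bsub>A\<^esub> a) = c \<odot>\<^bsub>A\<^esub> \<tau> a) \<and>
     (\<forall>a\<in>carrier A. \<tau> (star A a) = star A (\<tau> a)) \<and>
     (\<forall>a\<in>carrier A. \<forall>b\<in>carrier A.
        \<tau> (a \<oplus>\<^bsub>A\<^esub> b) = \<tau> a \<oplus>\<^bsub>A\<^esub> \<tau> b \<and> \<tau> (a \<otimes>\<^bsub>A\<^esub> b) = \<tau> a \<otimes>\<^bsub>A\<^esub> \<tau> b)"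

section \<open>The universal norm and its completion by Cauchy sequences\<close>

context isometry_star_alg
begin

abbreviation "N \<equiv> universal_norm A"
abbreviation "CS \<equiv> cauchy_seqs A N"
abbreviation "B \<equiv> enveloping_cstar_alg A"

text \<open>Makes the family in the supremum of \<open>universal_norm\<close> nonempty.\<close>

lemma zero_cstar_seminorm: "cstar_seminorm A (\<lambda>_. 0)"
  by (simp add: cstar_seminorm_def)

text \<open>The C*-identity at the unit says that \<open>p \<one>\<close> equals its own square, so
  it is 0 or 1, and at an isometry it then gives \<open>p b \<le> 1\<close>. The bound K is uniform
  in \<open>p\<close>, which makes the supremum defining \<open>universal_norm\<close>
  finite.\<close>

lemma isometry_span_seminorm_bounded:
  "b \<in> isometry_span A \<Longrightarrow> b \<in> carrier A \<and> (\<exists>K. \<forall>p. cstar_seminorm A p \<longrightarrow> p b \<le> K)"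
proof (induction rule: isometry_span.induct)
  case (isometry b)
  have "p b \<le> 1" if p: "cstar_seminorm A p" for p
  proof -
    have *: "p (star A a \<otimes> a) = (p a)\<^sup>2" if "a \<in> carrier A" for a
      using p that by (simp add: cstar_seminorm_def)
    have "0 \<le> p \<one>" using p by (simp add: cstar_seminorm_def)
    moreover have "p \<one> = p \<one> * p \<one>" using *[of \<one>] by (simp add: power2_eq_square)
    ultimately have "p \<one> \<le> 1" by (metis mult_cancel_right1 order_refl zero_le_one)
    then have "(p b)\<^sup>2 \<le> 1\<^sup>2" using *[of b] isometry by simp
    then show "p b \<le> 1" by (rule power2_le_imp_le) simp
  qed
  then show ?case using isometry(1) by blast
next
  case (smult b c)
  then obtain K where K: "b \<in> carrier A" "\<And>p. cstar_seminorm A p \<Longrightarrow> p b \<le> K" by blast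
  have "p (c \<odot> b) \<le> cmod c * K" if "cstar_seminorm A p" for p
    using K(2)[OF that] that K(1) by (simp add: cstar_seminorm_def mult_left_mono)
  then show ?case using K(1) by blast
next
  case (add a b)
  then obtain K L where K: "a \<in> carrier A" "\<And>p. cstar_seminorm A p \<Longrightarrow> p a \<le> K"
    and L: "b \<in> carrier A" "\<And>p. cstar_seminorm A p \<Longrightarrow> p b \<le> L" by blast
  have "p (a \<oplus> b) \<le> K + L" if p: "cstar_seminorm A p" for p
  proof -
    have "p (a \<oplus> b) \<le> p a + p b" using p K(1) L(1) by (simp add: cstar_seminorm_def)
    then show ?thesis using K(2)[OF p] L(2)[OF p] by linarith
  qed
  then show ?case using K(1) L(1) by blast
qed

lemma seminorm_le_universal_norm:
  assumes p: "cstar_seminorm A p" and a: "a \<in> carrier A"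
  shows "p a \<le> N a"
proof -
  obtain K where K: "\<And>p. cstar_seminorm A p \<Longrightarrow> p a \<le> K"
    using isometry_span_seminorm_bounded[OF subsetD[OF isometry_span a]] by blast
  have "bdd_above ((\<lambda>p. p a) ` {p. cstar_seminorm A p})"
    by (intro bdd_aboveI2[where M = K]) (simp add: K)
  then show ?thesis
    unfolding universal_norm_def by (intro cSup_upper imageI) (simp_all add: p)
qed

lemma universal_norm_le:
  assumes "\<And>p. cstar_seminorm A p \<Longrightarrow> p a \<le> M"
  shows "N a \<le> M"
  unfolding universal_norm_def
proof (rule cSUP_least)
  show "{p. cstar_seminorm A p} \<noteq> {}" using zero_cstar_seminorm by blast
qed (simp add: assms)

lemma N_nonneg: "a \<in> carrier A \<Longrightarrow> 0 \<le> N a"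
  using seminorm_le_universal_norm[OF zero_cstar_seminorm] by simp

lemma N_smult_le: "a \<in> carrier A \<Longrightarrow> N (c \<odot> a) \<le> cmod c * N a"
proof (rule universal_norm_le)
  fix p assume a: "a \<in> carrier A" and p: "cstar_seminorm A p"
  have "p (c \<odot> a) = cmod c * p a" using p a by (simp add: cstar_seminorm_def)
  also have "\<dots> \<le> cmod c * N a" by (intro mult_left_mono seminorm_le_universal_norm p a) simp
  finally show "p (c \<odot> a) \<le> cmod c * N a" .
qed

lemma N_smult: "a \<in> carrier A \<Longrightarrow> N (c \<odot> a) = cmod c * N a"
proof (cases "c = 0")
  case True
  assume "a \<in> carrier A"
  then show ?thesis using N_smult_le[of a 0] N_nonneg[of \<zero>] True by simp
next
  case False
  assume a: "a \<in> carrier A"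
  have "N a = N (inverse c \<odot> (c \<odot> a))" using False a by (simp add: smult_smult)
  also have "\<dots> \<le> cmod (inverse c) * N (c \<odot> a)" by (intro N_smult_le smult_closed a)
  finally have "cmod c * N a \<le> N (c \<odot> a)" using False by (simp add: norm_divide field_simps)
  then show ?thesis using N_smult_le[OF a, of c] by simp
qed

lemma N_add:
  assumes a: "a \<in> carrier A" and b: "b \<in> carrier A"
  shows "N (a \<oplus> b) \<le> N a + N b"
proof (rule universal_norm_le)
  fix p assume p: "cstar_seminorm A p"
  have "p (a \<oplus> b) \<le> p a + p b" using p a b by (simp add: cstar_seminorm_def)
  then show "p (a \<oplus> b) \<le> N a + N b"
    using seminorm_le_universal_norm[OF p a] seminorm_le_universal_norm[OF p b] by linarith
qed

lemma N_mult:
  assumes a: "a \<in> carrier A" and b: "b \<in> carrier A"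
  shows "N (a \<otimes> b) \<le> N a * N b"
proof (rule universal_norm_le)
  fix p assume p: "cstar_seminorm A p"
  have "p (a \<otimes> b) \<le> p a * p b" using p a b by (simp add: cstar_seminorm_def)
  also have "\<dots> \<le> N a * N b"
    using p a b by (intro mult_mono seminorm_le_universal_norm N_nonneg) (simp_all add: cstar_seminorm_def)
  finally show "p (a \<otimes> b) \<le> N a * N b" .
qed

text \<open>Already true of each seminorm: the square of p(star a) is p(a star(a)), at most p(a)
  p(star a), and one factor cancels.\<close>

lemma N_star_le:
  assumes a: "a \<in> carrier A"
  shows "N (star A a) \<le> N a"
proof (rule universal_norm_le)
  fix p assume p: "cstar_seminorm A p"
  then have nn: "0 \<le> p a" "0 \<le> p (star A a)" using a by (simp_all add: cstar_seminorm_def)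
  have "(p (star A a))\<^sup>2 = p (a \<otimes> star A a)"
    using p a star_closed[OF a] unfolding cstar_seminorm_def by (metis star_star)
  also have "\<dots> \<le> p a * p (star A a)" using p a by (simp add: cstar_seminorm_def)
  finally have "p (star A a) \<le> p a"
    using nn by (cases "p (star A a) = 0") (simp_all add: power2_eq_square)
  then show "p (star A a) \<le> N a" using seminorm_le_universal_norm[OF p a] by linarith
qed

lemma N_zero [simp]: "N \<zero> = 0"
  using N_smult[of \<zero> 0] by simp

lemma diff_self [simp]: "a \<in> carrier A \<Longrightarrow> a \<ominus> a = \<zero>"
  by (simp add: a_minus_def r_neg)

lemma N_diff_commute:
  assumes [simp]: "a \<in> carrier A" "b \<in> carrier A"
  shows "N (a \<ominus> b) = N (b \<ominus> a)"
proof -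
  have "a \<ominus> b = (- 1) \<odot> (b \<ominus> a)"
    unfolding diff_eq[OF assms] diff_eq[OF assms(2,1)] by (simp add: smult_add_right smult_smult a_comm)
  then show ?thesis by (simp add: N_smult)
qed

lemma N_diff_triangle:
  assumes "a \<in> carrier A" "b \<in> carrier A" "c \<in> carrier A"
  shows "N (a \<ominus> c) \<le> N (a \<ominus> b) + N (b \<ominus> c)"
  unfolding diff_telescope[OF assms] by (intro N_add minus_closed assms)

lemma diff_N_le:
  assumes [simp]: "a \<in> carrier A" "b \<in> carrier A"
  shows "\<bar>N a - N b\<bar> \<le> N (a \<ominus> b)"
proof -
  have 0: "x \<ominus> \<zero> = x" if "x \<in> carrier A" for x using that by (simp add: a_minus_def)
  show ?thesis
    using N_diff_triangle[of a b \<zero>] N_diff_triangle[of b a \<zero>] N_diff_commute[of a b] by (simp add: 0)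
qed

text \<open>The seminorm \<open>p\<close> composed with \<open>\<tau>\<close> competes in the
  supremum that defines the norm of \<open>a\<close>.\<close>

lemma endomorphism_contractive:
  assumes \<tau>: "star_endomorphism A \<tau>" and a: "a \<in> carrier A"
  shows "N (\<tau> a) \<le> N a"
proof (rule universal_norm_le)
  fix p assume p: "cstar_seminorm A p"
  have "cstar_seminorm A (\<lambda>x. p (\<tau> x))"
    unfolding cstar_seminorm_def
  proof (intro conjI allI ballI)
    fix x assume x: "x \<in> carrier A"
    then have "p (\<tau> (star A x \<otimes> x)) = p (star A (\<tau> x) \<otimes> \<tau> x)"
      using \<tau> by (simp add: star_endomorphism_def)
    then show "p (\<tau> (star A x \<otimes> x)) = (p (\<tau> x))\<^sup>2"
      using p \<tau> x by (simp add: cstar_seminorm_def star_endomorphism_def)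
  qed (use p \<tau> in \<open>simp_all add: cstar_seminorm_def star_endomorphism_def\<close>)
  then show "p (\<tau> a) \<le> N a" using a by (rule seminorm_le_universal_norm)
qed

lemma endomorphism_diff:
  assumes "star_endomorphism A \<tau>" "a \<in> carrier A" "b \<in> carrier A"
  shows "\<tau> a \<ominus> \<tau> b = \<tau> (a \<ominus> b)"
  using assms by (simp add: star_endomorphism_def diff_eq)

text \<open>With the product filter, being Cauchy is a limit statement, so sandwich and arithmetic
  rules for limits apply to it.\<close>

lemma cauchy_iff:
  "s \<in> CS \<longleftrightarrow> (\<forall>k. s k \<in> carrier A) \<and>
     ((\<lambda>(j, k). N (s j \<ominus> s k)) \<longlongrightarrow> 0) (sequentially \<times>\<^sub>F sequentially)"
proof (cases "\<forall>k. s k \<in> carrier A")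
  case True
  then have "\<bar>N (s j \<ominus> s k)\<bar> = N (s j \<ominus> s k)" for j k by (simp add: N_nonneg)
  then show ?thesis using True
    by (simp add: cauchy_seqs_def tendsto_iff eventually_prod_sequentially) blast
qed (auto simp: cauchy_seqs_def)

lemma cauchy_carrier: "s \<in> CS \<Longrightarrow> s k \<in> carrier A"
  by (simp add: cauchy_seqs_def)

lemma cauchy_const: "a \<in> carrier A \<Longrightarrow> (\<lambda>_. a) \<in> CS"
  by (simp add: cauchy_seqs_def)

text \<open>One rule for all operations: binary ones use both \<open>s\<close> and \<open>t\<close>,
  unary ones set L = 0. \<open>null_dominated\<close> is its counterpart for equivalence of
  sequences.\<close>

lemma cauchy_dominated:
  assumes s: "s \<in> CS" and t: "t \<in> CS" and r: "\<And>k. r k \<in> carrier A"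
    and le: "\<And>j k. N (r j \<ominus> r k) \<le> K * N (s j \<ominus> s k) + L * N (t j \<ominus> t k)"
  shows "r \<in> CS"
proof -
  let ?F = "sequentially \<times>\<^sub>F (sequentially :: nat filter)"
  have lim: "((\<lambda>x. K * (case x of (j, k) \<Rightarrow> N (s j \<ominus> s k)) + L * (case x of (j, k) \<Rightarrow> N (t j \<ominus> t k))) \<longlongrightarrow> K * 0 + L * 0) ?F"
    using s t unfolding cauchy_iff by (intro tendsto_intros) simp_all
  have "((\<lambda>(j, k). N (r j \<ominus> r k)) \<longlongrightarrow> 0) ?F"
  proof (rule tendsto_sandwich[OF _ _ tendsto_const])
    show "((\<lambda>x. K * (case x of (j, k) \<Rightarrow> N (s j \<ominus> s k)) + L * (case x of (j, k) \<Rightarrow> N (t j \<ominus> t k))) \<longlongrightarrow> 0) ?F"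
      using lim by simp
  qed (use r le in \<open>auto intro!: always_eventually N_nonneg\<close>)
  then show ?thesis using r by (simp add: cauchy_iff)
qed

lemma cauchy_lipschitz:
  fixes f :: "'a \<Rightarrow> 'v :: banach"
  assumes s: "s \<in> CS" and le: "\<And>a b. a \<in> carrier A \<Longrightarrow> b \<in> carrier A \<Longrightarrow> norm (f a - f b) \<le> N (a \<ominus> b)"
  shows "convergent (\<lambda>k. f (s k))"
proof -
  have "Cauchy (\<lambda>k. f (s k))"
  proof (rule metric_CauchyI)
    fix e :: real assume "e > 0"
    then obtain M where M: "\<And>j k. j \<ge> M \<Longrightarrow> k \<ge> M \<Longrightarrow> N (s j \<ominus> s k) < e"
      using s unfolding cauchy_seqs_def by blast
    show "\<exists>M. \<forall>m\<ge>M. \<forall>n\<ge>M. dist (f (s m)) (f (s n)) < e"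
    proof (intro exI allI impI)
      fix m n assume "M \<le> m" "M \<le> n"
      then show "dist (f (s m)) (f (s n)) < e"
        using M[of m n] le[of "s m" "s n"] s by (simp add: dist_norm cauchy_carrier)
    qed
  qed
  then show ?thesis by (simp add: Cauchy_convergent_iff)
qed

lemma N_convergent: "s \<in> CS \<Longrightarrow> convergent (\<lambda>k. N (s k))"
  by (erule cauchy_lipschitz) (simp add: diff_N_le)

lemma N_bounded: "s \<in> CS \<Longrightarrow> \<exists>K\<ge>0. \<forall>k. N (s k) \<le> K"
proof -
  assume s: "s \<in> CS"
  then obtain K where "\<And>k. norm (N (s k)) \<le> K"
    using convergent_imp_Bseq[OF N_convergent] by (auto simp: Bseq_def)
  then show ?thesis by (intro exI[of _ "max K 0"]) (auto simp: le_max_iff_disj abs_le_iff)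
qed

definition null_eq (infix "\<sim>" 50) where "s \<sim> t \<longleftrightarrow> (\<lambda>k. N (s k \<ominus> t k)) \<longlonglongrightarrow> 0"

lemma null_rel_iff: "(s, t) \<in> null_rel A N \<longleftrightarrow> s \<in> CS \<and> t \<in> CS \<and> s \<sim> t"
  by (simp add: null_rel_def null_eq_def)

lemma null_dominated:
  assumes "s \<sim> s'" "t \<sim> t'"
    and "\<And>k. r k \<in> carrier A" "\<And>k. r' k \<in> carrier A"
    and "\<And>k. N (r k \<ominus> r' k) \<le> K * N (s k \<ominus> s' k) + L * N (t k \<ominus> t' k)"
  shows "r \<sim> r'"
proof -
  have lim: "(\<lambda>k. K * N (s k \<ominus> s' k) + L * N (t k \<ominus> t' k)) \<longlonglongrightarrow> K * 0 + L * 0"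
    using assms(1,2) unfolding null_eq_def by (intro tendsto_intros)
  show ?thesis
    unfolding null_eq_def
  proof (rule tendsto_sandwich[OF _ _ tendsto_const])
    show "(\<lambda>k. K * N (s k \<ominus> s' k) + L * N (t k \<ominus> t' k)) \<longlonglongrightarrow> 0" using lim by simp
  qed (use assms(3,4,5) in \<open>auto intro!: always_eventually N_nonneg\<close>)
qed

lemma equiv_null_rel: "equiv CS (null_rel A N)"
proof (rule equivI)
  show "null_rel A N \<subseteq> CS \<times> CS" by (auto simp: null_rel_iff)
  show "refl_on CS (null_rel A N)"
    by (auto simp: refl_on_def null_rel_iff null_eq_def cauchy_carrier)
  show "sym (null_rel A N)"
    by (auto simp: sym_def null_rel_iff null_eq_def cauchy_carrier N_diff_commute)
  show "trans (null_rel A N)"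
  proof (rule transI)
    fix x y z assume "(x, y) \<in> null_rel A N" "(y, z) \<in> null_rel A N"
    then show "(x, z) \<in> null_rel A N"
      unfolding null_rel_iff
      using null_dominated[of x y y z x z 1 1] by (simp add: cauchy_carrier N_diff_triangle)
  qed
qed

lemma carrier_B: "carrier B = CS // null_rel A N"
  by (simp add: enveloping_cstar_alg_def)

lemma seq_class_in_B [simp, intro]: "s \<in> CS \<Longrightarrow> seq_class A s \<in> carrier B"
  by (simp add: carrier_B seq_class_def quotientI)

lemma seq_class_eq_iff: "s \<in> CS \<Longrightarrow> t \<in> CS \<Longrightarrow> seq_class A s = seq_class A t \<longleftrightarrow> s \<sim> t"
  unfolding seq_class_def by (simp add: eq_equiv_class_iff[OF equiv_null_rel] null_rel_iff)

lemma repr_in_class: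
  assumes "C \<in> carrier B"
  shows "repr C \<in> C"
proof -
  have "C \<noteq> {}" using assms unfolding carrier_B by (rule in_quotient_imp_non_empty[OF equiv_null_rel])
  then show ?thesis unfolding repr_def by (simp add: some_in_eq)
qed

lemma repr_cauchy: "C \<in> carrier B \<Longrightarrow> repr C \<in> CS"
  using repr_in_class[of C] in_quotient_imp_subset[OF equiv_null_rel, of C] by (auto simp: carrier_B)

lemma seq_class_repr: 
  assumes "C \<in> carrier B"
  shows "seq_class A (repr C) = C"
proof -
  obtain s where "s \<in> CS" "C = null_rel A N `` {s}"
    using assms by (auto simp: carrier_B elim: quotientE)
  then show ?thesis
    using repr_in_class[OF assms] equiv_class_eq[OF equiv_null_rel, of s "repr C"]
    by (simp add: seq_class_def)
qed

text \<open>The operations of the completion are defined on a representative picked by choice. This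
  lemma allows it to be exchanged for any given sequence of the class.\<close>

lemma repr_seq_class: "s \<in> CS \<Longrightarrow> repr (seq_class A s) \<sim> s"
  using seq_class_repr[of "seq_class A s"] by (simp add: seq_class_eq_iff repr_cauchy)

lemma B_cases:
  assumes "C \<in> carrier B"
  obtains s where "s \<in> CS" "C = seq_class A s"
  using assms seq_class_repr repr_cauchy by metis

lemma cauchy_add:
  assumes s: "s \<in> CS" and t: "t \<in> CS"
  shows "(\<lambda>k. s k \<oplus> t k) \<in> CS"
proof (rule cauchy_dominated[OF s t, where K = 1 and L = 1])
  fix j k
  have c: "s i \<in> carrier A" "t i \<in> carrier A" for i using s t by (simp_all add: cauchy_carrier)
  show "N (s j \<oplus> t j \<ominus> (s k \<oplus> t k)) \<le> 1 * N (s j \<ominus> s k) + 1 * N (t j \<ominus> t k)"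
    unfolding add_diff[OF c c] by (simp add: N_add c)
qed (use s t in \<open>simp add: cauchy_carrier\<close>)

lemma cauchy_smult:
  assumes s: "s \<in> CS"
  shows "(\<lambda>k. c \<odot> s k) \<in> CS"
  using s by (intro cauchy_dominated[OF s s, where K = "cmod c" and L = 0])
    (simp_all add: cauchy_carrier smult_diff N_smult)

lemma cauchy_star:
  assumes s: "s \<in> CS"
  shows "(\<lambda>k. star A (s k)) \<in> CS"
  using s by (intro cauchy_dominated[OF s s, where K = 1 and L = 0])
    (simp_all add: cauchy_carrier star_diff[symmetric] N_star_le)

text \<open>Multiplication is Lipschitz only on bounded sets, hence the bounds \<open>K\<close> and
  \<open>L\<close>, which \<open>N_bounded\<close> supplies for Cauchy sequences.\<close>

lemma N_mult_diff_le:
  assumes [simp]: "a \<in> carrier A" "b \<in> carrier A" "c \<in> carrier A" "d \<in> carrier A"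
    and "N a \<le> K" "N d \<le> L"
  shows "N (a \<otimes> b \<ominus> c \<otimes> d) \<le> L * N (a \<ominus> c) + K * N (b \<ominus> d)"
proof -
  have "N (a \<otimes> b \<ominus> c \<otimes> d) \<le> N a * N (b \<ominus> d) + N (a \<ominus> c) * N d"
    unfolding mult_diff[OF assms(1-4)]
    by (intro order_trans[OF N_add add_mono] N_mult) simp_all
  also have "\<dots> \<le> K * N (b \<ominus> d) + N (a \<ominus> c) * L"
    by (intro add_mono mult_right_mono mult_left_mono assms N_nonneg) simp_all
  finally show ?thesis by (simp add: mult.commute add.commute)
qed

lemma cauchy_mult:
  assumes s: "s \<in> CS" and t: "t \<in> CS"
  shows "(\<lambda>k. s k \<otimes> t k) \<in> CS"
proof -
  obtain K L where "\<And>k. N (s k) \<le> K" "\<And>k. N (t k) \<le> L" using N_bounded s t by metis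
  then show ?thesis
    using s t by (intro cauchy_dominated[OF s t, where K = L and L = K] N_mult_diff_le)
      (simp_all add: cauchy_carrier)
qed

lemma cauchy_endomorphism:
  assumes s: "s \<in> CS" and \<tau>: "star_endomorphism A \<tau>"
  shows "(\<lambda>k. \<tau> (s k)) \<in> CS"
proof -
  have "\<tau> (s k) \<in> carrier A" for k using s \<tau> by (simp add: cauchy_carrier star_endomorphism_def)
  then show ?thesis
    using s by (intro cauchy_dominated[OF s s, where K = 1 and L = 0])
      (simp_all add: cauchy_carrier endomorphism_diff[OF \<tau>] endomorphism_contractive[OF \<tau>])
qed

section \<open>Operations of the completion computed on arbitrary representatives\<close>

lemma B_smult: 
  assumes s: "s \<in> CS"
  shows "c \<odot>\<^bsub>B\<^esub> seq_class A s = seq_class A (\<lambda>k. c \<odot> s k)"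
proof -
  let ?s = "repr (seq_class A s)"
  have s': "?s \<in> CS" "?s \<sim> s" using s by (simp_all add: repr_cauchy repr_seq_class)
  have "(\<lambda>k. c \<odot> ?s k) \<sim> (\<lambda>k. c \<odot> s k)"
    using s s'(1) by (intro null_dominated[OF s'(2) s'(2), where K = "cmod c" and L = 0])
      (simp_all add: cauchy_carrier smult_diff N_smult)
  then show ?thesis using s s' by (simp add: enveloping_cstar_alg_def seq_class_eq_iff cauchy_smult)
qed

lemma B_star: 
  assumes s: "s \<in> CS"
  shows "star B (seq_class A s) = seq_class A (\<lambda>k. star A (s k))"
proof -
  let ?s = "repr (seq_class A s)"
  have s': "?s \<in> CS" "?s \<sim> s" using s by (simp_all add: repr_cauchy repr_seq_class)
  have "(\<lambda>k. star A (?s k)) \<sim> (\<lambda>k. star A (s k))"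
    using s s'(1) by (intro null_dominated[OF s'(2) s'(2), where K = 1 and L = 0])
      (simp_all add: cauchy_carrier star_diff[symmetric] N_star_le)
  then show ?thesis using s s' by (simp add: enveloping_cstar_alg_def seq_class_eq_iff cauchy_star)
qed

lemma B_add: 
  assumes s: "s \<in> CS" and t: "t \<in> CS"
  shows "seq_class A s \<oplus>\<^bsub>B\<^esub> seq_class A t = seq_class A (\<lambda>k. s k \<oplus> t k)"
proof -
  let ?s = "repr (seq_class A s)" and ?t = "repr (seq_class A t)"
  have s': "?s \<in> CS" "?s \<sim> s" using s by (simp_all add: repr_cauchy repr_seq_class)
  have t': "?t \<in> CS" "?t \<sim> t" using t by (simp_all add: repr_cauchy repr_seq_class)
  have "(\<lambda>k. ?s k \<oplus> ?t k) \<sim> (\<lambda>k. s k \<oplus> t k)"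
    using s t s'(1) t'(1) by (intro null_dominated[OF s'(2) t'(2), where K = 1 and L = 1])
      (simp_all add: cauchy_carrier add_diff N_add)
  then show ?thesis using s t s' t' by (simp add: enveloping_cstar_alg_def seq_class_eq_iff cauchy_add)
qed

lemma B_mult: 
  assumes s: "s \<in> CS" and t: "t \<in> CS"
  shows "seq_class A s \<otimes>\<^bsub>B\<^esub> seq_class A t = seq_class A (\<lambda>k. s k \<otimes> t k)"
proof -
  let ?s = "repr (seq_class A s)" and ?t = "repr (seq_class A t)"
  have s': "?s \<in> CS" "?s \<sim> s" using s by (simp_all add: repr_cauchy repr_seq_class)
  have t': "?t \<in> CS" "?t \<sim> t" using t by (simp_all add: repr_cauchy repr_seq_class)
  obtain K L where "\<And>k. N (?s k) \<le> K" "\<And>k. N (t k) \<le> L" using N_bounded s'(1) t by metis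
  then have "(\<lambda>k. ?s k \<otimes> ?t k) \<sim> (\<lambda>k. s k \<otimes> t k)"
    using s t s'(1) t'(1)
    by (intro null_dominated[OF s'(2) t'(2), where K = L and L = K] N_mult_diff_le)
      (simp_all add: cauchy_carrier)
  then show ?thesis using s t s' t' by (simp add: enveloping_cstar_alg_def seq_class_eq_iff cauchy_mult)
qed

lemma B_map:
  assumes s: "s \<in> CS" and \<tau>: "star_endomorphism A \<tau>"
  shows "seq_class A (\<lambda>k. \<tau> (repr (seq_class A s) k)) = seq_class A (\<lambda>k. \<tau> (s k))"
proof -
  let ?s = "repr (seq_class A s)"
  have s': "?s \<in> CS" "?s \<sim> s" using s by (simp_all add: repr_cauchy repr_seq_class)
  have c: "\<tau> a \<in> carrier A" if "a \<in> carrier A" for a using \<tau> that by (simp add: star_endomorphism_def)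
  have "(\<lambda>k. \<tau> (?s k)) \<sim> (\<lambda>k. \<tau> (s k))"
    using s s'(1) by (intro null_dominated[OF s'(2) s'(2), where K = 1 and L = 0])
      (simp_all add: cauchy_carrier c endomorphism_diff[OF \<tau>] endomorphism_contractive[OF \<tau>])
  then show ?thesis using s s' \<tau> by (simp add: seq_class_eq_iff cauchy_endomorphism)
qed

lemma B_one: "\<one>\<^bsub>B\<^esub> = seq_class A (\<lambda>_. \<one>)"
  by (simp add: enveloping_cstar_alg_def)

lemma lipschitz_null:
  fixes f :: "'a \<Rightarrow> 'v :: banach"
  assumes s: "s \<in> CS" and t: "t \<in> CS" and "s \<sim> t"
    and le: "\<And>a b. a \<in> carrier A \<Longrightarrow> b \<in> carrier A \<Longrightarrow> norm (f a - f b) \<le> N (a \<ominus> b)"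
  shows "(\<lambda>k. f (s k)) \<longlonglongrightarrow> lim (\<lambda>k. f (t k))"
proof -
  have "(\<lambda>k. f (s k) - f (t k)) \<longlonglongrightarrow> 0"
    by (rule Lim_null_comparison[OF _ assms(3)[unfolded null_eq_def]])
      (simp add: le cauchy_carrier[OF s] cauchy_carrier[OF t])
  moreover have "(\<lambda>k. f (t k)) \<longlonglongrightarrow> lim (\<lambda>k. f (t k))"
    using cauchy_lipschitz[OF t le] by (simp add: convergent_LIMSEQ_iff)
  ultimately have "(\<lambda>k. (f (s k) - f (t k)) + f (t k)) \<longlonglongrightarrow> 0 + lim (\<lambda>k. f (t k))"
    by (rule tendsto_add)
  then show ?thesis by simp
qed

text \<open>Norm, extended states and conditional expectation are all limits along the chosen
  representative; this identifies them as limits along any representative.\<close>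

lemma lipschitz_seq_class:
  fixes f :: "'a \<Rightarrow> 'v :: banach"
  assumes s: "s \<in> CS"
    and le: "\<And>a b. a \<in> carrier A \<Longrightarrow> b \<in> carrier A \<Longrightarrow> norm (f a - f b) \<le> N (a \<ominus> b)"
  shows "(\<lambda>k. f (s k)) \<longlonglongrightarrow> lim (\<lambda>k. f (repr (seq_class A s) k))"
proof (rule lipschitz_null[OF s _ _ le])
  show "repr (seq_class A s) \<in> CS" using s by (simp add: repr_cauchy)
  then show "s \<sim> repr (seq_class A s)"
    using seq_class_repr[of "seq_class A s"] s seq_class_eq_iff[of s "repr (seq_class A s)"] by simp
qed

lemma B_norm:
  assumes "s \<in> CS"
  shows "(\<lambda>k. N (s k)) \<longlonglongrightarrow> cnorm B (seq_class A s)"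
  using lipschitz_seq_class[OF assms, of N] by (simp add: enveloping_cstar_alg_def diff_N_le)

lemma B_smult_closed:
  assumes "C \<in> carrier B"
  shows "c \<odot>\<^bsub>B\<^esub> C \<in> carrier B"
proof -
  obtain s where "s \<in> CS" "C = seq_class A s" using assms by (rule B_cases)
  then show ?thesis by (simp add: B_smult cauchy_smult seq_class_in_B)
qed

text \<open>\<open>gns_norm\<close> is one of the C*-seminorms in the supremum and it dominates the
  functional.\<close>

lemma algebraic_state_bounded:
  assumes \<psi>: "algebraic_state A \<psi>" and a: "a \<in> carrier A"
  shows "cmod (\<psi> a) \<le> N a"
proof -
  interpret isometry_star_alg_state A \<psi> by standard (rule \<psi>)
  show ?thesis
    using cmod_\<psi>_le_gns_norm[OF a] seminorm_le_universal_norm[OF gns_norm_cstar_seminorm a] by linarith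
qed

lemma algebraic_state_lipschitz:
  assumes \<psi>: "algebraic_state A \<psi>" and a: "a \<in> carrier A" and b: "b \<in> carrier A"
  shows "norm (\<psi> a - \<psi> b) \<le> N (a \<ominus> b)"
proof -
  have "\<psi> (a \<ominus> b) = \<psi> a - \<psi> b" using \<psi> a b by (simp add: algebraic_state_def diff_eq)
  then show ?thesis using algebraic_state_bounded[OF \<psi>, of "a \<ominus> b"] a b by simp
qed

text \<open>All clauses of \<open>state\<close> are closed conditions and pass to the limit. Since
  \<open>\<phi>\<close> is characterised by its limits and not constructed, the lemma covers both
  the limit functional of a given \<open>\<psi>\<close> and
  \<open>\<omega>\<^sub>0 \<circ> canonical_expectation\<close>.\<close>

lemma extension_state:
  assumes \<psi>: "algebraic_state A \<psi>"
    and \<phi>: "\<And>s. s \<in> CS \<Longrightarrow> (\<lambda>k. \<psi> (s k)) \<longlonglongrightarrow> \<phi> (seq_class A s)"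
  shows "state B \<phi>"
  unfolding state_def
proof (intro conjI allI ballI)
  fix c C assume "C \<in> carrier B"
  then obtain s where s: "s \<in> CS" "C = seq_class A s" by (rule B_cases)
  have "(\<lambda>k. \<psi> (c \<odot> s k)) \<longlonglongrightarrow> c * \<phi> C"
    using \<psi> \<phi>[OF s(1)] s by (simp add: algebraic_state_def cauchy_carrier tendsto_mult_left)
  moreover have "(\<lambda>k. \<psi> (c \<odot> s k)) \<longlonglongrightarrow> \<phi> (c \<odot>\<^bsub>B\<^esub> C)"
    using \<phi>[OF cauchy_smult[OF s(1)]] s by (simp add: B_smult)
  ultimately show "\<phi> (c \<odot>\<^bsub>B\<^esub> C) = c * \<phi> C" by (rule LIMSEQ_unique[rotated])
next
  fix C D assume "C \<in> carrier B" "D \<in> carrier B"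
  then obtain s t where s: "s \<in> CS" "C = seq_class A s" and t: "t \<in> CS" "D = seq_class A t" by (metis B_cases)
  have "(\<lambda>k. \<psi> (s k \<oplus> t k)) \<longlonglongrightarrow> \<phi> C + \<phi> D"
    using \<psi> tendsto_add[OF \<phi>[OF s(1)] \<phi>[OF t(1)]] s t by (simp add: algebraic_state_def cauchy_carrier)
  moreover have "(\<lambda>k. \<psi> (s k \<oplus> t k)) \<longlonglongrightarrow> \<phi> (C \<oplus>\<^bsub>B\<^esub> D)"
    using \<phi>[OF cauchy_add[OF s(1) t(1)]] s t by (simp add: B_add)
  ultimately show "\<phi> (C \<oplus>\<^bsub>B\<^esub> D) = \<phi> C + \<phi> D" by (rule LIMSEQ_unique[rotated])
next
  fix C assume "C \<in> carrier B"
  then obtain s where s: "s \<in> CS" "C = seq_class A s" by (rule B_cases)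
  have *: "(\<lambda>k. \<psi> (star A (s k) \<otimes> s k)) \<longlonglongrightarrow> \<phi> (star B C \<otimes>\<^bsub>B\<^esub> C)"
    using \<phi>[OF cauchy_mult[OF cauchy_star s(1)]] s by (simp add: B_mult B_star cauchy_star)
  have "closed (\<real> :: complex set)" by (rule closed_complex_Reals)
  moreover have "\<psi> (star A (s k) \<otimes> s k) \<in> \<real>" for k
    using \<psi> s by (simp add: algebraic_state_def cauchy_carrier)
  ultimately show "\<phi> (star B C \<otimes>\<^bsub>B\<^esub> C) \<in> \<real>"
    using * by (rule closed_sequentially)
  have "0 \<le> Re (\<psi> (star A (s k) \<otimes> s k))" for k
    using \<psi> s by (simp add: algebraic_state_def cauchy_carrier)
  then show "0 \<le> Re (\<phi> (star B C \<otimes>\<^bsub>B\<^esub> C))"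
    by (intro LIMSEQ_le_const[OF tendsto_Re[OF *]]) auto
  show "cmod (\<phi> C) \<le> cnorm B C"
    unfolding s(2)
    by (rule LIMSEQ_le[OF tendsto_norm[OF \<phi>[OF s(1)]] B_norm[OF s(1)]])
      (simp add: algebraic_state_bounded[OF \<psi>] cauchy_carrier[OF s(1)])
next
  have "(\<lambda>k. \<psi> \<one>) \<longlonglongrightarrow> \<phi> \<one>\<^bsub>B\<^esub>" unfolding B_one by (rule \<phi>) (simp add: cauchy_const)
  moreover have "\<psi> \<one> = 1" using \<psi> by (simp add: algebraic_state_def)
  ultimately show "\<phi> \<one>\<^bsub>B\<^esub> = 1" by (simp add: LIMSEQ_const_iff)
qed

lemma restriction_state:
  assumes \<phi>: "state B \<phi>"
  shows "algebraic_state A (\<lambda>a. \<phi> (seq_class A (\<lambda>_. a)))"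
proof -
  have inB: "seq_class A (\<lambda>_. a) \<in> carrier B" if "a \<in> carrier A" for a
    using that by (intro seq_class_in_B cauchy_const)
  have sm: "\<phi> (c \<odot>\<^bsub>B\<^esub> C) = c * \<phi> C" and ad: "\<phi> (C \<oplus>\<^bsub>B\<^esub> D) = \<phi> C + \<phi> D"
    and po: "\<phi> (star B C \<otimes>\<^bsub>B\<^esub> C) \<in> \<real> \<and> 0 \<le> Re (\<phi> (star B C \<otimes>\<^bsub>B\<^esub> C))"
    if "C \<in> carrier B" "D \<in> carrier B" for c C D
    using \<phi> that unfolding state_def by blast+
  show ?thesis
    unfolding algebraic_state_def
  proof (intro conjI allI ballI)
    fix a assume a: "a \<in> carrier A"
    show "\<phi> (seq_class A (\<lambda>_. star A a \<otimes> a)) \<in> \<real>" "0 \<le> Re (\<phi> (seq_class A (\<lambda>_. star A a \<otimes> a)))"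
      using po[OF inB inB, OF a a] a by (simp_all add: B_star B_mult cauchy_const)
    fix c
    show "\<phi> (seq_class A (\<lambda>_. c \<odot> a)) = c * \<phi> (seq_class A (\<lambda>_. a))"
      using sm[OF inB inB, OF a a, of c] a by (simp add: B_smult cauchy_const)
  next
    fix a b assume "a \<in> carrier A" "b \<in> carrier A"
    then show "\<phi> (seq_class A (\<lambda>_. a \<oplus> b)) = \<phi> (seq_class A (\<lambda>_. a)) + \<phi> (seq_class A (\<lambda>_. b))"
      using ad[OF inB inB, of a b] by (simp add: B_add cauchy_const)
  next
    show "\<phi> (seq_class A (\<lambda>_. \<one>)) = 1" using \<phi> by (simp add: state_def B_one)
  qed
qed

text \<open>Density of the algebra: the constant classes of the terms \<open>s k\<close> approach
  the class of \<open>s\<close> in norm, and states are contractive. A state is therefore determined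
  by its restriction.\<close>

lemma state_LIMSEQ:
  assumes \<phi>: "state B \<phi>" and s: "s \<in> CS"
  shows "(\<lambda>k. \<phi> (seq_class A (\<lambda>_. s k))) \<longlonglongrightarrow> \<phi> (seq_class A s)"
proof (rule LIMSEQ_I)
  fix e :: real assume e: "0 < e"
  then have "0 < e / 2" by simp
  then obtain M where M: "\<And>j k. j \<ge> M \<Longrightarrow> k \<ge> M \<Longrightarrow> N (s j \<ominus> s k) < e / 2"
    using s unfolding cauchy_seqs_def by blast
  show "\<exists>M. \<forall>k\<ge>M. norm (\<phi> (seq_class A (\<lambda>_. s k)) - \<phi> (seq_class A s)) < e"
  proof (intro exI allI impI)
    fix k assume k: "M \<le> k"
    have c: "(\<lambda>_. s k) \<in> CS" "(\<lambda>j. (- 1) \<odot> s j) \<in> CS"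
      using s by (simp_all add: cauchy_const cauchy_carrier cauchy_smult)
    \<comment> \<open>The class of \<open>s k\<close> minus that of \<open>s\<close>, written with
      running index \<open>j\<close>, so that its norm is the limit over \<open>j\<close> of
      distances below \<open>e / 2\<close>.\<close>
    let ?D = "seq_class A (\<lambda>j. s k \<oplus> (- 1) \<odot> s j)"
    have D: "?D = seq_class A (\<lambda>_. s k) \<oplus>\<^bsub>B\<^esub> (- 1) \<odot>\<^bsub>B\<^esub> seq_class A s"
      using s c by (simp add: B_smult B_add)
    have inB: "?D \<in> carrier B" using c by (intro seq_class_in_B cauchy_add)
    have "\<phi> ?D = \<phi> (seq_class A (\<lambda>_. s k)) - \<phi> (seq_class A s)"
    proof -
      have "seq_class A (\<lambda>_. s k) \<in> carrier B" "seq_class A s \<in> carrier B" using s c by blast+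
      moreover from this(2) have "(- 1) \<odot>\<^bsub>B\<^esub> seq_class A s \<in> carrier B" by (rule B_smult_closed)
      ultimately show ?thesis unfolding D using \<phi> by (simp add: state_def)
    qed
    moreover have "cmod (\<phi> ?D) \<le> cnorm B ?D" using \<phi> inB unfolding state_def by blast
    moreover have "cnorm B ?D \<le> e / 2"
    proof (rule LIMSEQ_le_const2[OF B_norm])
      show "(\<lambda>j. s k \<oplus> (- 1) \<odot> s j) \<in> CS" using c by (intro cauchy_add)
      show "\<exists>M. \<forall>j\<ge>M. N (s k \<oplus> (- 1) \<odot> s j) \<le> e / 2"
      proof (intro exI allI impI)
        fix j assume "M \<le> j"
        then have "N (s k \<ominus> s j) < e / 2" using M k by blast
        then show "N (s k \<oplus> (- 1) \<odot> s j) \<le> e / 2"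
          using s by (simp add: diff_eq cauchy_carrier)
      qed
    qed
    ultimately show "norm (\<phi> (seq_class A (\<lambda>_. s k)) - \<phi> (seq_class A s)) < e" using e by simp
  qed
qed

text \<open>Extension by limits and restriction to constant sequences are inverse to each other and
  respect invariance, so the question moves entirely to the dense star-algebra.\<close>

lemma uniquely_ergodic_envelope_iff:
  fixes \<tau> :: "'g \<Rightarrow> 'a \<Rightarrow> 'a"
  assumes \<tau>: "\<And>g. star_endomorphism A (\<tau> g)"
    and T: "\<And>g C. C \<in> carrier B \<Longrightarrow> T g C = seq_class A (\<lambda>k. \<tau> g (repr C k))"
    and \<psi>0: "algebraic_state A \<psi>0"
    and \<phi>0: "\<And>s. s \<in> CS \<Longrightarrow> (\<lambda>k. \<psi>0 (s k)) \<longlonglongrightarrow> \<phi>0 (seq_class A s)"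
  shows "uniquely_ergodic B T \<and> invariant_state B T \<phi>0 \<longleftrightarrow>
    (\<forall>g. \<forall>a\<in>carrier A. \<psi>0 (\<tau> g a) = \<psi>0 a) \<and>
    (\<forall>\<psi>. algebraic_state A \<psi> \<longrightarrow> (\<forall>g. \<forall>a\<in>carrier A. \<psi> (\<tau> g a) = \<psi> a) \<longrightarrow> (\<forall>a\<in>carrier A. \<psi> a = \<psi>0 a))"
proof -
  have T': "T g (seq_class A s) = seq_class A (\<lambda>k. \<tau> g (s k))" if "s \<in> CS" for g s
    using that by (simp add: T seq_class_in_B B_map[OF _ \<tau>])
  have const: "\<phi> (seq_class A (\<lambda>_. a)) = \<psi> a"
    if "\<And>s. s \<in> CS \<Longrightarrow> (\<lambda>k. \<psi> (s k)) \<longlonglongrightarrow> \<phi> (seq_class A s)" "a \<in> carrier A"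
    for \<phi> :: "_ \<Rightarrow> complex" and \<psi> a
    using that(1)[OF cauchy_const[OF that(2)]] by (simp add: LIMSEQ_const_iff)
  have ext: "invariant_state B T \<phi>"
    if \<psi>: "algebraic_state A \<psi>" "\<And>g a. a \<in> carrier A \<Longrightarrow> \<psi> (\<tau> g a) = \<psi> a"
      and \<phi>: "\<And>s. s \<in> CS \<Longrightarrow> (\<lambda>k. \<psi> (s k)) \<longlonglongrightarrow> \<phi> (seq_class A s)" for \<phi> \<psi>
    unfolding invariant_state_def
  proof (intro conjI allI ballI)
    show "state B \<phi>" by (rule extension_state[OF \<psi>(1) \<phi>])
    fix g C assume "C \<in> carrier B"
    then obtain s where s: "s \<in> CS" "C = seq_class A s" by (rule B_cases)
    have "(\<lambda>k. \<psi> (s k)) \<longlonglongrightarrow> \<phi> (T g C)"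
      using \<phi>[OF cauchy_endomorphism[OF s(1) \<tau>[of g]]] s \<psi>(2) by (simp add: T' cauchy_carrier)
    then show "\<phi> (T g C) = \<phi> C" using \<phi>[OF s(1)] s(2) LIMSEQ_unique by blast
  qed
  have restr: "\<phi> (seq_class A (\<lambda>_. \<tau> g a)) = \<phi> (seq_class A (\<lambda>_. a))"
    if "invariant_state B T \<phi>" "a \<in> carrier A" for \<phi> g a
  proof -
    have "\<phi> (T g (seq_class A (\<lambda>_. a))) = \<phi> (seq_class A (\<lambda>_. a))"
      using that unfolding invariant_state_def by (simp add: seq_class_in_B cauchy_const)
    then show ?thesis using that(2) by (simp add: T' cauchy_const)
  qed
  show ?thesis
  proof (intro iffI conjI allI impI ballI)
    fix g a assume H: "uniquely_ergodic B T \<and> invariant_state B T \<phi>0" and a: "a \<in> carrier A"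
    have "\<tau> g a \<in> carrier A" using \<tau>[of g] a by (simp add: star_endomorphism_def)
    then show "\<psi>0 (\<tau> g a) = \<psi>0 a"
      using restr[OF conjunct2[OF H] a, of g] const[of \<psi>0 \<phi>0, OF \<phi>0] a by simp
  next
    fix \<psi> a assume H: "uniquely_ergodic B T \<and> invariant_state B T \<phi>0" and a: "a \<in> carrier A"
      and \<psi>: "algebraic_state A \<psi>" "\<forall>g. \<forall>a\<in>carrier A. \<psi> (\<tau> g a) = \<psi> a"
    define \<phi> where "\<phi> C = lim (\<lambda>k. \<psi> (repr C k))" for C
    have \<phi>: "(\<lambda>k. \<psi> (s k)) \<longlonglongrightarrow> \<phi> (seq_class A s)" if "s \<in> CS" for s
      unfolding \<phi>_def by (rule lipschitz_seq_class[OF that algebraic_state_lipschitz[OF \<psi>(1)]])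
    have "invariant_state B T \<phi>" using \<psi> \<phi> by (intro ext[of \<psi>]) auto
    then have "\<phi> (seq_class A (\<lambda>_. a)) = \<phi>0 (seq_class A (\<lambda>_. a))"
      using H seq_class_in_B[OF cauchy_const[OF a]] unfolding uniquely_ergodic_def by metis
    then show "\<psi> a = \<psi>0 a" using const[of \<psi> \<phi>, OF \<phi> a] const[of \<psi>0 \<phi>0, OF \<phi>0 a] by simp
  next
    assume H: "(\<forall>g. \<forall>a\<in>carrier A. \<psi>0 (\<tau> g a) = \<psi>0 a) \<and>
      (\<forall>\<psi>. algebraic_state A \<psi> \<longrightarrow> (\<forall>g. \<forall>a\<in>carrier A. \<psi> (\<tau> g a) = \<psi> a) \<longrightarrow> (\<forall>a\<in>carrier A. \<psi> a = \<psi>0 a))"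
    show inv: "invariant_state B T \<phi>0" by (rule ext[OF \<psi>0 _ \<phi>0]) (simp_all add: conjunct1[OF H])
    show "uniquely_ergodic B T"
      unfolding uniquely_ergodic_def
    proof (intro exI conjI allI impI ballI)
      show "invariant_state B T \<phi>0" by (rule inv)
      fix \<phi> C assume \<phi>: "invariant_state B T \<phi>" and "C \<in> carrier B"
      then obtain s where s: "s \<in> CS" "C = seq_class A s" using B_cases by blast
      have st: "state B \<phi>" using \<phi> by (simp add: invariant_state_def)
      have "\<forall>a\<in>carrier A. \<phi> (seq_class A (\<lambda>_. a)) = \<psi>0 a"
        using H restriction_state[OF st] restr[OF \<phi>] by blast
      then have "(\<lambda>k. \<psi>0 (s k)) \<longlonglongrightarrow> \<phi> C"
        using state_LIMSEQ[OF st s(1)] s by (simp add: cauchy_carrier)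
      then show "\<phi> C = \<phi>0 C" using \<phi>0[OF s(1)] s(2) LIMSEQ_unique by blast
    qed
  qed
qed

end


section \<open>Integration of continuous functions\<close>

lemma integrable_continuous_compact:
  fixes f :: "'x::metric_space \<Rightarrow> 'b::{banach, second_countable_topology}"
  assumes "compact (UNIV :: 'x set)" "finite_measure M" "sets M = sets borel" "continuous_on UNIV f"
  shows "integrable M f"
proof -
  interpret finite_measure M by fact
  have "bounded (range f)"
    using compact_continuous_image[OF assms(4,1)] by (rule compact_imp_bounded)
  then obtain K where "\<And>x. norm (f x) \<le> K" by (auto simp: bounded_iff)
  moreover have "f \<in> borel_measurable M"
    using borel_measurable_continuous_onI[OF assms(4)] assms(3) by (simp cong: measurable_cong_sets)
  ultimately show ?thesis by (intro integrable_const_bound[of _ K]) auto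
qed

text \<open>Closed sets form an intersection-stable generator, and the indicator of a nonempty
  closed set is a bounded pointwise limit of continuous functions.\<close>

lemma finite_measure_eqI_continuous:
  fixes M N :: "'x::metric_space measure"
  assumes fin: "finite_measure M" "finite_measure N" and sets: "sets M = sets borel" "sets N = sets borel"
    and eq: "\<And>f :: 'x \<Rightarrow> real. continuous_on UNIV f \<Longrightarrow> (\<And>x. 0 \<le> f x \<and> f x \<le> 1) \<Longrightarrow>
      (LINT x|M. f x) = (LINT x|N. f x)"
  shows "M = N"
proof -
  define f where "f F k x = max 0 (1 - real k * infdist x F)" for F :: "'x set" and k :: nat and x
  have cont: "continuous_on UNIV (f F k)" for F k
    unfolding f_def by (intro continuous_intros)
  have bnd: "0 \<le> f F k x" "f F k x \<le> 1" for F k x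
    by (simp_all add: f_def infdist_nonneg)
  have lim: "(\<lambda>k. f F k x) \<longlonglongrightarrow> indicator F x" if F: "closed F" "F \<noteq> {}" for F x
  proof (cases "x \<in> F")
    case True
    then show ?thesis by (simp add: f_def)
  next
    case False
    then have pos: "infdist x F > 0" using infdist_pos_not_in_closed[OF F] by simp
    obtain k0 :: nat where k0: "1 / infdist x F \<le> real k0" using real_arch_simple by blast
    have "\<forall>\<^sub>F k in sequentially. f F k x = indicator F x"
      using eventually_ge_at_top[of k0]
    proof eventually_elim
      case (elim k)
      then have "1 / infdist x F \<le> real k" using k0 by linarith
      then have "1 \<le> real k * infdist x F" using pos by (simp add: field_simps)
      then show ?case using False by (simp add: f_def)
    qed
    then show ?thesis by (rule tendsto_eventually)
  qed
  have meas: "(\<lambda>k. LINT x|P. f F k x) \<longlonglongrightarrow> measure P F"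
    if P: "finite_measure P" "sets P = sets borel" and F: "closed F" "F \<noteq> {}" for P F
  proof -
    interpret P: finite_measure P by fact
    have m: "f F k \<in> borel_measurable P" for k
      using borel_measurable_continuous_onI[OF cont] P(2) by (simp cong: measurable_cong_sets)
    have FP: "F \<in> sets P" using P(2) F(1) by simp
    have "(\<lambda>k. LINT x|P. f F k x) \<longlonglongrightarrow> (LINT x|P. indicator F x)"
      by (rule integral_dominated_convergence[where w = "\<lambda>_. 1"])
        (use m lim[OF F] bnd FP in auto)
    moreover have "(LINT x|P. indicator F x) = measure P F" using FP by simp
    ultimately show ?thesis by simp
  qed
  show ?thesis
  proof (rule measure_eqI_generator_eq[where E = "Collect closed" and \<Omega> = UNIV and A = "\<lambda>_. UNIV"])
    show "Int_stable (Collect closed :: 'x set set)" by (auto simp: Int_stable_def)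
    show "sets M = sigma_sets UNIV (Collect closed)" "sets N = sigma_sets UNIV (Collect closed)"
      using sets by (simp_all add: borel_eq_closed)
    fix F :: "'x set" assume "F \<in> Collect closed"
    then have F: "closed F" by simp
    show "emeasure M F = emeasure N F"
    \<comment> \<open>\<open>infdist\<close> to the empty set is 0, so the approximants would be
      constantly 1 there.\<close>
    proof (cases "F = {}")
      case False
      have "(LINT x|M. f F k x) = (LINT x|N. f F k x)" for k
        by (rule eq[OF cont]) (simp add: bnd)
      then have "measure M F = measure N F"
        using LIMSEQ_unique[OF meas[OF fin(1) sets(1) F False]] meas[OF fin(2) sets(2) F False] by simp
      then show ?thesis
        using fin by (simp add: finite_measure.emeasure_eq_measure)
    qed simp
  next
    show "emeasure M UNIV \<noteq> \<infinity>" using finite_measure.emeasure_finite[OF fin(1)] by simp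
  qed auto
qed

text \<open>The positive and negative parts of \<open>g\<close> are densities of two finite measures
  with the same integrals of continuous functions. The measures coincide, hence so do the
  densities.\<close>

lemma AE_zero_real:
  fixes g :: "'x::metric_space \<Rightarrow> real"
  assumes M: "finite_measure M" "sets M = sets borel"
    and g[measurable]: "integrable M g"
    and zero: "\<And>a :: 'x \<Rightarrow> real. continuous_on UNIV a \<Longrightarrow> (LINT x|M. a x * g x) = 0"
  shows "AE x in M. g x = 0"
proof -
  interpret finite_measure M by fact
  let ?p = "\<lambda>x. max 0 (g x)" and ?n = "\<lambda>x. max 0 (- g x)"
  have p: "integrable M ?p" and n: "integrable M ?n" using g by simp_all
  have fin: "finite_measure (density M (\<lambda>x. ennreal (f x)))"
    if "integrable M f" "\<And>x. 0 \<le> f x" for f :: "'x \<Rightarrow> real"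
  proof (rule finite_measureI)
    have [measurable]: "f \<in> borel_measurable M" using that(1) by auto
    have "emeasure (density M (\<lambda>x. ennreal (f x))) (space (density M (\<lambda>x. ennreal (f x)))) = (\<integral>\<^sup>+x. ennreal (f x) \<partial>M)"
      by (subst emeasure_density) (auto intro!: nn_integral_cong)
    also have "\<dots> = ennreal (LINT x|M. f x)" using that by (intro nn_integral_eq_integral) auto
    finally show "emeasure (density M (\<lambda>x. ennreal (f x))) (space (density M (\<lambda>x. ennreal (f x)))) \<noteq> \<infinity>" by simp
  qed
  have "density M (\<lambda>x. ennreal (?p x)) = density M (\<lambda>x. ennreal (?n x))"
  proof (rule finite_measure_eqI_continuous)
    fix a :: "'x \<Rightarrow> real" assume a: "continuous_on UNIV a" and bnd: "\<And>x. 0 \<le> a x \<and> a x \<le> 1"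
    have [measurable]: "a \<in> borel_measurable M"
      using borel_measurable_continuous_onI[OF a] M(2) by (simp cong: measurable_cong_sets)
    have ip: "integrable M (\<lambda>x. ?p x * a x)" and in': "integrable M (\<lambda>x. ?n x * a x)"
    proof -
      show "integrable M (\<lambda>x. ?p x * a x)"
        by (rule Bochner_Integration.integrable_bound[OF p]) (use bnd in \<open>auto simp: abs_mult mult_left_le\<close>)
      show "integrable M (\<lambda>x. ?n x * a x)"
        by (rule Bochner_Integration.integrable_bound[OF n]) (use bnd in \<open>auto simp: abs_mult mult_left_le\<close>)
    qed
    have "(LINT x|M. ?p x * a x) - (LINT x|M. ?n x * a x) = (LINT x|M. ?p x * a x - ?n x * a x)"
      using ip in' by simp
    also have "\<dots> = (LINT x|M. a x * g x)" by (intro Bochner_Integration.integral_cong) (auto simp: max_def)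
    also have "\<dots> = 0" by (rule zero[OF a])
    finally have "(LINT x|M. ?p x * a x) = (LINT x|M. ?n x * a x)" by simp
    then show "(LINT x|density M (\<lambda>x. ennreal (?p x)). a x) = (LINT x|density M (\<lambda>x. ennreal (?n x)). a x)"
      by (simp add: integral_density)
  qed (use M fin[OF p] fin[OF n] in simp_all)
  then have "AE x in M. ennreal (?p x) = ennreal (?n x)"
    by (subst (asm) density_unique_iff) simp_all
  then show ?thesis by eventually_elim (auto simp: max_def split: if_splits)
qed

lemma AE_zero_complex:
  fixes g :: "'x::metric_space \<Rightarrow> complex"
  assumes X: "compact (UNIV :: 'x set)" and M: "finite_measure M" "sets M = sets borel"
    and g: "integrable M g"
    and zero: "\<And>a :: 'x \<Rightarrow> complex. continuous_on UNIV a \<Longrightarrow> (LINT x|M. a x * g x) = 0"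
  shows "AE x in M. g x = 0"
proof -
  interpret finite_measure M by fact
  have z: "(LINT x|M. complex_of_real (a x) * g x) = 0" and i: "integrable M (\<lambda>x. complex_of_real (a x) * g x)"
    if a: "continuous_on UNIV a" for a :: "'x \<Rightarrow> real"
  proof -
    show "(LINT x|M. complex_of_real (a x) * g x) = 0"
      using zero[of "\<lambda>x. complex_of_real (a x)"] a by (simp add: continuous_on_of_real)
    have "bounded (range a)"
      using compact_continuous_image[OF a X] by (rule compact_imp_bounded)
    then obtain K where K: "\<And>x. norm (a x) \<le> K" by (auto simp: bounded_iff)
    have [measurable]: "a \<in> borel_measurable M" "g \<in> borel_measurable M"
      using borel_measurable_continuous_onI[OF a] M(2) g by (simp_all cong: measurable_cong_sets)
    show "integrable M (\<lambda>x. complex_of_real (a x) * g x)"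
    proof (rule Bochner_Integration.integrable_bound)
      show "integrable M (\<lambda>x. K * norm (g x))" using g by simp
      show "AE x in M. norm (complex_of_real (a x) * g x) \<le> norm (K * norm (g x))"
        by (auto simp: norm_mult intro!: order_trans[OF mult_right_mono[OF K[unfolded real_norm_def]] abs_ge_self])
    qed simp
  qed
  have "AE x in M. Re (g x) = 0"
  proof (rule AE_zero_real[OF M])
    fix a :: "'x \<Rightarrow> real" assume a: "continuous_on UNIV a"
    show "(LINT x|M. a x * Re (g x)) = 0"
      using integral_Re[OF i[OF a]] z[OF a] by simp
  qed (use g in simp)
  moreover have "AE x in M. Im (g x) = 0"
  proof (rule AE_zero_real[OF M])
    fix a :: "'x \<Rightarrow> real" assume a: "continuous_on UNIV a"
    show "(LINT x|M. a x * Im (g x)) = 0"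
      using integral_Im[OF i[OF a]] z[OF a] by simp
  qed (use g in simp)
  ultimately show ?thesis by eventually_elim (simp add: complex_eq_iff)
qed

text \<open>Sum and integral may be exchanged for nonnegative functions, so the pointwise sum of
  norms has finite integral.\<close>

lemma AE_summable_norm:
  fixes d :: "nat \<Rightarrow> 'x \<Rightarrow> 'b::{banach, second_countable_topology}"
  assumes d: "\<And>i. integrable M (d i)" and s: "summable (\<lambda>i. LINT x|M. norm (d i x))"
  shows "AE x in M. summable (\<lambda>i. norm (d i x))"
proof -
  have [measurable]: "d i \<in> borel_measurable M" for i using d[of i] by auto
  have "(\<integral>\<^sup>+x. (\<Sum>i. ennreal (norm (d i x))) \<partial>M) = (\<Sum>i. \<integral>\<^sup>+x. ennreal (norm (d i x)) \<partial>M)"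
    by (rule nn_integral_suminf) simp
  also have "\<dots> = (\<Sum>i. ennreal (LINT x|M. norm (d i x)))"
    using d by (intro suminf_cong nn_integral_eq_integral) auto
  also have "\<dots> = ennreal (\<Sum>i. LINT x|M. norm (d i x))"
    by (rule suminf_ennreal2[OF _ s]) simp
  finally have "(\<integral>\<^sup>+x. (\<Sum>i. ennreal (norm (d i x))) \<partial>M) \<noteq> \<infinity>" by simp
  then have "AE x in M. (\<Sum>i. ennreal (norm (d i x))) \<noteq> \<infinity>" by (intro nn_integral_PInf_AE) simp_all
  then show ?thesis by eventually_elim (simp add: summable_suminf_not_top)
qed

text \<open>The minimiser of \<open>\<integral>|f|\<^sup>2 - 2 Re L (cnj f)\<close> represents \<open>L\<close>; only the \<open>L\<^sup>1\<close> convergence of a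
  minimising sequence of continuous functions is needed.\<close>

lemma square_bounded_functional_density:
  fixes M :: "'x::metric_space measure" and L :: "('x \<Rightarrow> complex) \<Rightarrow> complex"
  assumes X: "compact (UNIV :: 'x set)" and M: "prob_space M" "sets M = sets borel"
    and add: "\<And>a b. continuous_on UNIV a \<Longrightarrow> continuous_on UNIV b \<Longrightarrow> L (\<lambda>x. a x + b x) = L a + L b"
    and scale: "\<And>c a. continuous_on UNIV a \<Longrightarrow> L (\<lambda>x. c * a x) = c * L a"
    and bound: "\<And>a. continuous_on UNIV a \<Longrightarrow> (cmod (L a))\<^sup>2 \<le> (LINT x|M. (cmod (a x))\<^sup>2)"
  shows "\<exists>h. integrable M h \<and> (\<forall>a. continuous_on UNIV a \<longrightarrow> L a = (LINT x|M. a x * h x))"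
proof -
  interpret prob_space M by fact
  have int: "integrable M f" if "continuous_on UNIV f" for f :: "'x \<Rightarrow> 'b::{banach, second_countable_topology}"
    using X that M(2) finite_measure_axioms by (intro integrable_continuous_compact)
  define sq where "sq f = (LINT x|M. (cmod (f x))\<^sup>2)" for f :: "'x \<Rightarrow> complex"
  define J where "J f = sq f - 2 * Re (L (\<lambda>x. cnj (f x)))" for f
  let ?C = "{f :: 'x \<Rightarrow> complex. continuous_on UNIV f}"
  have isq: "integrable M (\<lambda>x. (cmod (f x))\<^sup>2)" if "continuous_on UNIV f" for f :: "'x \<Rightarrow> complex"
    using that by (intro int continuous_intros)
  \<comment> \<open>With l the modulus of the linear term, \<open>bound\<close> makes
    \<open>J f\<close> at least l^2 - 2 l, which is at least -1.\<close>
  have J_ge: "- 1 \<le> J f" if f: "continuous_on UNIV f" for f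
  proof -
    let ?l = "cmod (L (\<lambda>x. cnj (f x)))"
    have "?l\<^sup>2 \<le> sq f" using bound[of "\<lambda>x. cnj (f x)"] f by (simp add: sq_def continuous_on_cnj)
    moreover have "0 \<le> (?l - 1)\<^sup>2" by simp
    ultimately have "2 * ?l \<le> sq f + 1" by (simp add: power2_diff)
    then show ?thesis using complex_Re_le_cmod[of "L (\<lambda>x. cnj (f x))"] by (simp add: J_def)
  qed
  define m where "m = Inf (J ` ?C)"
  have bdd: "bdd_below (J ` ?C)" using J_ge by (intro bdd_belowI2[where m = "- 1"]) auto
  have m_le: "m \<le> J f" if "continuous_on UNIV f" for f
    unfolding m_def using that by (intro cInf_lower bdd) auto
  \<comment> \<open>With error (1/4)^k / 4 the parallelogram identity keeps the squared distance of
    consecutive terms below (1/4)^k.\<close>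
  have "\<exists>f. continuous_on UNIV f \<and> J f < m + (1/4)^k / 4" for k :: nat
  proof -
    have "(\<lambda>_. 0) \<in> ?C" by simp
    then have ne: "J ` ?C \<noteq> {}" by blast
    have "Inf (J ` ?C) < m + (1/4)^k / 4" by (simp add: m_def)
    then obtain y where "y \<in> J ` ?C" "y < m + (1/4)^k / 4" using cInf_lessD[OF ne] by blast
    then show ?thesis by blast
  qed
  then obtain f where f: "\<And>k. continuous_on UNIV (f k)" and Jf: "\<And>k. J (f k) < m + (1/4)^k / 4" by metis
  have parallelogram: "sq (\<lambda>x. a x - b x) = 2 * J a + 2 * J b - 4 * J (\<lambda>x. (1/2) * (a x + b x))"
    if a: "continuous_on UNIV a" and b: "continuous_on UNIV b" for a b
  proof -
    have ptw: "(cmod (z - w))\<^sup>2 = 2 * (cmod z)\<^sup>2 + 2 * (cmod w)\<^sup>2 - 4 * (cmod ((1/2) * (z + w)))\<^sup>2" for z w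
      unfolding cmod_power2 by (simp add: power2_eq_square field_simps)
    have c: "continuous_on UNIV (\<lambda>x. (1/2) * (a x + b x))" using a b by (intro continuous_intros)
    have "sq (\<lambda>x. a x - b x) = 2 * sq a + 2 * sq b - 4 * sq (\<lambda>x. (1/2) * (a x + b x))"
      unfolding sq_def ptw using isq[OF a] isq[OF b] isq[OF c] by simp
    moreover have "Re (L (\<lambda>x. cnj ((1/2) * (a x + b x)))) = (Re (L (\<lambda>x. cnj (a x))) + Re (L (\<lambda>x. cnj (b x)))) / 2"
    proof -
      have c: "continuous_on UNIV (\<lambda>x. cnj (a x))" "continuous_on UNIV (\<lambda>x. cnj (b x))"
        using a b by (intro continuous_intros; simp)+
      have "L (\<lambda>x. (1/2) * (cnj (a x) + cnj (b x))) = (1/2) * L (\<lambda>x. cnj (a x) + cnj (b x))"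
        by (intro scale continuous_intros c)
      also have "\<dots> = (1/2) * (L (\<lambda>x. cnj (a x)) + L (\<lambda>x. cnj (b x)))" by (simp only: add[OF c])
      finally have "Re (L (\<lambda>x. (1/2) * (cnj (a x) + cnj (b x)))) =
          Re ((1/2) * (L (\<lambda>x. cnj (a x)) + L (\<lambda>x. cnj (b x))))" by (rule arg_cong)
      then show ?thesis by simp
    qed
    ultimately show ?thesis by (simp add: J_def)
  qed
  define d where "d k x = f (Suc k) x - f k x" for k x
  have d: "continuous_on UNIV (d k)" for k unfolding d_def by (intro continuous_intros f)
  have sq_d: "sq (d k) \<le> (1/4)^k" for k
  proof -
    have "m \<le> J (\<lambda>x. (1/2) * (f (Suc k) x + f k x))" by (intro m_le continuous_intros f)
    moreover have "0 \<le> (1/4 :: real)^k" by simp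
    ultimately show ?thesis
      using parallelogram[OF f f, of "Suc k" k] Jf[of k] Jf[of "Suc k"]
      unfolding d_def[abs_def] power_Suc by linarith
  qed
  have norm_d: "(LINT x|M. norm (d k x)) \<le> (1/2)^k" for k
  proof -
    \<comment> \<open>The weight 2^k balances the two summands: both end up with integral at most
      (1/2)^k, so an L^2 estimate turns into a summable L^1 one.\<close>
    have "norm (d k x) \<le> (2^k * (cmod (d k x))\<^sup>2 + (1/2)^k) / 2" for x
    proof -
      have "0 \<le> 2^k * (norm (d k x) - (1/2)^k)\<^sup>2" by simp
      also have "\<dots> = 2^k * (cmod (d k x))\<^sup>2 - 2 * norm (d k x) + (1/2)^k"
        by (simp add: power2_diff algebra_simps power_divide power2_eq_square)
      finally show ?thesis by simp
    qed
    then have "(LINT x|M. norm (d k x)) \<le> (LINT x|M. (2^k * (cmod (d k x))\<^sup>2 + (1/2)^k) / 2)"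
      using d isq[OF d] by (intro integral_mono int) (auto intro!: continuous_intros)
    also have "\<dots> = (2^k * sq (d k) + (1/2)^k) / 2"
      using isq[OF d] by (simp add: sq_def prob_space)
    also have "\<dots> \<le> (2^k * (1/4)^k + (1/2)^k) / 2" using sq_d[of k] by simp
    also have "\<dots> = (1/2)^k" by (simp add: power_mult_distrib[symmetric])
    finally show ?thesis .
  qed
  have summ: "summable (\<lambda>k. LINT x|M. norm (d k x))"
    by (rule summable_comparison_test[OF _ summable_geometric[of "1/2"]]) (use norm_d in auto)
  have AE_summ: "AE x in M. summable (\<lambda>k. norm (d k x))"
    by (rule AE_summable_norm[OF _ summ]) (intro int d)
  define h where "h x = f 0 x + (\<Sum>k. d k x)" for x
  have h: "integrable M h"
    unfolding h_def using int[OF f] integrable_suminf[OF int[OF d] AE_summ summ] by simp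
  have lim1: "(\<lambda>n. LINT x|M. a x * f n x) \<longlonglongrightarrow> (LINT x|M. a x * h x)" if a: "continuous_on UNIV a" for a
  proof -
    have "bounded (range a)"
      using compact_continuous_image[OF a X] by (rule compact_imp_bounded)
    then obtain K where K: "\<And>x. norm (a x) \<le> K" by (auto simp: bounded_iff)
    have ad: "integrable M (\<lambda>x. a x * d k x)" and af: "integrable M (\<lambda>x. a x * f k x)" for k
      using a d f by (auto intro!: int continuous_intros)
    have le: "norm (a x * d k x) \<le> K * norm (d k x)" for k x
      by (simp add: norm_mult mult_right_mono K)
    have summ': "summable (\<lambda>k. LINT x|M. norm (a x * d k x))"
    proof (rule summable_comparison_test[OF _ summable_mult[OF summ, of K]], intro exI allI impI)
      fix k
      have "(LINT x|M. norm (a x * d k x)) \<le> (LINT x|M. K * norm (d k x))"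
        using ad int[OF d] le by (intro integral_mono) auto
      then show "norm (LINT x|M. norm (a x * d k x)) \<le> K * (LINT x|M. norm (d k x))" by simp
    qed
    have AE': "AE x in M. summable (\<lambda>k. norm (a x * d k x))"
      by (rule AE_summable_norm[OF ad summ'])
    have "(\<lambda>k. LINT x|M. a x * d k x) sums (LINT x|M. (\<Sum>k. a x * d k x))"
      by (rule sums_integral[OF ad AE' summ'])
    also have "(LINT x|M. (\<Sum>k. a x * d k x)) = (LINT x|M. a x * h x - a x * f 0 x)"
    proof (rule integral_cong_AE)
      have [measurable]: "d k \<in> borel_measurable M" "f k \<in> borel_measurable M" "a \<in> borel_measurable M"
         "h \<in> borel_measurable M" for k
        using int[OF d, of k] int[OF f, of k] int[OF a] h by auto
      show "(\<lambda>x. \<Sum>k. a x * d k x) \<in> borel_measurable M" "(\<lambda>x. a x * h x - a x * f 0 x) \<in> borel_measurable M"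
        by simp_all
      show "AE x in M. (\<Sum>k. a x * d k x) = a x * h x - a x * f 0 x"
        using AE_summ
      proof eventually_elim
        case (elim x)
        then have "summable (\<lambda>k. d k x)" by (rule summable_norm_cancel)
        then show ?case by (simp add: h_def suminf_mult algebra_simps)
      qed
    qed
    finally have "(\<lambda>n. \<Sum>k<n. LINT x|M. a x * d k x) \<longlonglongrightarrow> (LINT x|M. a x * h x - a x * f 0 x)"
      by (simp add: sums_def)
    moreover have "(\<Sum>k<n. LINT x|M. a x * d k x) = (LINT x|M. a x * f n x) - (LINT x|M. a x * f 0 x)" for n
    proof -
      have "(LINT x|M. a x * d k x) = (LINT x|M. a x * f (Suc k) x) - (LINT x|M. a x * f k x)" for k
        using af[of "Suc k"] af[of k] by (simp add: d_def right_diff_distrib)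
      then show ?thesis
        using sum_lessThan_telescope[of "\<lambda>k. LINT x|M. a x * f k x" n] by (simp only:)
    qed
    moreover have "(LINT x|M. a x * h x - a x * f 0 x) = (LINT x|M. a x * h x) - (LINT x|M. a x * f 0 x)"
    proof (rule Bochner_Integration.integral_diff[OF _ af])
      show "integrable M (\<lambda>x. a x * h x)"
      proof (rule Bochner_Integration.integrable_bound)
        show "integrable M (\<lambda>x. K * norm (h x))" using h by simp
        show "(\<lambda>x. a x * h x) \<in> borel_measurable M" using int[OF a] h by auto
        show "AE x in M. norm (a x * h x) \<le> norm (K * norm (h x))"
          by (auto simp: norm_mult intro!: order_trans[OF mult_right_mono[OF K] abs_ge_self])
      qed
    qed
    ultimately have "(\<lambda>n. (LINT x|M. a x * f n x) - (LINT x|M. a x * f 0 x))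
        \<longlonglongrightarrow> (LINT x|M. a x * h x) - (LINT x|M. a x * f 0 x)" by (simp only:)
    from tendsto_add[OF this tendsto_const[of "LINT x|M. a x * f 0 x"]] show ?thesis by simp
  qed
  have lim_Re: "(\<lambda>n. Re ((LINT x|M. a x * f n x) - L a)) \<longlonglongrightarrow> 0" if a: "continuous_on UNIV a" for a
  proof -
    have step: "\<bar>Re ((LINT x|M. a x * f n x) - L a)\<bar> \<le> (1/2)^n * ((1 + sq a) / 2)" for n
    proof -
      let ?r = "Re ((LINT x|M. a x * f n x) - L a)"
      \<comment> \<open>Variation of the near-minimiser in the direction \<open>cnj a\<close>: its
        value of \<open>J\<close> stays above \<open>m\<close>, while \<open>J (f n)\<close> exceeds
        \<open>m\<close> only by the chosen error.\<close>
      have quad: "0 \<le> (1/4)^n / 4 + t\<^sup>2 * sq a + 2 * t * ?r" for t :: real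
      proof -
        let ?g = "\<lambda>x. f n x + of_real t * cnj (a x)"
        have g: "continuous_on UNIV ?g" by (intro continuous_intros f a)
        have ptw: "(cmod (z + of_real t * cnj w))\<^sup>2 = (cmod z)\<^sup>2 + t\<^sup>2 * (cmod w)\<^sup>2 + 2 * t * Re (w * z)" for z w
          unfolding cmod_power2 by (simp add: power2_eq_square algebra_simps)
        have af: "integrable M (\<lambda>x. a x * f n x)" by (intro int continuous_intros f a)
        have "sq ?g = sq (f n) + t\<^sup>2 * sq a + 2 * t * Re (LINT x|M. a x * f n x)"
          unfolding sq_def ptw integral_Re[OF af, symmetric]
          using isq[OF f] isq[OF a] integrable_Re[OF af] by simp
        moreover have "L (\<lambda>x. cnj (?g x)) = L (\<lambda>x. cnj (f n x)) + of_real t * L a"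
          using f a by (simp add: add scale continuous_intros)
        ultimately have "J ?g = J (f n) + t\<^sup>2 * sq a + 2 * t * ?r" by (simp add: J_def algebra_simps)
        then show ?thesis using m_le[OF g] Jf[of n] by simp
      qed
      \<comment> \<open>The sign makes the linear term negative. The size (1/2)^n brings the
        quadratic term to the order (1/4)^n of the error, leaving a bound of order (1/2)^n for the
        remainder.\<close>
      define t :: real where "t = (if ?r < 0 then 1 else - 1) * (1/2)^n"
      have half: "(1/2::real)^n * (1/2)^n = (1/4)^n"
        unfolding power_mult_distrib[symmetric] by simp
      have "t\<^sup>2 = (1/2)^n * (1/2)^n" by (simp add: t_def power2_eq_square)
      then have "t\<^sup>2 = (1/4)^n" by (simp only: half)
      moreover have "t * ?r = - ((1/2)^n * \<bar>?r\<bar>)" by (simp add: t_def abs_if algebra_simps)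
      ultimately have "2 * ((1/2)^n * \<bar>?r\<bar>) \<le> (1/4)^n / 4 + (1/4)^n * sq a" using quad[of t] by simp
      also have "\<dots> \<le> (1/4)^n * (1 + sq a)" by (simp add: algebra_simps)
      also have "\<dots> = (1/2)^n * ((1/2)^n * (1 + sq a))"
        by (simp only: half[symmetric] mult.assoc)
      finally have "(1/2::real)^n * (2 * \<bar>?r\<bar>) \<le> (1/2)^n * ((1/2)^n * (1 + sq a))" by (simp add: mult_ac)
      then have "2 * \<bar>?r\<bar> \<le> (1/2)^n * (1 + sq a)" by (rule mult_left_le_imp_le) simp
      then show ?thesis by simp
    qed
    have "(\<lambda>n. (1/2::real)^n * ((1 + sq a) / 2)) \<longlonglongrightarrow> 0 * ((1 + sq a) / 2)"
      by (intro tendsto_mult tendsto_const LIMSEQ_realpow_zero) simp_all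
    then have "(\<lambda>n. (1/2::real)^n * ((1 + sq a) / 2)) \<longlonglongrightarrow> 0" by simp
    then show ?thesis 
      by (rule Lim_null_comparison[rotated]) (use step in \<open>simp only: real_norm_def eventually_True simp_thms\<close>)
  qed
  have "L a = (LINT x|M. a x * h x)" if a: "continuous_on UNIV a" for a
  proof -
    have Re_eq: "Re (L b) = Re (LINT x|M. b x * h x)" if b: "continuous_on UNIV b" for b
    proof -
      have "(\<lambda>n. Re ((LINT x|M. b x * f n x) - L b)) \<longlonglongrightarrow> Re ((LINT x|M. b x * h x) - L b)"
        by (intro tendsto_intros lim1 b)
      then show ?thesis using LIMSEQ_unique[OF lim_Re[OF b]] by fastforce
    qed
    \<comment> \<open>Imaginary parts are real parts after multiplication by i.\<close>
    have "continuous_on UNIV (\<lambda>x. \<i> * a x)" by (intro continuous_intros a)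
    from Re_eq[OF this] have "Im (L a) = Im (LINT x|M. a x * h x)"
      by (simp add: scale a mult.assoc)
    then show ?thesis using Re_eq[OF a] by (simp add: complex_eq_iff)
  qed
  then show ?thesis using h by blast
qed


section \<open>The algebraic crossed product\<close>

lemma cont_alg_simps [simp]:
  "f \<in> carrier cont_alg \<longleftrightarrow> continuous_on UNIV f"
  "f \<otimes>\<^bsub>cont_alg\<^esub> g = (\<lambda>x. f x * g x)"
  "\<one>\<^bsub>cont_alg\<^esub> = (\<lambda>_. 1)"
  "\<zero>\<^bsub>cont_alg\<^esub> = (\<lambda>_. 0)"
  "f \<oplus>\<^bsub>cont_alg\<^esub> g = (\<lambda>x. f x + g x)"
  "c \<odot>\<^bsub>cont_alg\<^esub> f = (\<lambda>x. c * f x)"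
  "star cont_alg f = (\<lambda>x. cnj (f x))"
  "cnorm cont_alg f = (SUP x. cmod (f x))"
  by (simp_all add: cont_alg_def)

lemma continuous_functions_separate:
  fixes x y :: "'x::metric_space"
  assumes "\<And>a :: 'x \<Rightarrow> complex. continuous_on UNIV a \<Longrightarrow> a x = a y"
  shows "x = y"
proof -
  have "continuous_on UNIV (\<lambda>z. complex_of_real (dist z y))" by (intro continuous_intros)
  from assms[OF this] show ?thesis by simp
qed

text \<open>If no point evaluation agreed with \<open>\<xi>\<close>, compactness would give finitely many functions in the
  kernel whose squared moduli add up to an invertible function.\<close>

lemma character_is_evaluation:
  fixes \<xi> :: "('x::metric_space \<Rightarrow> complex) \<Rightarrow> complex"
  assumes X: "compact (UNIV :: 'x set)"
    and add: "\<And>a b. continuous_on UNIV a \<Longrightarrow> continuous_on UNIV b \<Longrightarrow> \<xi> (\<lambda>x. a x + b x) = \<xi> a + \<xi> b"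
    and scale: "\<And>c a. continuous_on UNIV a \<Longrightarrow> \<xi> (\<lambda>x. c * a x) = c * \<xi> a"
    and mult: "\<And>a b. continuous_on UNIV a \<Longrightarrow> continuous_on UNIV b \<Longrightarrow> \<xi> (\<lambda>x. a x * b x) = \<xi> a * \<xi> b"
    and one: "\<xi> (\<lambda>_. 1) = 1"
  shows "\<exists>y. \<forall>a. continuous_on UNIV a \<longrightarrow> \<xi> a = a y"
proof (rule ccontr)
  assume no: "\<not> ?thesis"
  have "\<exists>b. continuous_on UNIV b \<and> \<xi> b = 0 \<and> b y \<noteq> 0" for y
  proof -
    obtain a where a: "continuous_on UNIV a" "\<xi> a \<noteq> a y" using no by blast
    have c: "continuous_on UNIV (\<lambda>_ :: 'x. - \<xi> a)" by simp
    have c': "continuous_on UNIV (\<lambda>x. a x + - \<xi> a)" using continuous_on_add[OF a(1) c] .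
    have "\<xi> (\<lambda>_ :: 'x. - \<xi> a) = - \<xi> a" using scale[of "\<lambda>_. 1" "- \<xi> a"] one by simp
    then have "\<xi> (\<lambda>x. a x + - \<xi> a) = 0" using add[OF a(1) c] by simp
    then show ?thesis using a(2) c' by (intro exI[of _ "\<lambda>x. a x + - \<xi> a"]) simp
  qed
  then obtain b where b: "\<And>y. continuous_on UNIV (b y)" "\<And>y. \<xi> (b y) = 0" "\<And>y. b y y \<noteq> 0" by metis
  have "open {x. b y x \<noteq> 0}" for y
    using b(1)[of y] by (intro open_Collect_neq) simp_all
  moreover have "UNIV \<subseteq> (\<Union>y. {x. b y x \<noteq> 0})" using b(3) by blast
  ultimately obtain F where F: "finite F" "UNIV \<subseteq> (\<Union>y\<in>F. {x. b y x \<noteq> 0})"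
    using X by (metis (no_types, lifting) compactE_image)
  define s where "s G x = (\<Sum>y\<in>G. b y x * cnj (b y x))" for G x
  have s: "continuous_on UNIV (s G)" for G
    unfolding s_def by (intro continuous_intros b)
  have "finite G \<Longrightarrow> \<xi> (s G) = 0" for G
  proof (induction rule: finite_induct)
    case empty
    then show ?case using scale[of "\<lambda>_. 1" 0] by (simp add: s_def[abs_def])
  next
    case (insert y G)
    have c: "continuous_on UNIV (\<lambda>x. cnj (b y x))" by (intro continuous_intros b)
    then have c': "continuous_on UNIV (\<lambda>x. b y x * cnj (b y x))" by (intro continuous_intros b)
    have "\<xi> (\<lambda>x. b y x * cnj (b y x)) = 0" using mult[OF b(1) c] b(2) by simp
    moreover have "s (insert y G) = (\<lambda>x. b y x * cnj (b y x) + s G x)"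
      using insert by (simp add: s_def fun_eq_iff)
    ultimately show ?case using add[OF c' s[of G]] insert by simp
  qed
  then have "\<xi> (s F) = 0" using F(1) .
  have ne: "s F x \<noteq> 0" for x
  proof -
    obtain y where y: "y \<in> F" "b y x \<noteq> 0" using F(2) by blast
    have "s F x = of_real (\<Sum>y\<in>F. (cmod (b y x))\<^sup>2)" by (simp add: s_def complex_norm_square[symmetric])
    moreover have "(\<Sum>y\<in>F. (cmod (b y x))\<^sup>2) > 0" using y F(1) by (intro sum_pos2[of _ y]) auto
    ultimately show ?thesis by (metis less_irrefl of_real_eq_0_iff)
  qed
  have i: "continuous_on UNIV (\<lambda>x. inverse (s F x))" by (intro continuous_intros s) (simp add: ne)
  have "\<xi> (\<lambda>x. s F x * inverse (s F x)) = 0" using mult[OF s i] \<open>\<xi> (s F) = 0\<close> by simp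
  then show False using one by (simp add: ne)
qed

text \<open>For each x the map \<open>a -> \<sigma> a x\<close> is a character, hence evaluation at
  some \<open>T x\<close>. Continuity of \<open>T\<close> at x comes from testing
  \<open>\<sigma>\<close> on the distance to \<open>T x\<close>.\<close>

lemma homomorphism_is_composition:
  fixes \<sigma> :: "('x::metric_space \<Rightarrow> complex) \<Rightarrow> 'x \<Rightarrow> complex"
  assumes X: "compact (UNIV :: 'x set)"
    and cont: "\<And>a. continuous_on UNIV a \<Longrightarrow> continuous_on UNIV (\<sigma> a)"
    and add: "\<And>a b. continuous_on UNIV a \<Longrightarrow> continuous_on UNIV b \<Longrightarrow> \<sigma> (\<lambda>x. a x + b x) = (\<lambda>x. \<sigma> a x + \<sigma> b x)"
    and scale: "\<And>c a. continuous_on UNIV a \<Longrightarrow> \<sigma> (\<lambda>x. c * a x) = (\<lambda>x. c * \<sigma> a x)"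
    and mult: "\<And>a b. continuous_on UNIV a \<Longrightarrow> continuous_on UNIV b \<Longrightarrow> \<sigma> (\<lambda>x. a x * b x) = (\<lambda>x. \<sigma> a x * \<sigma> b x)"
    and one: "\<sigma> (\<lambda>_. 1) = (\<lambda>_. 1)"
  shows "\<exists>T. continuous_on UNIV T \<and> (\<forall>a. continuous_on UNIV a \<longrightarrow> (\<forall>x. \<sigma> a x = a (T x)))"
proof -
  have "\<exists>y. \<forall>a. continuous_on UNIV a \<longrightarrow> \<sigma> a x = a y" for x
  proof (rule character_is_evaluation[OF X, of "\<lambda>a. \<sigma> a x"])
    show "\<sigma> (\<lambda>_. 1) x = 1" by (rule fun_cong[OF one])
    fix a b :: "'x \<Rightarrow> complex" assume ab: "continuous_on UNIV a" "continuous_on UNIV b"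
    show "\<sigma> (\<lambda>x. a x + b x) x = \<sigma> a x + \<sigma> b x" by (rule fun_cong[OF add[OF ab]])
    show "\<sigma> (\<lambda>x. a x * b x) x = \<sigma> a x * \<sigma> b x" by (rule fun_cong[OF mult[OF ab]])
  next
    fix c and a :: "'x \<Rightarrow> complex" assume a: "continuous_on UNIV a"
    show "\<sigma> (\<lambda>x. c * a x) x = c * \<sigma> a x" by (rule fun_cong[OF scale[OF a]])
  qed
  then have "\<exists>T. \<forall>x. \<forall>a. continuous_on UNIV a \<longrightarrow> \<sigma> a x = a (T x)"
    by (intro choice allI)
  then obtain T where T: "\<forall>x. \<forall>a. continuous_on UNIV a \<longrightarrow> \<sigma> a x = a (T x)" by (elim exE)
  note T = T[rule_format]
  have "continuous_on UNIV T"
    unfolding continuous_on_def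
  proof
    fix x
    let ?a = "\<lambda>z. complex_of_real (dist z (T x))"
    have a: "continuous_on UNIV ?a" by (intro continuous_intros)
    have "((\<lambda>z. \<sigma> ?a z) \<longlongrightarrow> \<sigma> ?a x) (at x within UNIV)"
      using cont[OF a] by (simp add: continuous_on_def)
    then have "((\<lambda>z. complex_of_real (dist (T z) (T x))) \<longlongrightarrow> complex_of_real 0) (at x)"
      by (simp add: T[OF a])
    then have "((\<lambda>z. dist (T z) (T x)) \<longlongrightarrow> 0) (at x)" by (simp only: tendsto_of_real_iff)
    then show "(T \<longlongrightarrow> T x) (at x within UNIV)" by (rule tendsto_dist_iff[THEN iffD2])
  qed
  then show ?thesis
  proof (intro exI[of _ T] conjI allI impI)
    fix x and a :: "'x \<Rightarrow> complex" assume "continuous_on UNIV a"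
    then show "\<sigma> a x = a (T x)" by (rule T)
  qed
qed

text \<open>The automorphism and its inverse are both compositions with continuous maps. Since
  continuous functions separate points, these maps invert each other and \<open>T\<close> is unique,
  so the definite description in \<open>gelfand_homeo\<close> denotes it.\<close>

lemma gelfand_homeo_exists:
  fixes \<sigma> :: "('x::metric_space \<Rightarrow> complex) \<Rightarrow> 'x \<Rightarrow> complex"
  assumes X: "compact (UNIV :: 'x set)" and \<sigma>: "star_automorphism cont_alg \<sigma>"
  shows "\<exists>T'. homeomorphism UNIV UNIV (gelfand_homeo \<sigma>) T'"
    and "continuous_on UNIV a \<Longrightarrow> \<sigma> a x = a (gelfand_homeo \<sigma> x)"
proof -
  let ?C = "carrier (cont_alg :: ('x \<Rightarrow> complex) cstar_alg)"
  define \<tau> where "\<tau> = inv_into ?C \<sigma>"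
  have bij: "bij_betw \<sigma> ?C ?C" using \<sigma> by (simp add: star_automorphism_def)
  have cont: "continuous_on UNIV (\<sigma> a)" if "continuous_on UNIV a" for a
    using bij_betwE[OF bij] that by simp
  have add: "\<sigma> (\<lambda>x. a x + b x) = (\<lambda>x. \<sigma> a x + \<sigma> b x)" and mult: "\<sigma> (\<lambda>x. a x * b x) = (\<lambda>x. \<sigma> a x * \<sigma> b x)"
    if "continuous_on UNIV a" "continuous_on UNIV b" for a b
    using \<sigma> that by (simp_all add: star_automorphism_def)
  have scale: "\<sigma> (\<lambda>x. c * a x) = (\<lambda>x. c * \<sigma> a x)" if "continuous_on UNIV a" for a c
    using \<sigma> that by (simp add: star_automorphism_def)
  have \<tau>_cont: "continuous_on UNIV (\<tau> a)" and \<sigma>\<tau>: "\<sigma> (\<tau> a) = a" and \<tau>\<sigma>: "\<tau> (\<sigma> a) = a"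
    if "continuous_on UNIV a" for a
    using bij_betwE[OF bij_betw_inv_into[OF bij]] bij_betw_inv_into_right[OF bij] bij_betw_inv_into_left[OF bij] that
    by (simp_all add: \<tau>_def)
  have \<tau>_eq: "\<tau> a = b" if "a = \<sigma> b" "continuous_on UNIV b" for a b using \<tau>\<sigma> that by simp
  \<comment> \<open>\<open>star_automorphism\<close> says nothing about the unit. Surjectivity does:
    apply \<open>\<sigma>\<close> to the preimage of 1 multiplied by 1.\<close>
  have one: "\<sigma> (\<lambda>_. 1) = (\<lambda>_. 1)"
  proof -
    have c: "continuous_on UNIV (\<tau> (\<lambda>_. 1))" by (rule \<tau>_cont) simp
    have e: "\<sigma> (\<tau> (\<lambda>_. 1)) = (\<lambda>_. 1)" by (rule \<sigma>\<tau>) simp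
    have "\<sigma> (\<lambda>x. \<tau> (\<lambda>_. 1) x * 1) = (\<lambda>x. \<sigma> (\<tau> (\<lambda>_. 1)) x * \<sigma> (\<lambda>_. 1) x)"
      by (rule mult[OF c]) simp
    then have "(\<lambda>_. 1) = (\<lambda>x. 1 * \<sigma> (\<lambda>_. 1) x)" unfolding mult_1_right e .
    from fun_cong[OF this] show ?thesis by (intro ext) (simp only: mult_1_left)
  qed
  have "\<exists>T. continuous_on UNIV T \<and> (\<forall>a. continuous_on UNIV a \<longrightarrow> (\<forall>x. \<sigma> a x = a (T x)))"
    by (rule homomorphism_is_composition[of \<sigma>, OF X]) (fact cont add scale mult one)+
  then obtain T where T: "continuous_on UNIV T" "\<And>a x. continuous_on UNIV a \<Longrightarrow> \<sigma> a x = a (T x)"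
    by (elim exE conjE) simp
  have "\<exists>T. continuous_on UNIV T \<and> (\<forall>a. continuous_on UNIV a \<longrightarrow> (\<forall>x. \<tau> a x = a (T x)))"
  proof (rule homomorphism_is_composition[of \<tau>, OF X])
    show "continuous_on UNIV (\<tau> a)" if "continuous_on UNIV a" for a by (rule \<tau>_cont[OF that])
    show "\<tau> (\<lambda>_. 1) = (\<lambda>_. 1)" by (rule \<tau>_eq) (simp_all add: one)
    fix a b :: "'x \<Rightarrow> complex" assume ab: "continuous_on UNIV a" "continuous_on UNIV b"
    note c = \<tau>_cont[OF ab(1)] \<tau>_cont[OF ab(2)]
    show "\<tau> (\<lambda>x. a x + b x) = (\<lambda>x. \<tau> a x + \<tau> b x)"
      using continuous_on_add[OF c]
      by (intro \<tau>_eq) (simp_all only: add[OF c] \<sigma>\<tau>[OF ab(1)] \<sigma>\<tau>[OF ab(2)])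
    show "\<tau> (\<lambda>x. a x * b x) = (\<lambda>x. \<tau> a x * \<tau> b x)"
      using continuous_on_mult[OF c]
      by (intro \<tau>_eq) (simp_all only: mult[OF c] \<sigma>\<tau>[OF ab(1)] \<sigma>\<tau>[OF ab(2)])
  next
    fix c and a :: "'x \<Rightarrow> complex" assume a: "continuous_on UNIV a"
    show "\<tau> (\<lambda>x. c * a x) = (\<lambda>x. c * \<tau> a x)"
      using continuous_on_mult_left[OF \<tau>_cont[OF a], of c]
      by (intro \<tau>_eq) (simp_all only: scale[OF \<tau>_cont[OF a]] \<sigma>\<tau>[OF a])
  qed
  then obtain T' where T': "continuous_on UNIV T'" "\<And>a x. continuous_on UNIV a \<Longrightarrow> \<tau> a x = a (T' x)"
    by (elim exE conjE) simp
  have "T (T' x) = x" for x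
  proof (rule continuous_functions_separate)
    fix a :: "'x \<Rightarrow> complex" assume a: "continuous_on UNIV a"
    have "\<tau> (\<sigma> a) x = a (T (T' x))" using T'(2)[OF cont[OF a]] T(2)[OF a] by simp
    then show "a (T (T' x)) = a x" using \<tau>\<sigma>[OF a] by simp
  qed
  moreover have "T' (T x) = x" for x
  proof (rule continuous_functions_separate)
    fix a :: "'x \<Rightarrow> complex" assume a: "continuous_on UNIV a"
    have "\<sigma> (\<tau> a) x = a (T' (T x))" using T(2)[OF \<tau>_cont[OF a]] T'(2)[OF a] by simp
    then show "a (T' (T x)) = a x" using \<sigma>\<tau>[OF a] by simp
  qed
  ultimately have hom: "homeomorphism UNIV UNIV T T'"
    using T(1) T'(1) by (intro homeomorphismI) auto
  have *: "gelfand_homeo \<sigma> = T"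
    unfolding gelfand_homeo_def
  proof (rule the_equality)
    have "\<forall>a\<in>?C. \<forall>x. \<sigma> a x = a (T x)" by (intro ballI allI T(2)) simp
    then show "(\<exists>T'. homeomorphism UNIV UNIV T T') \<and> (\<forall>a\<in>?C. \<forall>x. \<sigma> a x = a (T x))"
      using hom by blast
    fix R assume R: "(\<exists>T'. homeomorphism UNIV UNIV R T') \<and> (\<forall>a\<in>?C. \<forall>x. \<sigma> a x = a (R x))"
    show "R = T"
    proof
      fix x show "R x = T x"
      proof (rule continuous_functions_separate)
        fix a :: "'x \<Rightarrow> complex" assume a: "continuous_on UNIV a"
        then have "\<sigma> a x = a (R x)" using R by simp
        then show "a (R x) = a (T x)" using T(2)[OF a, of x] by simp
      qed
    qed
  qed
  show "\<exists>T'. homeomorphism UNIV UNIV (gelfand_homeo \<sigma>) T'" using hom * by auto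
  show "\<sigma> a x = a (gelfand_homeo \<sigma> x)" if "continuous_on UNIV a" unfolding * by (rule T(2)[OF that])
qed

section \<open>Integer orbits and twisted convolution\<close>

locale cont_automorphism =
  fixes \<alpha> :: "('x::metric_space \<Rightarrow> complex) \<Rightarrow> ('x \<Rightarrow> complex)"
  assumes X: "compact (UNIV :: 'x set)"
    and \<alpha>: "star_automorphism cont_alg \<alpha>"
begin

text \<open>Split by sign in the same way as \<open>aut_power\<close>, so that the n-th power of
  \<open>\<alpha>\<close> becomes composition with \<open>orbit n\<close> case by case.\<close>

definition orbit :: "int \<Rightarrow> 'x \<Rightarrow> 'x" where
  "orbit n = (if 0 \<le> n then gelfand_homeo \<alpha> ^^ nat n else (inv_into UNIV (gelfand_homeo \<alpha>)) ^^ nat (- n))"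

lemma homeo: "homeomorphism UNIV UNIV (gelfand_homeo \<alpha>) (inv_into UNIV (gelfand_homeo \<alpha>))"
proof -
  obtain T' where T': "homeomorphism UNIV UNIV (gelfand_homeo \<alpha>) T'" using gelfand_homeo_exists(1)[OF X \<alpha>] by blast
  then have "inv_into UNIV (gelfand_homeo \<alpha>) = T'"
    by (intro Hilbert_Choice.inv_equality) (auto simp: homeomorphism_def)
  then show ?thesis using T' by simp
qed

lemma homeo_inv [simp]:
  "gelfand_homeo \<alpha> (inv_into UNIV (gelfand_homeo \<alpha>) x) = x" "inv_into UNIV (gelfand_homeo \<alpha>) (gelfand_homeo \<alpha> x) = x"
  using homeo by (auto simp: homeomorphism_def)

lemma orbit_0 [simp]: "orbit 0 x = x"
  by (simp add: orbit_def)

lemma orbit_succ: "orbit (n + 1) x = gelfand_homeo \<alpha> (orbit n x)"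
proof (cases "0 \<le> n")
  case True
  then have "nat (n + 1) = Suc (nat n)" by simp
  then show ?thesis using True by (simp add: orbit_def)
next
  case False
  then have "nat (- n) = Suc (nat (- (n + 1)))" by simp
  then show ?thesis using False by (auto simp: orbit_def)
qed

lemma orbit_pred: "orbit (n - 1) x = inv_into UNIV (gelfand_homeo \<alpha>) (orbit n x)"
  using orbit_succ[of "n - 1" x] by simp

lemma orbit_add: "orbit (m + n) x = orbit m (orbit n x)"
proof (induction m rule: int_induct[where k = 0])
  case (step1 i)
  then show ?case using orbit_succ[of "i + n" x] orbit_succ[of i "orbit n x"] by (simp add: ac_simps)
next
  case (step2 i)
  then show ?case using orbit_pred[of "i + n" x] orbit_pred[of i "orbit n x"] by (simp add: algebra_simps)
qed simp

lemma orbit_cancel [simp]: "orbit n (orbit (- n) x) = x" "orbit (- n) (orbit n x) = x"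
  using orbit_add[of n "- n" x] orbit_add[of "- n" n x] by simp_all

lemma continuous_orbit: "continuous_on UNIV (orbit n)"
proof -
  have "continuous_on UNIV (f ^^ k)" if "continuous_on UNIV f" for f :: "'x \<Rightarrow> 'x" and k
  proof (induction k)
    case (Suc k)
    then show ?case using continuous_on_compose[of UNIV "f ^^ k" f] continuous_on_subset[OF that subset_UNIV] by simp
  qed (simp add: id_def)
  then show ?thesis using homeo by (simp add: orbit_def homeomorphism_def)
qed

lemma continuous_on_orbit:
  "continuous_on UNIV f \<Longrightarrow> continuous_on UNIV (\<lambda>x. f (orbit n x))"
  for f :: "'x \<Rightarrow> 'y::topological_space"
  by (rule continuous_on_compose2[OF _ continuous_orbit]) auto

lemma aut_power_eq:
  assumes a: "continuous_on UNIV a"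
  shows "aut_power cont_alg \<alpha> n a = (\<lambda>x. a (orbit n x))"
proof -
  let ?C = "carrier (cont_alg :: ('x \<Rightarrow> complex) cstar_alg)"
  let ?S = "gelfand_homeo \<alpha>"
  have cS: "continuous_on UNIV (\<lambda>x. a (?S x))" and cS': "continuous_on UNIV (\<lambda>x. a (inv_into UNIV ?S x))"
    if "continuous_on UNIV a" for a :: "'x \<Rightarrow> complex"
    using that homeo continuous_on_compose2[of UNIV a UNIV ?S] continuous_on_compose2[of UNIV a UNIV "inv_into UNIV ?S"]
    by (auto simp: homeomorphism_def)
  have 1: "\<alpha> a = (\<lambda>x. a (?S x))" if "continuous_on UNIV a" for a
    using gelfand_homeo_exists(2)[OF X \<alpha> that] by auto
  have bij: "bij_betw \<alpha> ?C ?C" using \<alpha> by (simp add: star_automorphism_def)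
  have 2: "inv_into ?C \<alpha> a = (\<lambda>x. a (inv_into UNIV ?S x))" if "continuous_on UNIV a" for a
    using bij cS'[OF that] by (intro inv_into_f_eq) (auto simp: bij_betw_def 1)
  \<comment> \<open>Continuity of the iterates is carried through the induction because the
    composition formula for \<open>\<sigma>\<close> is available only on continuous
    functions.\<close>
  have pow: "continuous_on UNIV ((\<sigma> ^^ k) a) \<and> (\<sigma> ^^ k) a = (\<lambda>x. a ((R ^^ k) x))"
    if "\<And>a. continuous_on UNIV a \<Longrightarrow> \<sigma> a = (\<lambda>x. a (R x))"
       "\<And>a. continuous_on UNIV a \<Longrightarrow> continuous_on UNIV (\<lambda>x. a (R x) :: complex)"
    for \<sigma> :: "('x \<Rightarrow> complex) \<Rightarrow> 'x \<Rightarrow> complex" and R and k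
  proof (induction k)
    case (Suc k)
    then have c: "continuous_on UNIV ((\<sigma> ^^ k) a)" and eq: "(\<sigma> ^^ k) a = (\<lambda>x. a ((R ^^ k) x))" by blast+
    have "(\<sigma> ^^ Suc k) a = (\<lambda>x. (\<sigma> ^^ k) a (R x))" using that(1)[OF c] by simp
    moreover have "\<dots> = (\<lambda>x. a ((R ^^ Suc k) x))" unfolding eq by (simp add: funpow_swap1)
    ultimately show ?case using that(2)[OF c] by metis
  qed (simp add: a)
  show ?thesis
    using pow[of \<alpha> ?S, OF 1 cS] pow[of "inv_into ?C \<alpha>" "inv_into UNIV ?S", OF 2 cS'] by (simp add: aut_power_def orbit_def)
qed

definition supp :: "(int \<Rightarrow> 'x \<Rightarrow> complex) \<Rightarrow> int set" where
  "supp f = {n. f n \<noteq> (\<lambda>_. 0)}"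

abbreviation "P \<equiv> alg_crossed_product \<alpha>"

lemma P_carrier: "f \<in> carrier P \<longleftrightarrow> (\<forall>n. continuous_on UNIV (f n)) \<and> finite (supp f)"
  by (simp add: alg_crossed_product_def supp_def)

lemma P_simps [simp]:
  "f \<oplus>\<^bsub>P\<^esub> g = (\<lambda>n x. f n x + g n x)"
  "\<zero>\<^bsub>P\<^esub> = (\<lambda>n x. 0)"
  "\<one>\<^bsub>P\<^esub> = (\<lambda>n x. if n = 0 then 1 else 0)"
  "c \<odot>\<^bsub>P\<^esub> f = (\<lambda>n x. c * f n x)"
  by (simp_all add: alg_crossed_product_def)

lemma P_continuous: "f \<in> carrier P \<Longrightarrow> continuous_on UNIV (f n)"
  by (simp add: P_carrier)

lemma P_continuous_orbit: "f \<in> carrier P \<Longrightarrow> continuous_on UNIV (\<lambda>x. f n (orbit m x))"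
  by (intro continuous_on_orbit P_continuous)

lemma P_finite: "f \<in> carrier P \<Longrightarrow> finite (supp f)"
  by (simp add: P_carrier)

lemma supp_zero: "n \<notin> supp f \<Longrightarrow> f n x = 0"
  by (simp add: supp_def)

lemma star_eq: "f \<in> carrier P \<Longrightarrow> star P f = (\<lambda>n x. cnj (f (- n) (orbit n x)))"
proof -
  assume f: "f \<in> carrier P"
  have "star P f n = (\<lambda>x. cnj (f (- n) (orbit n x)))" for n
    using aut_power_eq[OF continuous_on_cnj[OF P_continuous[OF f]], of n "- n"] by (simp add: alg_crossed_product_def)
  then show ?thesis by (rule ext)
qed

text \<open>Allowing any finite \<open>F\<close> above the support lets sums over different supports
  be merged and reindexed.\<close>

lemma mult_eq:
  assumes f: "f \<in> carrier P" and g: "g \<in> carrier P" and F: "finite F" "supp f \<subseteq> F"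
  shows "f \<otimes>\<^bsub>P\<^esub> g = (\<lambda>n x. \<Sum>m\<in>F. f m x * g (n - m) (orbit m x))"
proof (intro ext)
  fix n x
  have "(f \<otimes>\<^bsub>P\<^esub> g) n x = (\<Sum>m\<in>supp f. f m x * g (n - m) (orbit m x))"
    using aut_power_eq[OF P_continuous[OF g]] by (simp add: alg_crossed_product_def supp_def)
  also have "\<dots> = (\<Sum>m\<in>F. f m x * g (n - m) (orbit m x))"
    using F by (intro sum.mono_neutral_left) (auto simp: supp_zero)
  finally show "(f \<otimes>\<^bsub>P\<^esub> g) n x = (\<Sum>m\<in>F. f m x * g (n - m) (orbit m x))" .
qed

lemma supp_mult:
  assumes f: "f \<in> carrier P" and g: "g \<in> carrier P"
  shows "supp (f \<otimes>\<^bsub>P\<^esub> g) \<subseteq> (\<lambda>(m, k). m + k) ` (supp f \<times> supp g)"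
proof
  fix n assume "n \<in> supp (f \<otimes>\<^bsub>P\<^esub> g)"
  then obtain x where "(f \<otimes>\<^bsub>P\<^esub> g) n x \<noteq> 0" by (auto simp: supp_def)
  then have "(\<Sum>m\<in>supp f. f m x * g (n - m) (orbit m x)) \<noteq> 0"
    unfolding mult_eq[OF f g P_finite[OF f] order_refl] .
  then obtain m where "m \<in> supp f" "f m x * g (n - m) (orbit m x) \<noteq> 0"
    by (rule sum.not_neutral_contains_not_neutral)
  then have "m \<in> supp f" "n - m \<in> supp g" by (auto simp: supp_def)
  then show "n \<in> (\<lambda>(m, k). m + k) ` (supp f \<times> supp g)" by (auto intro!: image_eqI[of _ _ "(m, n - m)"])
qed

lemma P_closed:
  assumes f: "f \<in> carrier P" and g: "g \<in> carrier P"
  shows "f \<oplus>\<^bsub>P\<^esub> g \<in> carrier P" "c \<odot>\<^bsub>P\<^esub> f \<in> carrier P" "f \<otimes>\<^bsub>P\<^esub> g \<in> carrier P" "star P f \<in> carrier P"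
    "\<one>\<^bsub>P\<^esub> \<in> carrier P" "\<zero>\<^bsub>P\<^esub> \<in> carrier P"
proof -
  have "supp (f \<oplus>\<^bsub>P\<^esub> g) \<subseteq> supp f \<union> supp g" by (auto simp: supp_def)
  then have "finite (supp (f \<oplus>\<^bsub>P\<^esub> g))" by (rule finite_subset) (simp add: P_finite f g)
  then show "f \<oplus>\<^bsub>P\<^esub> g \<in> carrier P" using f g by (simp add: P_carrier continuous_on_add)
  have "supp (c \<odot>\<^bsub>P\<^esub> f) \<subseteq> supp f" by (auto simp: supp_def)
  then have "finite (supp (c \<odot>\<^bsub>P\<^esub> f))" by (rule finite_subset) (simp add: P_finite f)
  then show "c \<odot>\<^bsub>P\<^esub> f \<in> carrier P" using f by (simp add: P_carrier continuous_on_mult_left)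
  have "finite (supp (f \<otimes>\<^bsub>P\<^esub> g))" by (rule finite_subset[OF supp_mult[OF f g]]) (simp add: P_finite f g)
  moreover have "continuous_on UNIV ((f \<otimes>\<^bsub>P\<^esub> g) n)" for n
    unfolding mult_eq[OF f g P_finite[OF f] order_refl] by (intro continuous_intros P_continuous[OF f] P_continuous_orbit[OF g])
  ultimately show "f \<otimes>\<^bsub>P\<^esub> g \<in> carrier P" by (simp add: P_carrier)
  have "supp (star P f) \<subseteq> uminus ` supp f"
  proof
    fix n assume "n \<in> supp (star P f)"
    then have "- n \<in> supp f" using f by (auto simp: star_eq supp_def fun_eq_iff)
    then show "n \<in> uminus ` supp f" by (auto intro!: image_eqI[of _ _ "- n"])
  qed
  then have "finite (supp (star P f))" by (rule finite_subset) (simp add: P_finite f)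
  moreover have "continuous_on UNIV (star P f n)" for n
    unfolding star_eq[OF f] by (intro continuous_intros P_continuous_orbit[OF f])
  ultimately show "star P f \<in> carrier P" by (simp add: P_carrier)
  have "supp \<one>\<^bsub>P\<^esub> \<subseteq> {0}" by (auto simp: supp_def)
  then have "finite (supp \<one>\<^bsub>P\<^esub>)" by (rule finite_subset) simp
  then show "\<one>\<^bsub>P\<^esub> \<in> carrier P" by (simp add: P_carrier)
  show "\<zero>\<^bsub>P\<^esub> \<in> carrier P" by (simp add: P_carrier supp_def)
qed

lemma P_assoc:
  assumes f: "f \<in> carrier P" and g: "g \<in> carrier P" and h: "h \<in> carrier P"
  shows "(f \<otimes>\<^bsub>P\<^esub> g) \<otimes>\<^bsub>P\<^esub> h = f \<otimes>\<^bsub>P\<^esub> (g \<otimes>\<^bsub>P\<^esub> h)"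
proof (intro ext)
  fix n x
  let ?K = "(\<lambda>(m, k). m + k) ` (supp f \<times> supp g)"
  have K: "finite ?K" by (simp add: P_finite f g)
  \<comment> \<open>Substituting k = m + j identifies the inner sum with a convolution at n - m.
    \<open>?K\<close> contains every such k, and the additional indices contribute 0.\<close>
  have shift: "(\<Sum>k\<in>?K. g (k - m) y * h (n - k) (orbit (k - m) y)) =
      (\<Sum>j\<in>supp g. g j y * h (n - m - j) (orbit j y))" if m: "m \<in> supp f" for m y
  proof -
    have "(\<Sum>j\<in>supp g. g j y * h (n - m - j) (orbit j y)) =
        (\<Sum>k\<in>(\<lambda>j. m + j) ` supp g. g (k - m) y * h (n - k) (orbit (k - m) y))"
      by (subst sum.reindex) (auto simp: inj_on_def algebra_simps)
    also have "\<dots> = (\<Sum>k\<in>?K. g (k - m) y * h (n - k) (orbit (k - m) y))"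
    proof (intro sum.mono_neutral_left ballI K)
      show "(\<lambda>j. m + j) ` supp g \<subseteq> ?K" using m by force
      fix k assume "k \<in> ?K - (\<lambda>j. m + j) ` supp g"
      then have "k - m \<notin> supp g" by (auto simp: image_iff)
      then show "g (k - m) y * h (n - k) (orbit (k - m) y) = 0" by (simp add: supp_zero)
    qed
    finally show ?thesis by simp
  qed
  have orb: "orbit k x = orbit (k - m) (orbit m x)" for k m using orbit_add[of "k - m" m x] by simp
  have "((f \<otimes>\<^bsub>P\<^esub> g) \<otimes>\<^bsub>P\<^esub> h) n x = (\<Sum>k\<in>?K. (f \<otimes>\<^bsub>P\<^esub> g) k x * h (n - k) (orbit k x))"
    by (simp add: mult_eq[OF P_closed(3)[OF f g] h K supp_mult[OF f g]])
  also have "\<dots> = (\<Sum>k\<in>?K. \<Sum>m\<in>supp f. f m x * (g (k - m) (orbit m x) * h (n - k) (orbit k x)))"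
    by (simp add: mult_eq[OF f g P_finite[OF f] order_refl] sum_distrib_right mult.assoc)
  also have "\<dots> = (\<Sum>m\<in>supp f. f m x * (\<Sum>k\<in>?K. g (k - m) (orbit m x) * h (n - k) (orbit k x)))"
    by (subst sum.swap) (simp add: sum_distrib_left)
  also have "\<dots> = (\<Sum>m\<in>supp f. f m x * (\<Sum>k\<in>?K. g (k - m) (orbit m x) * h (n - k) (orbit (k - m) (orbit m x))))"
    using orb by (intro sum.cong refl arg_cong2[where f = "(*)"]) simp
  also have "\<dots> = (\<Sum>m\<in>supp f. f m x * (g \<otimes>\<^bsub>P\<^esub> h) (n - m) (orbit m x))"
    by (intro sum.cong refl) (simp add: shift mult_eq[OF g h P_finite[OF g] order_refl])
  also have "\<dots> = (f \<otimes>\<^bsub>P\<^esub> (g \<otimes>\<^bsub>P\<^esub> h)) n x"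
    by (simp add: mult_eq[OF f P_closed(3)[OF g h] P_finite[OF f] order_refl])
  finally show "((f \<otimes>\<^bsub>P\<^esub> g) \<otimes>\<^bsub>P\<^esub> h) n x = (f \<otimes>\<^bsub>P\<^esub> (g \<otimes>\<^bsub>P\<^esub> h)) n x" .
qed

text \<open>The monomial \<open>a V^n\<close>.\<close>

definition single :: "int \<Rightarrow> ('x \<Rightarrow> complex) \<Rightarrow> int \<Rightarrow> 'x \<Rightarrow> complex" where
  "single n a = (\<lambda>k x. if k = n then a x else 0)"

lemma supp_single: "supp (single n a) \<subseteq> {n}"
  by (auto simp: supp_def single_def)

lemma single_closed: 
  assumes a: "continuous_on UNIV a"
  shows "single n a \<in> carrier P"
proof -
  have "finite (supp (single n a))" by (rule finite_subset[OF supp_single]) simp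
  moreover have "continuous_on UNIV (single n a k)" for k
    by (cases "k = n") (simp_all add: single_def a)
  ultimately show ?thesis by (simp add: P_carrier)
qed

lemma one_eq_single: "\<one>\<^bsub>P\<^esub> = single 0 (\<lambda>_. 1)"
  by (simp add: single_def)

lemma mult_single:
  assumes a: "continuous_on UNIV a" and g: "g \<in> carrier P"
  shows "single m a \<otimes>\<^bsub>P\<^esub> g = (\<lambda>n x. a x * g (n - m) (orbit m x))"
  unfolding mult_eq[OF single_closed[OF a] g _ supp_single, simplified] by (simp add: single_def)

text \<open>The product is summed over the indices of \<open>f\<close> itself, by the substitution m
  = - i. For \<open>g = f\<close> and \<open>k = 0\<close> it becomes a sum of squared moduli, which
  shows positivity.\<close>

lemma P_star_mult:
  assumes f: "f \<in> carrier P" and g: "g \<in> carrier P" and F: "finite F" "supp f \<subseteq> F"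
  shows "(star P f \<otimes>\<^bsub>P\<^esub> g) k x = (\<Sum>i\<in>F. cnj (f i (orbit (- i) x)) * g (k + i) (orbit (- i) x))"
proof -
  have "supp (star P f) \<subseteq> uminus ` F"
  proof
    fix n assume "n \<in> supp (star P f)"
    then have "- n \<in> supp f" using f by (auto simp: star_eq supp_def fun_eq_iff)
    then show "n \<in> uminus ` F" using F(2) by (auto intro!: image_eqI[of _ _ "- n"])
  qed
  from mult_eq[OF P_closed(4)[OF f f] g _ this] F(1)
  have "(star P f \<otimes>\<^bsub>P\<^esub> g) k x = (\<Sum>m\<in>uminus ` F. star P f m x * g (k - m) (orbit m x))" by simp
  also have "\<dots> = (\<Sum>i\<in>F. cnj (f i (orbit (- i) x)) * g (k + i) (orbit (- i) x))"
    by (subst sum.reindex) (simp_all add: star_eq[OF f])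
  finally show ?thesis .
qed

lemma P_monoid: "Group.monoid P"
proof (rule monoidI)
  fix f assume f: "f \<in> carrier P"
  have c1: "continuous_on UNIV (\<lambda>_ :: 'x. 1 :: complex)" by simp
  show "\<one>\<^bsub>P\<^esub> \<otimes>\<^bsub>P\<^esub> f = f" unfolding one_eq_single mult_single[OF c1 f] by simp
  show "f \<otimes>\<^bsub>P\<^esub> \<one>\<^bsub>P\<^esub> = f"
  proof (intro ext)
    fix n x
    have fin: "finite (insert n (supp f))" using P_finite[OF f] by simp
    have "(f \<otimes>\<^bsub>P\<^esub> \<one>\<^bsub>P\<^esub>) n x = (\<Sum>m\<in>insert n (supp f). f m x * \<one>\<^bsub>P\<^esub> (n - m) (orbit m x))"
      unfolding mult_eq[OF f P_closed(5)[OF f f] fin subset_insertI] ..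
    also have "\<dots> = (\<Sum>m\<in>insert n (supp f). if m = n then f m x else 0)"
      by (intro sum.cong) auto
    finally have "(f \<otimes>\<^bsub>P\<^esub> \<one>\<^bsub>P\<^esub>) n x = (\<Sum>m\<in>insert n (supp f). if m = n then f m x else 0)" .
    then show "(f \<otimes>\<^bsub>P\<^esub> \<one>\<^bsub>P\<^esub>) n x = f n x" using P_finite[OF f] by (simp add: sum.delta)
  qed
next
  show "\<one>\<^bsub>P\<^esub> \<in> carrier P" unfolding one_eq_single by (rule single_closed) simp
qed (simp_all only: P_closed P_assoc)

lemma P_abelian_group: "abelian_group P"
proof (rule abelian_groupI)
  fix f assume f: "f \<in> carrier P"
  show "\<exists>g\<in>carrier P. g \<oplus>\<^bsub>P\<^esub> f = \<zero>\<^bsub>P\<^esub>"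
    by (rule bexI[OF _ P_closed(2)[OF f f, of "- 1"]]) simp
next
  show "\<zero>\<^bsub>P\<^esub> \<in> carrier P" by (simp add: P_carrier supp_def)
qed (simp_all add: P_closed(1)[simplified] add_ac)

lemma P_ring: "ring P"
proof (rule ringI[OF P_abelian_group P_monoid])
  fix f g h assume f: "f \<in> carrier P" and g: "g \<in> carrier P" and h: "h \<in> carrier P"
  let ?F = "supp f \<union> supp g"
  have F: "finite ?F" by (simp add: P_finite f g)
  have s: "supp (f \<oplus>\<^bsub>P\<^esub> g) \<subseteq> ?F" by (auto simp: supp_def)
  show "(f \<oplus>\<^bsub>P\<^esub> g) \<otimes>\<^bsub>P\<^esub> h = f \<otimes>\<^bsub>P\<^esub> h \<oplus>\<^bsub>P\<^esub> g \<otimes>\<^bsub>P\<^esub> h"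
    unfolding mult_eq[OF P_closed(1)[OF f g] h F s] mult_eq[OF f h F Un_upper1] mult_eq[OF g h F Un_upper2]
    by (simp add: distrib_right sum.distrib)
  show "h \<otimes>\<^bsub>P\<^esub> (f \<oplus>\<^bsub>P\<^esub> g) = h \<otimes>\<^bsub>P\<^esub> f \<oplus>\<^bsub>P\<^esub> h \<otimes>\<^bsub>P\<^esub> g"
    unfolding mult_eq[OF h P_closed(1)[OF f g] P_finite[OF h] order_refl] mult_eq[OF h f P_finite[OF h] order_refl]
      mult_eq[OF h g P_finite[OF h] order_refl]
    by (simp add: distrib_left sum.distrib)
qed

lemma complex_field_cring: "cring complex_field"
proof (rule cringI)
  show "abelian_group complex_field"
  proof (rule abelian_groupI)
    fix x assume "x \<in> carrier complex_field"
    show "\<exists>y\<in>carrier complex_field. y \<oplus>\<^bsub>complex_field\<^esub> x = \<zero>\<^bsub>complex_field\<^esub>"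
      by (rule bexI[of _ "- x"]) (simp_all add: complex_field_def)
  qed (simp_all add: complex_field_def)
  show "Group.comm_monoid complex_field"
    by (rule comm_monoidI) (simp_all add: complex_field_def)
qed (simp add: complex_field_def distrib_right)

lemma P_star_algebra: "star_algebra P"
  unfolding star_algebra_def
proof (intro conjI allI ballI)
  show "ring P" by (rule P_ring)
  show "Module.module complex_field P"
    by (rule moduleI[OF complex_field_cring P_abelian_group])
      (simp_all add: P_closed(2)[simplified] complex_field_def algebra_simps)
next
  fix c f g assume f: "f \<in> carrier P" and g: "g \<in> carrier P"
  have s: "supp (c \<odot>\<^bsub>P\<^esub> f) \<subseteq> supp f" by (auto simp: supp_def)
  show "(c \<odot>\<^bsub>P\<^esub> f) \<otimes>\<^bsub>P\<^esub> g = c \<odot>\<^bsub>P\<^esub> (f \<otimes>\<^bsub>P\<^esub> g)"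
    unfolding mult_eq[OF P_closed(2)[OF f f] g P_finite[OF f] s] mult_eq[OF f g P_finite[OF f] order_refl]
    by (simp add: sum_distrib_left mult.assoc)
  show "f \<otimes>\<^bsub>P\<^esub> (c \<odot>\<^bsub>P\<^esub> g) = c \<odot>\<^bsub>P\<^esub> (f \<otimes>\<^bsub>P\<^esub> g)"
    unfolding mult_eq[OF f P_closed(2)[OF g g] P_finite[OF f] order_refl] mult_eq[OF f g P_finite[OF f] order_refl]
    by (simp add: sum_distrib_left mult_ac)
next
  fix f assume f: "f \<in> carrier P"
  show sf: "star P f \<in> carrier P" by (rule P_closed(4)[OF f f])
  show "star P (star P f) = f" unfolding star_eq[OF sf] unfolding star_eq[OF f] by simp
next
  fix c f assume f: "f \<in> carrier P"
  show "star P (c \<odot>\<^bsub>P\<^esub> f) = cnj c \<odot>\<^bsub>P\<^esub> star P f"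
    unfolding star_eq[OF P_closed(2)[OF f f]] star_eq[OF f] by simp
next
  fix f g assume f: "f \<in> carrier P" and g: "g \<in> carrier P"
  show "star P (f \<oplus>\<^bsub>P\<^esub> g) = star P f \<oplus>\<^bsub>P\<^esub> star P g"
    unfolding star_eq[OF P_closed(1)[OF f g]] star_eq[OF f] star_eq[OF g] by simp
  show "star P (f \<otimes>\<^bsub>P\<^esub> g) = star P g \<otimes>\<^bsub>P\<^esub> star P f"
  proof (intro ext)
    fix n x
    \<comment> \<open>The first piece contains \<open>supp g\<close>; the second is chosen so that
      the reflection i -> - n - i maps \<open>?K\<close> onto a set containing
      \<open>supp f\<close>.\<close>
    let ?K = "supp g \<union> (\<lambda>m. - n - m) ` supp f"
    have K: "finite ?K" by (simp add: P_finite f g)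
    have orb: "orbit (- i) x = orbit (- n - i) (orbit n x)" for i
      using orbit_add[of "- n - i" n x] by simp
    have "(star P g \<otimes>\<^bsub>P\<^esub> star P f) n x =
        (\<Sum>i\<in>?K. cnj (g i (orbit (- i) x)) * star P f (n + i) (orbit (- i) x))"
      by (rule P_star_mult[OF g P_closed(4)[OF f f] K Un_upper1])
    also have "\<dots> = (\<Sum>i\<in>?K. cnj (g i (orbit (- i) x)) * cnj (f (- n - i) (orbit n x)))"
    proof (intro sum.cong refl)
      fix i
      have "orbit (n + i) (orbit (- i) x) = orbit n x" using orbit_add[of "n + i" "- i" x] by simp
      then show "cnj (g i (orbit (- i) x)) * star P f (n + i) (orbit (- i) x) =
          cnj (g i (orbit (- i) x)) * cnj (f (- n - i) (orbit n x))"
        unfolding star_eq[OF f] by simp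
    qed
    also have "\<dots> = (\<Sum>m\<in>(\<lambda>i. - n - i) ` ?K. cnj (f m (orbit n x) * g (- n - m) (orbit m (orbit n x))))"
      by (subst sum.reindex) (auto simp: inj_on_def mult.commute orb)
    also have "\<dots> = cnj ((f \<otimes>\<^bsub>P\<^esub> g) (- n) (orbit n x))"
    proof -
      have "supp f \<subseteq> (\<lambda>i. - n - i) ` ?K" by (auto simp: image_image image_Un)
      then show ?thesis using K by (subst mult_eq[OF f g]) (simp_all add: cnj_sum)
    qed
    finally show "star P (f \<otimes>\<^bsub>P\<^esub> g) n x = (star P g \<otimes>\<^bsub>P\<^esub> star P f) n x"
      unfolding star_eq[OF P_closed(3)[OF f g]] by simp
  qed
qed

text \<open>Both \<open>u\<close> and V are unitary, hence so is their product
  \<open>u V^n\<close>.\<close>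

lemma single_isometry:
  assumes u: "continuous_on UNIV u" and mod: "\<And>x. cmod (u x) = 1"
  shows "single n u \<in> isometry_span P"
proof (rule isometry_span.isometry[OF single_closed[OF u]])
  have "(star P (single n u) \<otimes>\<^bsub>P\<^esub> single n u) k x = (if k = 0 then 1 else 0)" for k x
    using P_star_mult[OF single_closed[OF u] single_closed[OF u] _ supp_single, of n n k x] mod
    by (simp add: single_def complex_norm_square[symmetric] mult.commute[of "cnj z" for z])
  then show "star P (single n u) \<otimes>\<^bsub>P\<^esub> single n u = \<one>\<^bsub>P\<^esub>" by (simp add: fun_eq_iff)
qed

text \<open>A real function \<open>r\<close> with values in \<open>[-1, 1]\<close> is the real part of the unitary \<open>r + i \<surd>(1 - r\<^sup>2)\<close>.\<close>

lemma single_real_span: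
  assumes r: "continuous_on UNIV r" and bnd: "\<And>x. \<bar>r x\<bar> \<le> 1"
  shows "single n (\<lambda>x. of_real (r x)) \<in> isometry_span P"
proof -
  define u where "u x = Complex (r x) (sqrt (1 - (r x)\<^sup>2))" for x
  have le: "(r x)\<^sup>2 \<le> 1" for x using bnd[of x] by (simp add: abs_square_le_1)
  have u: "continuous_on UNIV u" unfolding u_def Complex_eq by (intro continuous_intros r)
  have cu: "continuous_on UNIV (\<lambda>x. cnj (u x))" by (intro continuous_intros u)
  have mod: "cmod (u x) = 1" for x using le[of x] by (simp add: u_def cmod_def)
  have "single n (\<lambda>x. of_real (r x)) = (1/2) \<odot>\<^bsub>P\<^esub> (single n u \<oplus>\<^bsub>P\<^esub> single n (\<lambda>x. cnj (u x)))"
    by (auto simp: single_def fun_eq_iff u_def complex_eq_iff)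
  then show ?thesis
    using isometry_span.smult[OF isometry_span.add[OF single_isometry[OF u mod] single_isometry[OF cu]], of "1/2"] mod
    by (simp only: complex_mod_cnj)
qed

lemma single_span:
  assumes a: "continuous_on UNIV a"
  shows "single n a \<in> isometry_span P"
proof -
  have "bounded (range a)"
    using compact_continuous_image[OF a X] by (rule compact_imp_bounded)
  \<comment> \<open>Dividing by a positive bound brings real and imaginary parts into [-1, 1], where
    \<open>single_real_span\<close> applies.\<close>
  then obtain K where K: "K > 0" "\<And>x. cmod (a x) \<le> K" by (auto simp: bounded_pos)
  have r: "continuous_on UNIV (\<lambda>x. Re (a x) / K)" and i: "continuous_on UNIV (\<lambda>x. Im (a x) / K)"
    using K(1) by (intro continuous_intros a; simp)+
  have rb: "\<bar>Re (a x) / K\<bar> \<le> 1" and ib: "\<bar>Im (a x) / K\<bar> \<le> 1" for x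
    using K(1) order_trans[OF abs_Re_le_cmod K(2)[of x]] order_trans[OF abs_Im_le_cmod K(2)[of x]]
    by (simp_all add: field_simps)
  have "single n a = of_real K \<odot>\<^bsub>P\<^esub> (single n (\<lambda>x. of_real (Re (a x) / K)) \<oplus>\<^bsub>P\<^esub>
      \<i> \<odot>\<^bsub>P\<^esub> single n (\<lambda>x. of_real (Im (a x) / K)))"
    using K(1) by (auto simp: single_def fun_eq_iff complex_eq_iff)
  then show ?thesis
    using isometry_span.smult[OF isometry_span.add[OF single_real_span[OF r rb]
        isometry_span.smult[OF single_real_span[OF i ib], of \<i>]], of "of_real K"]
    by (simp only:)
qed

lemma isometry_span_finite_support:
  assumes "finite F"
  shows "f \<in> carrier P \<Longrightarrow> supp f \<subseteq> F \<Longrightarrow> f \<in> isometry_span P"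
  using assms
proof (induction F arbitrary: f rule: finite_induct)
  case empty
  then have "f = (\<lambda>n x. 0)" by (auto simp: supp_def)
  then have "f = 0 \<odot>\<^bsub>P\<^esub> single 0 (\<lambda>_. 1)" by simp
  then show ?case using isometry_span.smult[OF single_span, of "\<lambda>_. 1" 0 0] by simp
next
  case (insert n F)
  define g where "g = f(n := \<lambda>_. 0)"
  have s: "supp g \<subseteq> F" "supp g \<subseteq> supp f" using insert.prems(2) by (auto simp: supp_def g_def)
  have "continuous_on UNIV (g k)" for k
    using P_continuous[OF insert.prems(1)] by (cases "k = n") (simp_all add: g_def)
  then have "g \<in> carrier P" using finite_subset[OF s(1) insert.hyps(1)] by (simp add: P_carrier)
  then have g: "g \<in> isometry_span P" using insert.IH s(1) by blast
  have "f = g \<oplus>\<^bsub>P\<^esub> single n (f n)" by (auto simp: g_def single_def fun_eq_iff)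
  then show ?case
    using isometry_span.add[OF g single_span[OF P_continuous[OF insert.prems(1)], of n n]] by (simp only:)
qed

lemma P_isometry_star_alg: "isometry_star_alg P"
proof
  show "star_algebra P" by (rule P_star_algebra)
  show "carrier P \<subseteq> isometry_span P" using isometry_span_finite_support P_finite by blast
qed

end


section \<open>Ergodicity of the base system\<close>

text \<open>If K is the supremum of the modulus of \<open>a\<close>, then K^2 - |a|^2 is the squared
  modulus of the continuous function \<open>d\<close>. Positivity at \<open>d\<close> bounds
  \<open>q a\<close> by K, and Cauchy-Schwarz against the unit bounds
  \<open>\<phi> a\<close>.\<close>

lemma state_cont_algI:
  fixes \<phi> :: "('x::metric_space \<Rightarrow> complex) \<Rightarrow> complex"
  assumes X: "compact (UNIV :: 'x set)" and sa: "star_algebra (cont_alg :: ('x \<Rightarrow> complex) cstar_alg)"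
    and \<phi>: "algebraic_state cont_alg \<phi>"
  shows "state cont_alg \<phi>"
proof -
  interpret star_alg_state "cont_alg :: ('x \<Rightarrow> complex) cstar_alg" \<phi>
    using sa \<phi> by unfold_locales
  have "cmod (\<phi> a) \<le> (SUP x. cmod (a x))" if a: "continuous_on UNIV a" for a
  proof -
    have "bounded (range a)"
      using compact_continuous_image[OF a X] by (rule compact_imp_bounded)
    then have bdd: "bdd_above (range (\<lambda>x. cmod (a x)))"
      by (auto simp: bounded_iff bdd_above_def)
    define K where "K = (SUP x. cmod (a x))"
    have K: "cmod (a x) \<le> K" for x unfolding K_def by (rule cSUP_upper[OF UNIV_I bdd])
    have K0: "0 \<le> K" using order_trans[OF norm_ge_zero K] .
    define d where "d x = complex_of_real (sqrt (K\<^sup>2 - (cmod (a x))\<^sup>2))" for x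
    have d: "continuous_on UNIV d" unfolding d_def by (intro continuous_intros a)
    have aa: "continuous_on UNIV (\<lambda>x. cnj (a x) * a x)" by (intro continuous_intros a)
    have "cnj (d x) * d x = of_real (K\<^sup>2) * 1 + (- 1) * (cnj (a x) * a x)" for x
    proof -
      have "(cmod (a x))\<^sup>2 \<le> K\<^sup>2" using K[of x] by (intro power_mono) simp_all
      then have "cnj (d x) * d x = of_real (K\<^sup>2 - (cmod (a x))\<^sup>2)"
        unfolding d_def complex_cnj_complex_of_real of_real_mult[symmetric] by simp
      then show ?thesis
        by (simp add: complex_norm_square mult.commute del: of_real_power)
    qed
    then have "\<phi> (\<lambda>x. cnj (d x) * d x) = \<phi> (\<lambda>x. of_real (K\<^sup>2) * 1 + (- 1) * (cnj (a x) * a x))"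
      by presburger
    also have "\<dots> = \<phi> (\<lambda>x. of_real (K\<^sup>2) * 1) + \<phi> (\<lambda>x. (- 1) * (cnj (a x) * a x))"
      using \<psi>_add[of "\<lambda>x. of_real (K\<^sup>2) * 1" "\<lambda>x. (- 1) * (cnj (a x) * a x)"] continuous_on_mult_left[OF aa, of "- 1"] by simp
    also have "\<dots> = of_real (K\<^sup>2) - \<phi> (\<lambda>x. cnj (a x) * a x)"
      using \<psi>_smult[of "\<lambda>_. 1" "of_real (K\<^sup>2)"] \<psi>_smult[of "\<lambda>x. cnj (a x) * a x" "- 1"] \<psi>_one aa by simp
    finally have "Re (\<phi> (\<lambda>x. cnj (a x) * a x)) \<le> K\<^sup>2"
      using \<psi>_nonneg[of d] d by simp
    then have "q a \<le> K" using K0 by (simp add: state_seminorm_def real_le_lsqrt)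
    moreover have "cmod (\<phi> a) \<le> q \<one>\<^bsub>cont_alg\<^esub> * q a"
      using cauchy_schwarz[of "\<lambda>_. 1" a] a by simp
    ultimately show ?thesis using q_one by (simp add: K_def)
  qed
  then show ?thesis using \<phi> by (simp add: state_def algebraic_state_def)
qed

section \<open>The invariant measure and its ergodicity\<close>

locale skew_system = cont_automorphism \<alpha>
  for \<alpha> :: "('x::metric_space \<Rightarrow> complex) \<Rightarrow> ('x \<Rightarrow> complex)" +
  fixes \<theta> :: "'g::topological_group_add \<Rightarrow> ('x \<Rightarrow> complex) \<Rightarrow> ('x \<Rightarrow> complex)"
    and u :: "'g \<Rightarrow> 'x \<Rightarrow> complex"
    and \<omega>\<^sub>0 :: "('x \<Rightarrow> complex) \<Rightarrow> complex"
    and \<mu>\<^sub>0 :: "'x measure"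
  assumes system: "cstar_dynamical_system cont_alg \<theta>"
    and ergodic: "uniquely_ergodic cont_alg \<theta>"
    and \<omega>\<^sub>0: "invariant_state cont_alg \<theta> \<omega>\<^sub>0"
    and prob: "prob_space \<mu>\<^sub>0" and sets_\<mu>: "sets \<mu>\<^sub>0 = sets borel"
    and \<omega>\<^sub>0_eq: "\<And>f. f \<in> carrier cont_alg \<Longrightarrow> \<omega>\<^sub>0 f = (LINT x|\<mu>\<^sub>0. f x)"
    and commute: "\<And>g a. a \<in> carrier cont_alg \<Longrightarrow> \<alpha> (\<theta> g a) = \<theta> g (\<alpha> a)"
    and cocycle: "continuous_cocycle \<theta> u"
begin

sublocale prob_space \<mu>\<^sub>0 by (rule prob)

abbreviation "T g \<equiv> gelfand_homeo (\<theta> g)"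

lemma space_\<mu> [simp]: "space \<mu>\<^sub>0 = UNIV"
  using sets_eq_imp_space_eq[OF sets_\<mu>] by simp

lemma prob_UNIV [simp]: "prob UNIV = 1"
  using prob_space by simp

lemma \<theta>_aut: "star_automorphism cont_alg (\<theta> g)"
  using system by (simp add: cstar_dynamical_system_def)

lemma cont_star_algebra: "star_algebra (cont_alg :: ('x \<Rightarrow> complex) cstar_alg)"
  using system by (simp add: cstar_dynamical_system_def cstar_algebra_def)

lemma \<theta>_eq: "continuous_on UNIV a \<Longrightarrow> \<theta> g a = (\<lambda>x. a (T g x))"
  by (rule ext) (rule gelfand_homeo_exists(2)[OF X \<theta>_aut])

lemma continuous_T: "continuous_on UNIV (T g)"
  using gelfand_homeo_exists(1)[OF X \<theta>_aut, of g] by (auto simp: homeomorphism_def)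

lemma continuous_on_T:
  "continuous_on UNIV f \<Longrightarrow> continuous_on UNIV (\<lambda>x. f (T g x))"
  for f :: "'x \<Rightarrow> 'y::topological_space"
  by (rule continuous_on_compose2[OF _ continuous_T]) auto

lemma borel_continuous: 
  "continuous_on UNIV f \<Longrightarrow> f \<in> borel_measurable \<mu>\<^sub>0"
  for f :: "'x \<Rightarrow> 'y::topological_space"
  using borel_measurable_continuous_onI[of f] sets_\<mu> by (simp cong: measurable_cong_sets)

lemma integrable_continuous: 
  "continuous_on UNIV f \<Longrightarrow> integrable \<mu>\<^sub>0 f"
  for f :: "'x \<Rightarrow> 'y::{banach, second_countable_topology}"
  by (rule integrable_continuous_compact[OF X finite_measure_axioms sets_\<mu>])

lemma T_measurable [measurable]: "T g \<in> measurable \<mu>\<^sub>0 \<mu>\<^sub>0"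
proof -
  have "T g \<in> borel_measurable \<mu>\<^sub>0" by (rule borel_continuous[OF continuous_T])
  then show ?thesis using sets_\<mu> by (simp cong: measurable_cong_sets)
qed

lemma invariant_state_unique:
  assumes \<phi>: "algebraic_state cont_alg \<phi>"
    and inv: "\<And>g a. continuous_on UNIV a \<Longrightarrow> \<phi> (\<lambda>x. a (T g x)) = \<phi> a"
    and a: "continuous_on UNIV a"
  shows "\<phi> a = (LINT x|\<mu>\<^sub>0. a x)"
proof -
  have "invariant_state cont_alg \<theta> \<phi>"
    unfolding invariant_state_def
    using state_cont_algI[OF X cont_star_algebra \<phi>] by (simp add: \<theta>_eq inv)
  then have "\<phi> a = \<omega>\<^sub>0 a"
    using ergodic \<omega>\<^sub>0 a unfolding uniquely_ergodic_def by (metis cont_alg_simps(1))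
  then show ?thesis using \<omega>\<^sub>0_eq a by simp
qed

lemma integral_T_continuous:
  assumes a: "continuous_on UNIV a"
  shows "(LINT x|\<mu>\<^sub>0. a (T g x)) = (LINT x|\<mu>\<^sub>0. a x :: complex)"
proof -
  have "\<omega>\<^sub>0 (\<theta> g a) = \<omega>\<^sub>0 a" using \<omega>\<^sub>0 a by (simp add: invariant_state_def)
  then show ?thesis using \<omega>\<^sub>0_eq[of a] \<omega>\<^sub>0_eq[of "\<lambda>x. a (T g x)"] a continuous_on_T[OF a] by (simp add: \<theta>_eq)
qed

text \<open>Invariance of the state speaks of continuous functions only; equality of the two
  measures extends it to measurable functions and almost-everywhere statements.\<close>

lemma distr_T: "distr \<mu>\<^sub>0 \<mu>\<^sub>0 (T g) = \<mu>\<^sub>0"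
proof (rule finite_measure_eqI_continuous)
  show "finite_measure (distr \<mu>\<^sub>0 \<mu>\<^sub>0 (T g))" by (rule finite_measure_distr) simp
  show "finite_measure \<mu>\<^sub>0" by (rule finite_measure_axioms)
  fix f :: "'x \<Rightarrow> real" assume f: "continuous_on UNIV f"
  have c: "continuous_on UNIV (\<lambda>x. complex_of_real (f x))" by (intro continuous_intros f)
  have [measurable]: "f \<in> borel_measurable \<mu>\<^sub>0" by (rule borel_continuous[OF f])
  have "complex_of_real (LINT x|\<mu>\<^sub>0. f (T g x)) = complex_of_real (LINT x|\<mu>\<^sub>0. f x)"
    using integral_T_continuous[OF c, of g] by simp
  then show "(LINT x|distr \<mu>\<^sub>0 \<mu>\<^sub>0 (T g). f x) = (LINT x|\<mu>\<^sub>0. f x)"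
    by (simp add: integral_distr)
qed (simp_all add: sets_\<mu>)

lemma AE_T: "AE x in \<mu>\<^sub>0. Q x \<Longrightarrow> AE x in \<mu>\<^sub>0. Q (T g x)"
  using AE_distrD[OF T_measurable, of Q g] unfolding distr_T .

lemma integral_T:
  assumes [measurable]: "f \<in> borel_measurable \<mu>\<^sub>0"
  shows "(LINT x|\<mu>\<^sub>0. f (T g x)) = (LINT x|\<mu>\<^sub>0. f x :: complex)"
  using integral_distr[OF T_measurable assms, of g] by (simp add: distr_T)

lemma integrable_T:
  assumes "integrable \<mu>\<^sub>0 f"
  shows "integrable \<mu>\<^sub>0 (\<lambda>x. f (T g x) :: complex)"
  using integrable_distr[OF T_measurable, of g f] assms by (simp add: distr_T)

lemma integrable_bounded_mult:
  assumes f: "integrable \<mu>\<^sub>0 f" and b: "b \<in> borel_measurable \<mu>\<^sub>0" "\<And>x. cmod (b x) \<le> K"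
  shows "integrable \<mu>\<^sub>0 (\<lambda>x. b x * f x :: complex)"
proof (rule Bochner_Integration.integrable_bound)
  show "integrable \<mu>\<^sub>0 (\<lambda>x. K * norm (f x))" using f by simp
  show "(\<lambda>x. b x * f x) \<in> borel_measurable \<mu>\<^sub>0" using b f by auto
  show "AE x in \<mu>\<^sub>0. norm (b x * f x) \<le> norm (K * norm (f x))"
    by (auto simp: norm_mult intro!: order_trans[OF mult_right_mono[OF b(2)] abs_ge_self])
qed

lemma integrable_continuous_mult:
  assumes f: "integrable \<mu>\<^sub>0 f" and a: "continuous_on UNIV a"
  shows "integrable \<mu>\<^sub>0 (\<lambda>x. a x * f x :: complex)"
proof -
  have "bounded (range a)"
    using compact_continuous_image[OF a X] by (rule compact_imp_bounded)
  then obtain K where "\<And>x. cmod (a x) \<le> K" by (auto simp: bounded_iff)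
  then show ?thesis using f borel_continuous[OF a] by (intro integrable_bounded_mult)
qed

lemma AE_zeroI:
  assumes "integrable \<mu>\<^sub>0 f" and "\<And>a. continuous_on UNIV a \<Longrightarrow> (LINT x|\<mu>\<^sub>0. a x * f x) = 0"
  shows "AE x in \<mu>\<^sub>0. f x = (0 :: complex)"
  using AE_zero_complex[OF X finite_measure_axioms sets_\<mu> assms] .

text \<open>An invariant set of positive measure would otherwise carry a second invariant state.\<close>

lemma invariant_set_trivial:
  assumes B[measurable]: "B \<in> sets \<mu>\<^sub>0" and inv: "\<And>g. AE x in \<mu>\<^sub>0. T g x \<in> B \<longleftrightarrow> x \<in> B"
  shows "(AE x in \<mu>\<^sub>0. x \<notin> B) \<or> (AE x in \<mu>\<^sub>0. x \<in> B)"
proof (cases "measure \<mu>\<^sub>0 B = 0")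
  case True
  then have "B \<in> null_sets \<mu>\<^sub>0" using B by (simp add: null_sets_def emeasure_eq_measure)
  then show ?thesis using AE_not_in by blast
next
  case False
  define p where "p = measure \<mu>\<^sub>0 B"
  have p: "p > 0" using False by (simp add: p_def less_le)
  \<comment> \<open>The density of the measure conditioned on \<open>B\<close>; integration against
    it is the competing invariant state.\<close>
  define k :: "'x \<Rightarrow> complex" where "k x = of_real (indicator B x / p)" for x
  have [measurable]: "k \<in> borel_measurable \<mu>\<^sub>0" unfolding k_def by measurable
  have k: "integrable \<mu>\<^sub>0 k"
    by (rule integrable_const_bound[of _ "1 / p"]) (use p in \<open>auto simp: k_def indicator_def norm_divide\<close>)
  define \<phi> where "\<phi> a = (LINT x|\<mu>\<^sub>0. a x * k x)" for a
  have "algebraic_state cont_alg \<phi>"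
    unfolding algebraic_state_def
  proof (intro conjI allI ballI)
    fix c a assume "a \<in> carrier (cont_alg :: ('x \<Rightarrow> complex) cstar_alg)"
    then show "\<phi> (c \<odot>\<^bsub>cont_alg\<^esub> a) = c * \<phi> a" by (simp add: \<phi>_def mult.assoc)
  next
    fix a b assume "a \<in> carrier (cont_alg :: ('x \<Rightarrow> complex) cstar_alg)" "b \<in> carrier (cont_alg :: ('x \<Rightarrow> complex) cstar_alg)"
    then show "\<phi> (a \<oplus>\<^bsub>cont_alg\<^esub> b) = \<phi> a + \<phi> b"
      using integrable_continuous_mult[OF k] by (simp add: \<phi>_def distrib_right)
  next
    fix a assume "a \<in> carrier (cont_alg :: ('x \<Rightarrow> complex) cstar_alg)"
    have "(star cont_alg a \<otimes>\<^bsub>cont_alg\<^esub> a) x * k x = of_real ((cmod (a x))\<^sup>2 * (indicator B x / p))" for x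
      by (simp add: k_def complex_norm_square mult.commute del: of_real_power)
    then have eq: "\<phi> (star cont_alg a \<otimes>\<^bsub>cont_alg\<^esub> a) = of_real (LINT x|\<mu>\<^sub>0. (cmod (a x))\<^sup>2 * (indicator B x / p))"
      unfolding \<phi>_def by (simp only: integral_complex_of_real)
    show "\<phi> (star cont_alg a \<otimes>\<^bsub>cont_alg\<^esub> a) \<in> \<real>" unfolding eq by simp
    show "0 \<le> Re (\<phi> (star cont_alg a \<otimes>\<^bsub>cont_alg\<^esub> a))"
      unfolding eq using p by (simp add: integral_nonneg)
  next
    have "\<phi> \<one>\<^bsub>cont_alg\<^esub> = of_real (LINT x|\<mu>\<^sub>0. indicator B x / p)"
      unfolding \<phi>_def k_def cont_alg_simps mult_1_left by (rule integral_complex_of_real)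
    then show "\<phi> \<one>\<^bsub>cont_alg\<^esub> = 1" using p by (simp add: p_def)
  qed
  moreover have "\<phi> (\<lambda>x. a (T g x)) = \<phi> a" if a: "continuous_on UNIV a" for g a
  proof -
    have [measurable]: "a \<in> borel_measurable \<mu>\<^sub>0" by (rule borel_continuous[OF a])
    have "\<phi> (\<lambda>x. a (T g x)) = (LINT x|\<mu>\<^sub>0. a (T g x) * k (T g x))"
      unfolding \<phi>_def
    proof (rule integral_cong_AE)
      show "AE x in \<mu>\<^sub>0. a (T g x) * k x = a (T g x) * k (T g x)"
        using inv[of g] by eventually_elim (simp add: k_def indicator_def)
    qed measurable
    also have "\<dots> = \<phi> a" unfolding \<phi>_def by (rule integral_T[where f = "\<lambda>x. a x * k x"]) measurable
    finally show ?thesis .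
  qed
  ultimately have \<phi>: "\<phi> a = (LINT x|\<mu>\<^sub>0. a x)" if "continuous_on UNIV a" for a
    using that by (rule invariant_state_unique)
  \<comment> \<open>Uniqueness of the state forces \<open>k\<close> to equal 1 almost everywhere,
    but \<open>k\<close> is 0 outside \<open>B\<close>.\<close>
  have "AE x in \<mu>\<^sub>0. k x - 1 = 0"
  proof (rule AE_zeroI)
    show "integrable \<mu>\<^sub>0 (\<lambda>x. k x - 1)" using k by simp
    fix a :: "'x \<Rightarrow> complex" assume a: "continuous_on UNIV a"
    show "(LINT x|\<mu>\<^sub>0. a x * (k x - 1)) = 0"
      using \<phi>[OF a] integrable_continuous_mult[OF k a] integrable_continuous[OF a]
      by (simp add: \<phi>_def right_diff_distrib)
  qed
  then have "AE x in \<mu>\<^sub>0. x \<in> B" by eventually_elim (auto simp: k_def indicator_def split: if_splits)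
  then show ?thesis by blast
qed

text \<open>The sublevel set at the mean is invariant, hence null or of full measure. In either case
  the difference of \<open>f\<close> and its mean has one sign and integral 0.\<close>

lemma invariant_function_constant:
  fixes f :: "'x \<Rightarrow> real"
  assumes f: "integrable \<mu>\<^sub>0 f" and inv: "\<And>g. AE x in \<mu>\<^sub>0. f (T g x) = f x"
  shows "AE x in \<mu>\<^sub>0. f x = (LINT x|\<mu>\<^sub>0. f x)"
proof -
  define c where "c = (LINT x|\<mu>\<^sub>0. f x)"
  have [measurable]: "f \<in> borel_measurable \<mu>\<^sub>0" using f by auto
  let ?B = "{x \<in> space \<mu>\<^sub>0. f x \<le> c}"
  have "AE x in \<mu>\<^sub>0. T g x \<in> ?B \<longleftrightarrow> x \<in> ?B" for g
    using inv[of g] by eventually_elim simp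
  then have "(AE x in \<mu>\<^sub>0. x \<notin> ?B) \<or> (AE x in \<mu>\<^sub>0. x \<in> ?B)"
    by (intro invariant_set_trivial) measurable
  then show ?thesis
  proof
    assume A: "AE x in \<mu>\<^sub>0. x \<notin> ?B"
    then have "AE x in \<mu>\<^sub>0. 0 \<le> f x - c" by eventually_elim simp
    moreover have "(LINT x|\<mu>\<^sub>0. f x - c) = 0" using f by (simp add: c_def prob_space)
    ultimately have "AE x in \<mu>\<^sub>0. f x - c = 0"
      using f by (subst (asm) integral_nonneg_eq_0_iff_AE) auto
    then show ?thesis by eventually_elim (simp add: c_def)
  next
    assume A: "AE x in \<mu>\<^sub>0. x \<in> ?B"
    then have "AE x in \<mu>\<^sub>0. 0 \<le> c - f x" by eventually_elim simp
    moreover have "(LINT x|\<mu>\<^sub>0. c - f x) = 0" using f by (simp add: c_def prob_space)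
    ultimately have "AE x in \<mu>\<^sub>0. c - f x = 0"
      using f by (subst (asm) integral_nonneg_eq_0_iff_AE) auto
    then show ?thesis by eventually_elim (simp add: c_def)
  qed
qed

text \<open>Commutation of \<open>\<alpha>\<close> with \<open>\<theta> g\<close>, carried from
  functions to points because continuous functions separate points.\<close>

lemma orbit_T: "orbit n (T g x) = T g (orbit n x)"
proof -
  have S: "gelfand_homeo \<alpha> (T g x) = T g (gelfand_homeo \<alpha> x)" for x
  proof (rule continuous_functions_separate)
    fix a :: "'x \<Rightarrow> complex" assume a: "continuous_on UNIV a"
    have aS: "\<alpha> a = (\<lambda>x. a (gelfand_homeo \<alpha> x))"
      by (rule ext) (rule gelfand_homeo_exists(2)[OF X \<alpha> a])
    have "continuous_on UNIV (\<alpha> a)" using \<alpha> a bij_betwE by (fastforce simp: star_automorphism_def)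
    then have "\<theta> g (\<alpha> a) x = a (gelfand_homeo \<alpha> (T g x))" by (simp add: \<theta>_eq aS)
    moreover have "\<alpha> (\<theta> g a) x = a (T g (gelfand_homeo \<alpha> x))"
      using gelfand_homeo_exists(2)[OF X \<alpha> continuous_on_T[OF a, of g], of x] by (simp add: \<theta>_eq[OF a])
    ultimately show "a (gelfand_homeo \<alpha> (T g x)) = a (T g (gelfand_homeo \<alpha> x))"
      using commute[of a g] a by simp
  qed
  have S': "inv_into UNIV (gelfand_homeo \<alpha>) (T g x) = T g (inv_into UNIV (gelfand_homeo \<alpha>) x)" for x
    using S[of "inv_into UNIV (gelfand_homeo \<alpha>) x"] by (metis homeo_inv)
  show ?thesis
  proof (induction n rule: int_induct[where k = 0])
    case (step1 i)
    then show ?case by (simp add: orbit_succ S)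
  next
    case (step2 i)
    then show ?case by (simp add: orbit_pred S')
  qed simp
qed

end


section \<open>The skew product on the algebraic crossed product\<close>

context skew_system
begin

abbreviation "U n g \<equiv> cocycle_power \<alpha> u n g"

lemma u_continuous: "continuous_on UNIV (u g)"
proof -
  have u: "continuous_on UNIV (\<lambda>(g, x). u g x)" using cocycle by (simp add: continuous_cocycle_def)
  have "continuous_on UNIV (\<lambda>x. (\<lambda>(g, x). u g x) (g, x))"
    by (rule continuous_on_compose2[OF u]) (auto intro!: continuous_intros)
  then show ?thesis by simp
qed

lemma u_modulus: "cmod (u g x) = 1"
  using cocycle by (simp add: continuous_cocycle_def)

lemma u_cnj [simp]: "u g x * cnj (u g x) = 1"
  by (simp add: complex_norm_square[symmetric] u_modulus)

lemma U_eq: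
  "U n g x = (if 0 \<le> n then \<Prod>k\<in>{0..<n}. u g (orbit k x) else \<Prod>k\<in>{n..<0}. cnj (u g (orbit k x)))"
  unfolding cocycle_power_def aut_power_eq[OF u_continuous] aut_power_eq[OF continuous_on_cnj[OF u_continuous]] ..

lemma U_0 [simp]: "U 0 g x = 1"
  by (simp add: U_eq)

lemma U_succ: "U (n + 1) g x = U n g x * u g (orbit n x)"
proof (cases "0 \<le> n")
  case True
  then have "{0..<n + 1} = insert n {0..<n}" by auto
  then show ?thesis using True by (simp add: U_eq mult.commute)
next
  case False
  then have *: "{n..<0} = insert n {n + 1..<0}" by auto
  have "(\<Prod>k\<in>{n..<0}. cnj (u g (orbit k x))) * u g (orbit n x) = (\<Prod>k\<in>{n + 1..<0}. cnj (u g (orbit k x)))"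
    unfolding * using u_cnj[of g "orbit n x"] by (simp add: mult_ac)
  \<comment> \<open>At n = -1 the successor falls into the other branch of \<open>U_eq\<close>,
    where the product is empty as well.\<close>
  then show ?thesis using False by (cases "n = - 1") (simp_all add: U_eq)
qed

text \<open>The cocycle identity along the integers, which expresses that the skew product respects
  V^m V^n = V^(m + n).\<close>

lemma U_add: "U (m + n) g x = U m g x * U n g (orbit m x)"
proof (induction n rule: int_induct[where k = 0])
  case (step1 i)
  have "U (m + (i + 1)) g x = U (m + i) g x * u g (orbit (m + i) x)" using U_succ[of "m + i" g x] by (simp add: add.assoc)
  then show ?case using step1 U_succ[of i g "orbit m x"] orbit_add[of i m x] by (simp add: add.commute)
next
  case (step2 i)
  have ne: "u g y \<noteq> 0" for y using u_modulus[of g y] by auto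
  have "U (m + i) g x = U (m + (i - 1)) g x * u g (orbit (m + (i - 1)) x)"
    using U_succ[of "m + (i - 1)" g x] by (simp add: add.assoc)
  moreover have "U i g (orbit m x) = U (i - 1) g (orbit m x) * u g (orbit (m + (i - 1)) x)"
    using U_succ[of "i - 1" g "orbit m x"] orbit_add[of "i - 1" m x] by (simp add: add.commute)
  ultimately have "U (m + (i - 1)) g x * u g (orbit (m + (i - 1)) x) =
      (U m g x * U (i - 1) g (orbit m x)) * u g (orbit (m + (i - 1)) x)"
    using step2 by (simp only: mult.assoc)
  then show ?case using ne[of "orbit (m + (i - 1)) x"] by simp
qed simp

lemma U_modulus: "cmod (U n g x) = 1"
  by (simp add: U_eq prod_norm[symmetric] u_modulus)

text \<open>Compatibility with adjoints: the image of V^(- n) has to be the adjoint of the image of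
  V^n.\<close>

lemma U_uminus: "U (- n) g (orbit n x) = cnj (U n g x)"
proof -
  have "U n g x * U (- n) g (orbit n x) = 1" using U_add[of n "- n" g x] by simp
  then have "cnj (U n g x) * U n g x * U (- n) g (orbit n x) = cnj (U n g x)" by (simp only: mult.assoc mult_1_right)
  moreover have "cnj (U n g x) * U n g x = 1"
    using complex_norm_square[of "U n g x"] by (simp add: U_modulus mult.commute)
  ultimately show ?thesis by simp
qed

lemma U_continuous: "continuous_on UNIV (U n g)"
proof -
  have "continuous_on UNIV (\<lambda>x. u g (orbit k x))" for k by (rule continuous_on_orbit[OF u_continuous])
  then show ?thesis unfolding U_eq[abs_def] by (cases "0 \<le> n") (auto intro!: continuous_intros)
qed

text \<open>The skew product before completion, taken termwise from the sequence inside
  \<open>skew_product\<close>.\<close>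

definition \<tau> :: "'g \<Rightarrow> (int \<Rightarrow> 'x \<Rightarrow> complex) \<Rightarrow> int \<Rightarrow> 'x \<Rightarrow> complex" where
  "\<tau> g f = (\<lambda>n x. \<theta> g (f n) x * U n g x)"

lemma \<tau>_eq:
  assumes f: "f \<in> carrier P"
  shows "\<tau> g f = (\<lambda>n x. f n (T g x) * U n g x)"
  unfolding \<tau>_def \<theta>_eq[OF P_continuous[OF f]] ..

lemma supp_\<tau>: "f \<in> carrier P \<Longrightarrow> supp (\<tau> g f) \<subseteq> supp f"
  by (auto simp: \<tau>_eq supp_def fun_eq_iff)

lemma \<tau>_closed:
  assumes f: "f \<in> carrier P"
  shows "\<tau> g f \<in> carrier P"
proof -
  have "finite (supp (\<tau> g f))" using supp_\<tau>[OF f] P_finite[OF f] by (rule finite_subset)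
  moreover have "continuous_on UNIV (\<tau> g f n)" for n
    unfolding \<tau>_eq[OF f] by (intro continuous_on_mult continuous_on_T[OF P_continuous[OF f]] U_continuous)
  ultimately show ?thesis by (simp add: P_carrier)
qed

lemma \<tau>_endomorphism: "star_endomorphism P (\<tau> g)"
  unfolding star_endomorphism_def
proof (intro conjI allI ballI)
  fix f assume f: "f \<in> carrier P"
  show \<tau>f: "\<tau> g f \<in> carrier P" by (rule \<tau>_closed[OF f])
  show "\<tau> g (star P f) = star P (\<tau> g f)"
  proof (intro ext)
    fix n x
    show "\<tau> g (star P f) n x = star P (\<tau> g f) n x"
      unfolding \<tau>_eq[OF P_closed(4)[OF f f]] star_eq[OF \<tau>f] unfolding \<tau>_eq[OF f] star_eq[OF f]
      using U_uminus[of n g x] by (simp add: orbit_T)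
  qed
  fix c
  show "\<tau> g (c \<odot>\<^bsub>P\<^esub> f) = c \<odot>\<^bsub>P\<^esub> \<tau> g f"
    unfolding \<tau>_eq[OF P_closed(2)[OF f f]] \<tau>_eq[OF f] by (simp add: mult.assoc)
next
  fix f h assume f: "f \<in> carrier P" and h: "h \<in> carrier P"
  show "\<tau> g (f \<oplus>\<^bsub>P\<^esub> h) = \<tau> g f \<oplus>\<^bsub>P\<^esub> \<tau> g h"
    unfolding \<tau>_eq[OF P_closed(1)[OF f h]] \<tau>_eq[OF f] \<tau>_eq[OF h] by (simp add: distrib_right)
  show "\<tau> g (f \<otimes>\<^bsub>P\<^esub> h) = \<tau> g f \<otimes>\<^bsub>P\<^esub> \<tau> g h"
  proof (intro ext)
    fix n x
    have cocycle: "U n g x = U m g x * U (n - m) g (orbit m x)" for m using U_add[of m "n - m" g x] by simp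
    have "\<tau> g (f \<otimes>\<^bsub>P\<^esub> h) n x = (\<Sum>m\<in>supp f. f m (T g x) * h (n - m) (orbit m (T g x)) * U n g x)"
      unfolding \<tau>_eq[OF P_closed(3)[OF f h]] unfolding mult_eq[OF f h P_finite[OF f] order_refl]
      by (rule sum_distrib_right)
    also have "\<dots> = (\<Sum>m\<in>supp f. \<tau> g f m x * \<tau> g h (n - m) (orbit m x))"
    proof (rule sum.cong[OF refl])
      fix m
      show "f m (T g x) * h (n - m) (orbit m (T g x)) * U n g x = \<tau> g f m x * \<tau> g h (n - m) (orbit m x)"
        unfolding \<tau>_eq[OF f] \<tau>_eq[OF h] cocycle[of m] orbit_T by (simp only: mult_ac)
    qed
    also have "\<dots> = (\<tau> g f \<otimes>\<^bsub>P\<^esub> \<tau> g h) n x"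
      unfolding mult_eq[OF \<tau>_closed[OF f] \<tau>_closed[OF h] P_finite[OF f] supp_\<tau>[OF f]] ..
    finally show "\<tau> g (f \<otimes>\<^bsub>P\<^esub> h) n x = (\<tau> g f \<otimes>\<^bsub>P\<^esub> \<tau> g h) n x" .
  qed
qed

lemma \<tau>_single:
  assumes a: "continuous_on UNIV a"
  shows "\<tau> g (single n a) = single n (\<lambda>x. a (T g x) * U n g x)"
  unfolding \<tau>_eq[OF single_closed[OF a]] by (auto simp: single_def fun_eq_iff)

text \<open>The candidate \<open>\<omega>\<^sub>0 \<circ> E\<close> on the dense algebra, with
  \<open>\<omega>\<^sub>0\<close> replaced by its integral.\<close>

definition \<psi>\<^sub>0 :: "(int \<Rightarrow> 'x \<Rightarrow> complex) \<Rightarrow> complex" where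
  "\<psi>\<^sub>0 f = (LINT x|\<mu>\<^sub>0. f 0 x)"

lemma P_star_mult_0:
  assumes f: "f \<in> carrier P"
  shows "(star P f \<otimes>\<^bsub>P\<^esub> f) 0 x = of_real (\<Sum>i\<in>supp f. (cmod (f i (orbit (- i) x)))\<^sup>2)"
  unfolding P_star_mult[OF f f P_finite[OF f] order_refl]
  unfolding of_real_sum complex_norm_square by (intro sum.cong refl) (simp only: add_0 mult.commute)

text \<open>Consequently |f 0 x| is at most the universal norm of \<open>f\<close> for every x, so f
  -> f 0 is contractive for the supremum norm.\<close>

lemma evaluation_state: "algebraic_state P (\<lambda>f. f 0 x)"
  unfolding algebraic_state_def
proof (intro conjI allI ballI)
  fix f assume f: "f \<in> carrier P"
  show "(star P f \<otimes>\<^bsub>P\<^esub> f) 0 x \<in> \<real>" unfolding P_star_mult_0[OF f] by simp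
  show "0 \<le> Re ((star P f \<otimes>\<^bsub>P\<^esub> f) 0 x)" unfolding P_star_mult_0[OF f] by (simp add: sum_nonneg)
qed simp_all

lemma \<psi>\<^sub>0_state: "algebraic_state P \<psi>\<^sub>0"
  unfolding algebraic_state_def
proof (intro conjI allI ballI)
  fix f assume f: "f \<in> carrier P"
  have eq: "\<psi>\<^sub>0 (star P f \<otimes>\<^bsub>P\<^esub> f) = of_real (LINT x|\<mu>\<^sub>0. (\<Sum>i\<in>supp f. (cmod (f i (orbit (- i) x)))\<^sup>2))"
    unfolding \<psi>\<^sub>0_def P_star_mult_0[OF f] by (rule integral_complex_of_real)
  show "\<psi>\<^sub>0 (star P f \<otimes>\<^bsub>P\<^esub> f) \<in> \<real>" unfolding eq by simp
  show "0 \<le> Re (\<psi>\<^sub>0 (star P f \<otimes>\<^bsub>P\<^esub> f))" unfolding eq by (simp add: sum_nonneg integral_nonneg)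
next
  fix f g assume f: "f \<in> carrier P" and g: "g \<in> carrier P"
  show "\<psi>\<^sub>0 (f \<oplus>\<^bsub>P\<^esub> g) = \<psi>\<^sub>0 f + \<psi>\<^sub>0 g"
    unfolding \<psi>\<^sub>0_def P_simps
    by (rule Bochner_Integration.integral_add) (rule integrable_continuous[OF P_continuous[OF f]] integrable_continuous[OF P_continuous[OF g]])+
qed (simp_all add: \<psi>\<^sub>0_def)

lemma \<psi>\<^sub>0_invariant:
  assumes f: "f \<in> carrier P"
  shows "\<psi>\<^sub>0 (\<tau> g f) = \<psi>\<^sub>0 f"
  using integral_T_continuous[OF P_continuous[OF f], of 0 g] by (simp add: \<psi>\<^sub>0_def \<tau>_eq[OF f])

text \<open>The definition of the expectation is a pointwise limit. Evaluation states bound the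
  error uniformly in x, so the limit is continuous and \<open>\<omega>\<^sub>0\<close> of it is an
  integral; dominated convergence then applies.\<close>

lemma expectation_limit:
  assumes s: "s \<in> cauchy_seqs P (universal_norm P)"
  shows "(\<lambda>k. \<psi>\<^sub>0 (s k)) \<longlonglongrightarrow> (\<omega>\<^sub>0 \<circ> canonical_expectation) (seq_class P s)"
proof -
  interpret isometry_star_alg P by (rule P_isometry_star_alg)
  let ?E = "canonical_expectation (seq_class P s)"
  have c: "s k \<in> carrier P" for k by (rule cauchy_carrier[OF s])
  have lim: "(\<lambda>k. s k 0 x) \<longlonglongrightarrow> ?E x" for x
    unfolding canonical_expectation_def
    by (rule lipschitz_seq_class[OF s, of "\<lambda>f. f 0 x"]) (rule algebraic_state_lipschitz[OF evaluation_state])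
  have "uniform_limit UNIV (\<lambda>k x. s k 0 x) ?E sequentially"
  proof (rule uniform_limitI)
    fix e :: real assume e: "0 < e"
    then have "0 < e / 2" by simp
    then obtain M where M: "\<And>j k. j \<ge> M \<Longrightarrow> k \<ge> M \<Longrightarrow> N (s j \<ominus>\<^bsub>P\<^esub> s k) < e / 2"
      using s unfolding cauchy_seqs_def by blast
    have "dist (s k 0 x) (?E x) < e" if k: "k \<ge> M" for k x
    proof -
      have "(\<lambda>j. norm (s k 0 x - s j 0 x)) \<longlonglongrightarrow> norm (s k 0 x - ?E x)" by (intro tendsto_intros lim)
      moreover have "norm (s k 0 x - s j 0 x) \<le> e / 2" if "j \<ge> M" for j
        using algebraic_state_lipschitz[OF evaluation_state c c, of k x j] M[OF k that] by linarith
      ultimately have "norm (s k 0 x - ?E x) \<le> e / 2"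
        by (intro LIMSEQ_le_const2[of "\<lambda>j. norm (s k 0 x - s j 0 x)"]) auto
      then show ?thesis using e by (simp add: dist_norm)
    qed
    then show "\<forall>\<^sub>F k in sequentially. \<forall>x\<in>UNIV. dist (s k 0 x) (?E x) < e"
      by (auto simp: eventually_sequentially)
  qed
  then have E: "continuous_on UNIV ?E"
    by (rule uniform_limit_theorem[rotated]) (simp_all add: P_continuous[OF c])
  obtain K where K: "\<And>k. N (s k) \<le> K" using N_bounded[OF s] by blast
  have "(\<lambda>k. LINT x|\<mu>\<^sub>0. s k 0 x) \<longlonglongrightarrow> (LINT x|\<mu>\<^sub>0. ?E x)"
  proof (rule integral_dominated_convergence[where w = "\<lambda>_. K"])
    show "?E \<in> borel_measurable \<mu>\<^sub>0" by (rule borel_continuous[OF E])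
    show "(\<lambda>x. s k 0 x) \<in> borel_measurable \<mu>\<^sub>0" for k by (rule borel_continuous[OF P_continuous[OF c]])
    show "AE x in \<mu>\<^sub>0. norm (s k 0 x) \<le> K" for k
      using order_trans[OF algebraic_state_bounded[OF evaluation_state c] K] by simp
  qed (simp_all add: lim)
  then show ?thesis using \<omega>\<^sub>0_eq E by (simp add: \<psi>\<^sub>0_def)
qed

lemma state_ext_single:
  assumes \<phi>: "algebraic_state P \<phi>" and \<psi>: "algebraic_state P \<psi>"
    and eq: "\<And>n a. continuous_on UNIV a \<Longrightarrow> \<phi> (single n a) = \<psi> (single n a)"
    and f: "f \<in> carrier P"
  shows "\<phi> f = \<psi> f"
proof -
  have "f \<in> carrier P \<Longrightarrow> supp f \<subseteq> F \<Longrightarrow> \<phi> f = \<psi> f" if "finite F" for F f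
    using that
  proof (induction F arbitrary: f rule: finite_induct)
    case empty
    then have "f = single 0 (\<lambda>_. 0)" by (auto simp: supp_def single_def fun_eq_iff)
    then show ?case using eq[of "\<lambda>_. 0" 0] by simp
  next
    case (insert n F)
    define g where "g = f(n := \<lambda>_. 0)"
    have s: "supp g \<subseteq> F" using insert.prems(2) by (auto simp: supp_def g_def)
    have "continuous_on UNIV (g k)" for k
      using P_continuous[OF insert.prems(1)] by (cases "k = n") (simp_all add: g_def)
    then have g: "g \<in> carrier P" using finite_subset[OF s insert.hyps(1)] by (simp add: P_carrier)
    have fn: "continuous_on UNIV (f n)" by (rule P_continuous[OF insert.prems(1)])
    have fg: "f = g \<oplus>\<^bsub>P\<^esub> single n (f n)" by (auto simp: g_def single_def fun_eq_iff)
    have "\<xi> (g \<oplus>\<^bsub>P\<^esub> single n (f n)) = \<xi> g + \<xi> (single n (f n))" if "algebraic_state P \<xi>" for \<xi>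
      using that g single_closed[OF fn] unfolding algebraic_state_def by blast
    from this[OF \<phi>] this[OF \<psi>] have "\<phi> (g \<oplus>\<^bsub>P\<^esub> single n (f n)) = \<psi> (g \<oplus>\<^bsub>P\<^esub> single n (f n))"
      unfolding insert.IH[OF g s] eq[OF fn] by (rule trans[OF _ sym])
    then show ?case unfolding fg[symmetric] .
  qed
  then show ?thesis using f P_finite[OF f] by blast
qed

lemma single_star_mult:
  assumes a: "continuous_on UNIV a" and b: "continuous_on UNIV b"
  shows "star P (single 0 a) \<otimes>\<^bsub>P\<^esub> single n b = single n (\<lambda>x. cnj (a x) * b x)"
proof (intro ext)
  fix k x
  show "(star P (single 0 a) \<otimes>\<^bsub>P\<^esub> single n b) k x = single n (\<lambda>x. cnj (a x) * b x) k x"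
    using P_star_mult[OF single_closed[OF a] single_closed[OF b] _ supp_single, of 0 n k x]
    by (simp add: single_def)
qed

lemma single_unit_isometry: "star P (single n (\<lambda>_. 1)) \<otimes>\<^bsub>P\<^esub> single n (\<lambda>_. 1) = \<one>\<^bsub>P\<^esub>"
proof (intro ext)
  fix k x
  have c: "continuous_on UNIV (\<lambda>_ :: 'x. 1 :: complex)" by simp
  show "(star P (single n (\<lambda>_. 1)) \<otimes>\<^bsub>P\<^esub> single n (\<lambda>_. 1)) k x = \<one>\<^bsub>P\<^esub> k x"
    using P_star_mult[OF single_closed[OF c] single_closed[OF c] _ supp_single, of n n k x]
    by (simp add: single_def)
qed

text \<open>Degree 0 is a copy of C(X) on which the cocycle factor is 1, so \<open>\<tau> g\<close>
  acts there as \<open>\<theta> g\<close> and unique ergodicity of the base decides.\<close>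

lemma restricted_state_eq:
  assumes \<psi>: "algebraic_state P \<psi>" and inv: "\<And>g f. f \<in> carrier P \<Longrightarrow> \<psi> (\<tau> g f) = \<psi> f"
    and a: "continuous_on UNIV a"
  shows "\<psi> (single 0 a) = (LINT x|\<mu>\<^sub>0. a x)"
proof (rule invariant_state_unique[OF _ _ a, of "\<lambda>a. \<psi> (single 0 a)"])
  interpret star_alg_state P \<psi> using P_star_algebra \<psi> by unfold_locales
  show "algebraic_state cont_alg (\<lambda>a. \<psi> (single 0 a))"
    unfolding algebraic_state_def
  proof (intro conjI allI ballI)
    fix a assume "a \<in> carrier (cont_alg :: ('x \<Rightarrow> complex) cstar_alg)"
    then have a: "continuous_on UNIV a" by simp
    show "\<psi> (single 0 (star cont_alg a \<otimes>\<^bsub>cont_alg\<^esub> a)) \<in> \<real>"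
      using \<psi>_real[OF single_closed[OF a], of 0] by (simp add: single_star_mult[OF a a])
    show "0 \<le> Re (\<psi> (single 0 (star cont_alg a \<otimes>\<^bsub>cont_alg\<^esub> a)))"
      using \<psi>_nonneg[OF single_closed[OF a], of 0] by (simp add: single_star_mult[OF a a])
    fix c
    have "single 0 (c \<odot>\<^bsub>cont_alg\<^esub> a) = c \<odot>\<^bsub>P\<^esub> single 0 a" by (auto simp: single_def fun_eq_iff)
    then show "\<psi> (single 0 (c \<odot>\<^bsub>cont_alg\<^esub> a)) = c * \<psi> (single 0 a)"
      using \<psi>_smult[OF single_closed[OF a]] by (simp only:)
  next
    fix a b assume "a \<in> carrier (cont_alg :: ('x \<Rightarrow> complex) cstar_alg)" "b \<in> carrier (cont_alg :: ('x \<Rightarrow> complex) cstar_alg)"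
    then have a: "continuous_on UNIV a" and b: "continuous_on UNIV b" by simp_all
    have "single 0 (a \<oplus>\<^bsub>cont_alg\<^esub> b) = single 0 a \<oplus>\<^bsub>P\<^esub> single 0 b" by (auto simp: single_def fun_eq_iff)
    then show "\<psi> (single 0 (a \<oplus>\<^bsub>cont_alg\<^esub> b)) = \<psi> (single 0 a) + \<psi> (single 0 b)"
      using \<psi>_add[OF single_closed[OF a] single_closed[OF b]] by (simp only:)
  next
    show "\<psi> (single 0 \<one>\<^bsub>cont_alg\<^esub>) = 1" using \<psi>_one unfolding one_eq_single by simp
  qed
  fix g and a :: "'x \<Rightarrow> complex" assume a: "continuous_on UNIV a"
  show "\<psi> (single 0 (\<lambda>x. a (T g x))) = \<psi> (single 0 a)"
    using inv[OF single_closed[OF a], of g 0] by (simp add: \<tau>_single[OF a])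
qed

end


section \<open>Invariant states and coboundaries\<close>

context skew_system
begin

lemma cnj_measurable [measurable (raw)]:
  "w \<in> borel_measurable M \<Longrightarrow> (\<lambda>x. cnj (w x)) \<in> borel_measurable M"
  by (rule measurable_compose[OF _ borel_measurable_continuous_onI[OF continuous_on_cnj[OF continuous_on_id]]])

lemma Fourier_coefficient_density:
  assumes \<psi>: "algebraic_state P \<psi>" and inv: "\<And>g f. f \<in> carrier P \<Longrightarrow> \<psi> (\<tau> g f) = \<psi> f"
  shows "\<exists>h. integrable \<mu>\<^sub>0 h \<and> (\<forall>a. continuous_on UNIV a \<longrightarrow> \<psi> (single n a) = (LINT x|\<mu>\<^sub>0. a x * h x))"
proof (rule square_bounded_functional_density[OF X prob sets_\<mu>])
  interpret star_alg_state P \<psi> using P_star_algebra \<psi> by unfold_locales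
  fix a :: "'x \<Rightarrow> complex" assume a: "continuous_on UNIV a"
  have ca: "continuous_on UNIV (\<lambda>x. cnj (a x))" by (intro continuous_intros a)
  have one: "continuous_on UNIV (\<lambda>_ :: 'x. 1 :: complex)" by simp
  have sq: "continuous_on UNIV (\<lambda>x. a x * cnj (a x))" by (intro continuous_intros a)
  \<comment> \<open>In this factorisation V^n has length 1 and the other factor lies in degree 0,
    where the state is already the integral.\<close>
  have "single n a = star P (single 0 (\<lambda>x. cnj (a x))) \<otimes>\<^bsub>P\<^esub> single n (\<lambda>_. 1)"
    unfolding single_star_mult[OF ca one] by simp
  then have "cmod (\<psi> (single n a)) \<le> q (single 0 (\<lambda>x. cnj (a x))) * q (single n (\<lambda>_. 1))"
    using cauchy_schwarz[OF single_closed[OF ca] single_closed[OF one], of 0 n] by (simp only:)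
  moreover have "q (single n (\<lambda>_. 1)) = 1"
    unfolding state_seminorm_def single_unit_isometry \<psi>_one by simp
  ultimately have "(cmod (\<psi> (single n a)))\<^sup>2 \<le> (q (single 0 (\<lambda>x. cnj (a x))))\<^sup>2"
    by (intro power_mono) simp_all
  also have "\<dots> = Re (LINT x|\<mu>\<^sub>0. a x * cnj (a x))"
    unfolding q_square[OF single_closed[OF ca]] single_star_mult[OF ca ca] complex_cnj_cnj
    using restricted_state_eq[OF \<psi> inv sq] by simp
  also have "(LINT x|\<mu>\<^sub>0. a x * cnj (a x)) = of_real (LINT x|\<mu>\<^sub>0. (cmod (a x))\<^sup>2)"
    unfolding complex_norm_square[symmetric] by (rule integral_complex_of_real)
  finally show "(cmod (\<psi> (single n a)))\<^sup>2 \<le> (LINT x|\<mu>\<^sub>0. (cmod (a x))\<^sup>2)" by simp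
  fix c
  have "single n (\<lambda>x. c * a x) = c \<odot>\<^bsub>P\<^esub> single n a" by (auto simp: single_def fun_eq_iff)
  then show "\<psi> (single n (\<lambda>x. c * a x)) = c * \<psi> (single n a)"
    using \<psi>_smult[OF single_closed[OF a], of c n] by (simp only:)
next
  interpret star_alg_state P \<psi> using P_star_algebra \<psi> by unfold_locales
  fix a b :: "'x \<Rightarrow> complex" assume a: "continuous_on UNIV a" and b: "continuous_on UNIV b"
  have "single n (\<lambda>x. a x + b x) = single n a \<oplus>\<^bsub>P\<^esub> single n b" by (auto simp: single_def fun_eq_iff)
  then show "\<psi> (single n (\<lambda>x. a x + b x)) = \<psi> (single n a) + \<psi> (single n b)"
    using \<psi>_add[OF single_closed[OF a] single_closed[OF b], of n n] by (simp only:)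
qed

text \<open>Every test function may thus be taken of the form \<open>a \<circ> T g\<close>, the
  shape in which invariance can be applied.\<close>

lemma continuous_T_inverse:
  assumes "continuous_on UNIV b"
  shows "\<exists>a. continuous_on UNIV a \<and> b = (\<lambda>x. a (T g x))"
proof -
  obtain T' where T': "homeomorphism UNIV UNIV (T g) T'" using gelfand_homeo_exists(1)[OF X \<theta>_aut, of g] by blast
  have "continuous_on UNIV (\<lambda>x. b (T' x))"
    by (rule continuous_on_compose2[OF assms]) (use T' in \<open>auto simp: homeomorphism_def\<close>)
  moreover have "b = (\<lambda>x. b (T' (T g x)))" using T' by (auto simp: homeomorphism_def)
  ultimately show ?thesis by (intro exI[of _ "\<lambda>x. b (T' x)"]) simp
qed

text \<open>Both sides are tested against \<open>a \<circ> T g\<close>: invariance of the state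
  reduces the first integral to that of \<open>a h\<close>, invariance of the measure the
  second.\<close>

lemma invariant_density_equivariant:
  assumes \<psi>: "algebraic_state P \<psi>" and inv: "\<And>g f. f \<in> carrier P \<Longrightarrow> \<psi> (\<tau> g f) = \<psi> f"
    and h: "integrable \<mu>\<^sub>0 h" and rep: "\<And>a. continuous_on UNIV a \<Longrightarrow> \<psi> (single n a) = (LINT x|\<mu>\<^sub>0. a x * h x)"
  shows "AE x in \<mu>\<^sub>0. U n g x * h x = h (T g x)"
proof -
  have "AE x in \<mu>\<^sub>0. U n g x * h x - h (T g x) = 0"
  proof (rule AE_zeroI)
    have Uh: "integrable \<mu>\<^sub>0 (\<lambda>x. U n g x * h x)" by (rule integrable_continuous_mult[OF h U_continuous])
    have hT: "integrable \<mu>\<^sub>0 (\<lambda>x. h (T g x))" by (rule integrable_T[OF h])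
    show "integrable \<mu>\<^sub>0 (\<lambda>x. U n g x * h x - h (T g x))" using Uh hT by (rule Bochner_Integration.integrable_diff)
    fix b :: "'x \<Rightarrow> complex" assume b: "continuous_on UNIV b"
    obtain a where a: "continuous_on UNIV a" and ab: "b = (\<lambda>x. a (T g x))" using continuous_T_inverse[OF b] by blast
    have ah: "(\<lambda>x. a x * h x) \<in> borel_measurable \<mu>\<^sub>0" using integrable_continuous_mult[OF h a] by auto
    have "(LINT x|\<mu>\<^sub>0. b x * (U n g x * h x)) = \<psi> (single n (\<lambda>x. a (T g x) * U n g x))"
      using rep[of "\<lambda>x. a (T g x) * U n g x"] continuous_on_mult[OF continuous_on_T[OF a, of g] U_continuous[of n g]]
      by (simp add: ab mult.assoc)
    also have "\<dots> = \<psi> (single n a)" using inv[OF single_closed[OF a], of g n] by (simp only: \<tau>_single[OF a])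
    also have "\<dots> = (LINT x|\<mu>\<^sub>0. b x * h (T g x))"
      unfolding rep[OF a] ab using integral_T[OF ah, of g] by simp
    finally show "(LINT x|\<mu>\<^sub>0. b x * (U n g x * h x - h (T g x))) = 0"
      using integrable_continuous_mult[OF Uh b] integrable_continuous_mult[OF hT b] by (simp add: right_diff_distrib)
  qed
  then show ?thesis by eventually_elim simp
qed

lemma invariant_state_eq_\<psi>\<^sub>0:
  assumes \<psi>: "algebraic_state P \<psi>" and inv: "\<And>g f. f \<in> carrier P \<Longrightarrow> \<psi> (\<tau> g f) = \<psi> f"
    and nc: "\<And>n. n \<noteq> 0 \<Longrightarrow> \<not> measurable_coboundary \<theta> \<mu>\<^sub>0 (cocycle_power \<alpha> u n)"
    and f: "f \<in> carrier P"
  shows "\<psi> f = \<psi>\<^sub>0 f"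
proof (rule state_ext_single[OF \<psi> \<psi>\<^sub>0_state _ f])
  fix n and a :: "'x \<Rightarrow> complex" assume a: "continuous_on UNIV a"
  show "\<psi> (single n a) = \<psi>\<^sub>0 (single n a)"
  proof (cases "n = 0")
    case True
    then show ?thesis using restricted_state_eq[OF \<psi> inv a] by (simp add: \<psi>\<^sub>0_def single_def)
  next
    case False
    have "\<exists>h. integrable \<mu>\<^sub>0 h \<and> (\<forall>a. continuous_on UNIV a \<longrightarrow> \<psi> (single n a) = (LINT x|\<mu>\<^sub>0. a x * h x))"
      by (rule Fourier_coefficient_density[OF \<psi>]) (rule inv)
    then obtain h where h: "integrable \<mu>\<^sub>0 h"
      and rep: "\<And>a. continuous_on UNIV a \<Longrightarrow> \<psi> (single n a) = (LINT x|\<mu>\<^sub>0. a x * h x)"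
      by (elim exE conjE) simp
    have [measurable]: "h \<in> borel_measurable \<mu>\<^sub>0" using h by auto
    have equi: "AE x in \<mu>\<^sub>0. U n g x * h x = h (T g x)" for g
      by (rule invariant_density_equivariant[OF \<psi> _ h]) (fact inv rep)+
    have "AE x in \<mu>\<^sub>0. cmod (h (T g x)) = cmod (h x)" for g
      using equi[of g]
    proof eventually_elim
      case (elim x)
      then have "cmod (h (T g x)) = cmod (U n g x) * cmod (h x)" by (metis norm_mult)
      then show ?case by (simp add: U_modulus)
    qed
    then obtain c where c: "AE x in \<mu>\<^sub>0. cmod (h x) = c"
      using invariant_function_constant[of "\<lambda>x. cmod (h x)"] h by auto
    have "c = 0"
    proof (rule ccontr)
      assume "c \<noteq> 0"
      \<comment> \<open>The value 1 on the exceptional null set makes \<open>w\<close> circle-valued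
        everywhere, as \<open>measurable_coboundary\<close> demands.\<close>
      define w where "w x = (if cmod (h x) = c then cnj (h x) / of_real c else 1)" for x
      have "w \<in> borel_measurable \<mu>\<^sub>0" unfolding w_def by measurable
      moreover have "cmod (w x) = 1" for x using \<open>c \<noteq> 0\<close> by (auto simp: w_def norm_divide)
      \<comment> \<open>The modulus has to be \<open>c\<close> at \<open>T g x\<close> too, hence
        the use of \<open>AE_T\<close>. Then \<open>h (T g x) * cnj (h x)\<close> is the cocycle
        value times c^2.\<close>
      moreover have "AE x in \<mu>\<^sub>0. U n g x = cnj (w (T g x)) * w x" for g
        using equi[of g] c AE_T[OF c, of g]
      proof eventually_elim
        case (elim x)
        have "h x * cnj (h x) = of_real c * of_real c"
          using complex_norm_square[of "h x"] elim(2) by (simp add: power2_eq_square)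
        then have "U n g x * h x * cnj (h x) = U n g x * (of_real c * of_real c)" by (simp only: mult.assoc)
        then have "h (T g x) * cnj (h x) = U n g x * (of_real c * of_real c)" using elim(1) by simp
        then show ?case using elim(2,3) \<open>c \<noteq> 0\<close> by (simp add: w_def field_simps)
      qed
      ultimately have "measurable_coboundary \<theta> \<mu>\<^sub>0 (cocycle_power \<alpha> u n)"
        unfolding measurable_coboundary_def by blast
      then show False using nc[OF False] by blast
    qed
    then have "AE x in \<mu>\<^sub>0. cmod (h x) = 0" using c by simp
    then have "AE x in \<mu>\<^sub>0. a x * h x = 0" by eventually_elim simp
    then have "(LINT x|\<mu>\<^sub>0. a x * h x) = 0" by (rule integral_eq_zero_AE)
    then show ?thesis using False rep[OF a] by (simp add: \<psi>\<^sub>0_def single_def)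
  qed
qed

text \<open>The matrix \<open>(f (i - j) (orbit (- i) x))\<^bsub>i j\<^esub>\<close> represents \<open>f\<close> on \<open>\<ell>\<^sup>2(\<int>)\<close>; the function below is
  its quadratic form at the vector \<open>\<delta>\<^sub>0 + cnj (w x) \<delta>\<^bsub>- n\<^esub>\<close>, of squared norm 2.\<close>

definition twist :: "int \<Rightarrow> ('x \<Rightarrow> complex) \<Rightarrow> (int \<Rightarrow> 'x \<Rightarrow> complex) \<Rightarrow> 'x \<Rightarrow> complex" where
  "twist n w f x = f 0 x + f 0 (orbit n x) + cnj (w x) * f n x + w x * f (- n) (orbit n x)"

text \<open>All four terms involve coefficients at the same points \<open>orbit (- i) x\<close>.
  They combine to the sum of |a_i + cnj w b_i|^2, where a_i and b_i are the coefficients of degree i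
  and i + n there.\<close>

lemma twist_star_mult:
  assumes f: "f \<in> carrier P" and w: "cmod (w x) = 1"
  shows "\<exists>r\<ge>0. twist n w (star P f \<otimes>\<^bsub>P\<^esub> f) x = of_real r"
proof -
  \<comment> \<open>Closed up by the shift so that both i and i + n run over a set containing
    \<open>supp f\<close>.\<close>
  let ?F = "supp f \<union> (\<lambda>i. i - n) ` supp f"
  have F: "finite ?F" by (simp add: P_finite[OF f])
  have F': "finite ((\<lambda>i. i + n) ` ?F)" using F by (rule finite_imageI)
  have sub: "supp f \<subseteq> (\<lambda>i. i + n) ` ?F" by (auto simp: image_Un image_image)
  have orb: "orbit (- i - n) (orbit n x) = orbit (- i) x" for i using orbit_add[of "- i - n" n x] by simp
  let ?a = "\<lambda>i. f i (orbit (- i) x)" and ?b = "\<lambda>i. f (i + n) (orbit (- i) x)"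
  have 1: "(star P f \<otimes>\<^bsub>P\<^esub> f) 0 x = (\<Sum>i\<in>?F. cnj (?a i) * ?a i)"
    using P_star_mult[OF f f F Un_upper1, of 0 x] by simp
  have 2: "(star P f \<otimes>\<^bsub>P\<^esub> f) n x = (\<Sum>i\<in>?F. cnj (?a i) * ?b i)"
    using P_star_mult[OF f f F Un_upper1, of n x] by (simp add: add.commute)
  have 3: "(star P f \<otimes>\<^bsub>P\<^esub> f) 0 (orbit n x) = (\<Sum>i\<in>?F. cnj (?b i) * ?b i)"
    unfolding P_star_mult[OF f f F' sub] by (subst sum.reindex) (simp_all add: inj_on_def orb)
  have 4: "(star P f \<otimes>\<^bsub>P\<^esub> f) (- n) (orbit n x) = (\<Sum>i\<in>?F. cnj (?b i) * ?a i)"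
    unfolding P_star_mult[OF f f F' sub] by (subst sum.reindex) (simp_all add: inj_on_def orb)
  have ww: "cnj (w x) * w x = 1" using complex_norm_square[of "w x"] w by (simp add: mult.commute)
  have sq: "a' * a + b' * b + w' * (a' * b) + v * (b' * a) = (a' + v * b') * (a + w' * b)"
    if "w' * v = 1" for a a' b b' v w' :: complex
  proof -
    have "(a' + v * b') * (a + w' * b) = a' * a + w' * (a' * b) + v * (b' * a) + (w' * v) * (b' * b)"
      by (simp add: algebra_simps)
    then show ?thesis using that by simp
  qed
  have "twist n w (star P f \<otimes>\<^bsub>P\<^esub> f) x =
      (\<Sum>i\<in>?F. cnj (?a i) * ?a i + cnj (?b i) * ?b i + cnj (w x) * (cnj (?a i) * ?b i) + w x * (cnj (?b i) * ?a i))"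
    unfolding twist_def 1 2 3 4 sum_distrib_left sum.distrib ..
  also have "\<dots> = (\<Sum>i\<in>?F. of_real ((cmod (?a i + cnj (w x) * ?b i))\<^sup>2))"
  proof (rule sum.cong[OF refl])
    fix i
    show "cnj (?a i) * ?a i + cnj (?b i) * ?b i + cnj (w x) * (cnj (?a i) * ?b i) + w x * (cnj (?b i) * ?a i) =
        of_real ((cmod (?a i + cnj (w x) * ?b i))\<^sup>2)"
      unfolding sq[OF ww] complex_norm_square by (simp add: mult.commute)
  qed
  also have "\<dots> = of_real (\<Sum>i\<in>?F. (cmod (?a i + cnj (w x) * ?b i))\<^sup>2)" by (rule of_real_sum[symmetric])
  finally show ?thesis by (intro exI[of _ "\<Sum>i\<in>?F. (cmod (?a i + cnj (w x) * ?b i))\<^sup>2"]) (simp add: sum_nonneg)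
qed

lemma twist_integrable:
  assumes f: "f \<in> carrier P" and w: "w \<in> borel_measurable \<mu>\<^sub>0" "\<And>x. cmod (w x) = 1"
  shows "integrable \<mu>\<^sub>0 (twist n w f)"
proof -
  have cw: "(\<lambda>x. cnj (w x)) \<in> borel_measurable \<mu>\<^sub>0" using w(1) by (rule cnj_measurable)
  have i: "integrable \<mu>\<^sub>0 (f k)" and o: "integrable \<mu>\<^sub>0 (\<lambda>x. f k (orbit n x))" for k
    by (rule integrable_continuous[OF P_continuous[OF f]] integrable_continuous[OF P_continuous_orbit[OF f]])+
  show ?thesis
    unfolding twist_def[abs_def]
    by (intro Bochner_Integration.integrable_add i o
        integrable_bounded_mult[OF i cw, of 1] integrable_bounded_mult[OF o w(1), of 1]) (simp_all add: w(2))
qed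

lemma twist_state:
  assumes n: "n \<noteq> 0" and w: "w \<in> borel_measurable \<mu>\<^sub>0" "\<And>x. cmod (w x) = 1"
  shows "algebraic_state P (\<lambda>f. (LINT x|\<mu>\<^sub>0. twist n w f x) / 2)"
  unfolding algebraic_state_def
proof (intro conjI allI ballI)
  fix f assume f: "f \<in> carrier P"
  obtain r where r: "\<And>x. 0 \<le> r x" "\<And>x. twist n w (star P f \<otimes>\<^bsub>P\<^esub> f) x = of_real (r x)"
    using twist_star_mult[OF f, of w _ n] w(2) by metis
  have eq: "(LINT x|\<mu>\<^sub>0. twist n w (star P f \<otimes>\<^bsub>P\<^esub> f) x) / 2 = of_real ((LINT x|\<mu>\<^sub>0. r x) / 2)"
    unfolding r(2) by (simp add: integral_complex_of_real)
  show "(LINT x|\<mu>\<^sub>0. twist n w (star P f \<otimes>\<^bsub>P\<^esub> f) x) / 2 \<in> \<real>" unfolding eq by (rule Reals_of_real)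
  show "0 \<le> Re ((LINT x|\<mu>\<^sub>0. twist n w (star P f \<otimes>\<^bsub>P\<^esub> f) x) / 2)"
    unfolding eq Re_complex_of_real using r(1) by simp
  fix c
  have "twist n w (c \<odot>\<^bsub>P\<^esub> f) = (\<lambda>x. c * twist n w f x)" by (simp add: twist_def fun_eq_iff algebra_simps)
  then show "(LINT x|\<mu>\<^sub>0. twist n w (c \<odot>\<^bsub>P\<^esub> f) x) / 2 = c * ((LINT x|\<mu>\<^sub>0. twist n w f x) / 2)" by simp
next
  fix f g assume f: "f \<in> carrier P" and g: "g \<in> carrier P"
  have "twist n w (f \<oplus>\<^bsub>P\<^esub> g) = (\<lambda>x. twist n w f x + twist n w g x)" by (simp add: twist_def fun_eq_iff algebra_simps)
  then show "(LINT x|\<mu>\<^sub>0. twist n w (f \<oplus>\<^bsub>P\<^esub> g) x) / 2 = (LINT x|\<mu>\<^sub>0. twist n w f x) / 2 + (LINT x|\<mu>\<^sub>0. twist n w g x) / 2"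
    using twist_integrable[OF f w, of n] twist_integrable[OF g w, of n] by (simp add: add_divide_distrib)
next
  \<comment> \<open>For nonzero n the unit contributes only through its two diagonal terms, which
    accounts for the division by 2.\<close>
  have "twist n w \<one>\<^bsub>P\<^esub> = (\<lambda>_. 2)" using n by (simp add: twist_def fun_eq_iff)
  then show "(LINT x|\<mu>\<^sub>0. twist n w \<one>\<^bsub>P\<^esub> x) / 2 = 1" by simp
qed

text \<open>The coboundary relation turns \<open>cnj (w x) * U n g x\<close> into
  \<open>cnj (w (T g x))\<close>, and its conjugate handles degree - n. This is the invariance of
  \<open>w V^n\<close> read off pointwise.\<close>

lemma twist_\<tau>:
  assumes f: "f \<in> carrier P" and w: "\<And>x. cmod (w x) = 1" and U: "U n g x = cnj (w (T g x)) * w x"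
  shows "twist n w (\<tau> g f) x = twist n w f (T g x)"
proof -
  have ww: "cnj (w x) * w x = 1" using complex_norm_square[of "w x"] w[of x] by (simp add: mult.commute)
  have "cnj (w x) * U n g x = cnj (w (T g x))" unfolding U using ww by (simp add: mult_ac)
  then have 1: "cnj (w x) * (f n (T g x) * U n g x) = cnj (w (T g x)) * f n (T g x)"
    by (metis mult.assoc mult.commute)
  have "w x * U (- n) g (orbit n x) = w (T g x)"
    unfolding U_uminus U complex_cnj_mult complex_cnj_cnj using ww by (simp add: mult_ac)
  then have 2: "w x * (f (- n) y * U (- n) g (orbit n x)) = w (T g x) * f (- n) y" for y
    by (metis mult.assoc mult.commute)
  show ?thesis unfolding twist_def \<tau>_eq[OF f] U_0 orbit_T mult_1_right 1 2 ..
qed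

text \<open>If the twisted state agreed with \<open>\<psi>\<^sub>0\<close> on every
  \<open>a V^n\<close>, then \<open>cnj w\<close> would be orthogonal to all continuous functions
  and vanish almost everywhere, against |w| = 1.\<close>

lemma coboundary_not_unique:
  assumes n: "n \<noteq> 0" and cob: "measurable_coboundary \<theta> \<mu>\<^sub>0 (cocycle_power \<alpha> u n)"
  shows "\<exists>\<psi> f. algebraic_state P \<psi> \<and> (\<forall>g. \<forall>f\<in>carrier P. \<psi> (\<tau> g f) = \<psi> f) \<and> f \<in> carrier P \<and> \<psi> f \<noteq> \<psi>\<^sub>0 f"
proof -
  obtain w where w: "w \<in> borel_measurable \<mu>\<^sub>0" "\<And>x. cmod (w x) = 1"
    and U: "\<And>g. AE x in \<mu>\<^sub>0. U n g x = cnj (w (T g x)) * w x"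
    using cob unfolding measurable_coboundary_def by blast
  define \<psi> where "\<psi> f = (LINT x|\<mu>\<^sub>0. twist n w f x) / 2" for f
  have st: "algebraic_state P \<psi>" unfolding \<psi>_def[abs_def] by (rule twist_state[OF n w])
  have inv: "\<psi> (\<tau> g f) = \<psi> f" if f: "f \<in> carrier P" for g f
  proof -
    have t: "twist n w k \<in> borel_measurable \<mu>\<^sub>0" if "k \<in> carrier P" for k
      using twist_integrable[OF that w, of n] by auto
    have "(LINT x|\<mu>\<^sub>0. twist n w (\<tau> g f) x) = (LINT x|\<mu>\<^sub>0. twist n w f (T g x))"
    proof (rule integral_cong_AE)
      show "twist n w (\<tau> g f) \<in> borel_measurable \<mu>\<^sub>0" by (rule t[OF \<tau>_closed[OF f]])
      show "(\<lambda>x. twist n w f (T g x)) \<in> borel_measurable \<mu>\<^sub>0"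
        using integrable_T[OF twist_integrable[OF f w, of n], of g] by auto
      show "AE x in \<mu>\<^sub>0. twist n w (\<tau> g f) x = twist n w f (T g x)"
        using U[of g] by eventually_elim (rule twist_\<tau>[OF f w(2)])
    qed
    also have "\<dots> = (LINT x|\<mu>\<^sub>0. twist n w f x)" by (rule integral_T[OF t[OF f]])
    finally show ?thesis by (simp add: \<psi>_def)
  qed
  have "\<exists>a. continuous_on UNIV a \<and> \<psi> (single n a) \<noteq> \<psi>\<^sub>0 (single n a)"
  proof (rule ccontr)
    assume no: "\<not> ?thesis"
    have cw: "integrable \<mu>\<^sub>0 (\<lambda>x. cnj (w x))"
      using w cnj_measurable[OF w(1)] by (intro integrable_const_bound[of _ 1]) auto
    have "AE x in \<mu>\<^sub>0. cnj (w x) = 0"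
    proof (rule AE_zeroI[OF cw])
      fix a :: "'x \<Rightarrow> complex" assume a: "continuous_on UNIV a"
      have "\<psi> (single n a) = \<psi>\<^sub>0 (single n a)" using no a by blast
      \<comment> \<open>Since n is nonzero, it differs from 0 and from - n, and one of the four
        terms survives.\<close>
      moreover have "twist n w (single n a) = (\<lambda>x. a x * cnj (w x))"
        using n by (simp add: twist_def single_def fun_eq_iff mult.commute)
      ultimately show "(LINT x|\<mu>\<^sub>0. a x * cnj (w x)) = 0" using n by (simp add: \<psi>_def \<psi>\<^sub>0_def single_def)
    qed
    then have "AE x in \<mu>\<^sub>0. False"
    proof eventually_elim
      case (elim x)
      then show ?case using w(2)[of x] by simp
    qed
    then show False by simp
  qed
  then show ?thesis using st inv single_closed by blast
qed

lemma skew_product_uniquely_ergodic_iff: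
  "uniquely_ergodic (crossed_product \<alpha>) (skew_product \<theta> \<alpha> u) \<and>
     invariant_state (crossed_product \<alpha>) (skew_product \<theta> \<alpha> u) (\<omega>\<^sub>0 \<circ> canonical_expectation)
   \<longleftrightarrow> (\<forall>n::int. n \<noteq> 0 \<longrightarrow> \<not> measurable_coboundary \<theta> \<mu>\<^sub>0 (cocycle_power \<alpha> u n))"
proof -
  interpret B: isometry_star_alg P by (rule P_isometry_star_alg)
  have "uniquely_ergodic (crossed_product \<alpha>) (skew_product \<theta> \<alpha> u) \<and>
     invariant_state (crossed_product \<alpha>) (skew_product \<theta> \<alpha> u) (\<omega>\<^sub>0 \<circ> canonical_expectation) \<longleftrightarrow>
     (\<forall>g. \<forall>f\<in>carrier P. \<psi>\<^sub>0 (\<tau> g f) = \<psi>\<^sub>0 f) \<and>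
     (\<forall>\<psi>. algebraic_state P \<psi> \<longrightarrow> (\<forall>g. \<forall>f\<in>carrier P. \<psi> (\<tau> g f) = \<psi> f) \<longrightarrow> (\<forall>f\<in>carrier P. \<psi> f = \<psi>\<^sub>0 f))"
    unfolding crossed_product_def
  proof (rule B.uniquely_ergodic_envelope_iff)
    show "star_endomorphism P (\<tau> g)" for g by (rule \<tau>_endomorphism)
    show "skew_product \<theta> \<alpha> u g C = seq_class P (\<lambda>k. \<tau> g (repr C k))" for g C
      by (simp add: skew_product_def \<tau>_def)
    show "algebraic_state P \<psi>\<^sub>0" by (rule \<psi>\<^sub>0_state)
    show "(\<lambda>k. \<psi>\<^sub>0 (s k)) \<longlonglongrightarrow> (\<omega>\<^sub>0 \<circ> canonical_expectation) (seq_class P s)"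
      if "s \<in> cauchy_seqs P (universal_norm P)" for s by (rule expectation_limit[OF that])
  qed
  also have "\<dots> \<longleftrightarrow> (\<forall>n. n \<noteq> 0 \<longrightarrow> \<not> measurable_coboundary \<theta> \<mu>\<^sub>0 (cocycle_power \<alpha> u n))"
  proof
    assume H: "(\<forall>g. \<forall>f\<in>carrier P. \<psi>\<^sub>0 (\<tau> g f) = \<psi>\<^sub>0 f) \<and>
      (\<forall>\<psi>. algebraic_state P \<psi> \<longrightarrow> (\<forall>g. \<forall>f\<in>carrier P. \<psi> (\<tau> g f) = \<psi> f) \<longrightarrow> (\<forall>f\<in>carrier P. \<psi> f = \<psi>\<^sub>0 f))"
    show "\<forall>n. n \<noteq> 0 \<longrightarrow> \<not> measurable_coboundary \<theta> \<mu>\<^sub>0 (cocycle_power \<alpha> u n)"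
    proof (intro allI impI notI)
      fix n :: int assume "n \<noteq> 0" "measurable_coboundary \<theta> \<mu>\<^sub>0 (cocycle_power \<alpha> u n)"
      from coboundary_not_unique[OF this] obtain \<psi> f where "algebraic_state P \<psi>"
        "\<forall>g. \<forall>f\<in>carrier P. \<psi> (\<tau> g f) = \<psi> f" "f \<in> carrier P" "\<psi> f \<noteq> \<psi>\<^sub>0 f" by blast
      then show False using conjunct2[OF H, rule_format, of \<psi> f] by blast
    qed
  next
    assume nc: "\<forall>n. n \<noteq> 0 \<longrightarrow> \<not> measurable_coboundary \<theta> \<mu>\<^sub>0 (cocycle_power \<alpha> u n)"
    show "(\<forall>g. \<forall>f\<in>carrier P. \<psi>\<^sub>0 (\<tau> g f) = \<psi>\<^sub>0 f) \<and>
      (\<forall>\<psi>. algebraic_state P \<psi> \<longrightarrow> (\<forall>g. \<forall>f\<in>carrier P. \<psi> (\<tau> g f) = \<psi> f) \<longrightarrow> (\<forall>f\<in>carrier P. \<psi> f = \<psi>\<^sub>0 f))"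
    proof (intro conjI allI ballI impI)
      fix g f assume "f \<in> carrier P"
      then show "\<psi>\<^sub>0 (\<tau> g f) = \<psi>\<^sub>0 f" by (rule \<psi>\<^sub>0_invariant)
    next
      fix \<psi> f assume \<psi>: "algebraic_state P \<psi>" and inv: "\<forall>g. \<forall>f\<in>carrier P. \<psi> (\<tau> g f) = \<psi> f" and f: "f \<in> carrier P"
      show "\<psi> f = \<psi>\<^sub>0 f"
      proof (rule invariant_state_eq_\<psi>\<^sub>0[OF \<psi> _ _ f])
        show "\<psi> (\<tau> g k) = \<psi> k" if "k \<in> carrier P" for g k using inv that by blast
        show "\<not> measurable_coboundary \<theta> \<mu>\<^sub>0 (cocycle_power \<alpha> u k)" if "k \<noteq> 0" for k using nc that by blast
      qed
    qed
  qed
  finally show ?thesis .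
qed

end

theorem corollary3p9:
  fixes \<theta> :: "'g::{topological_group_add, t2_space, second_countable_topology} \<Rightarrow>
                ('x::metric_space \<Rightarrow> complex) \<Rightarrow> ('x \<Rightarrow> complex)"
    and \<alpha> :: "('x \<Rightarrow> complex) \<Rightarrow> ('x \<Rightarrow> complex)"
    and u :: "'g \<Rightarrow> 'x \<Rightarrow> complex"
    and \<omega>\<^sub>0 :: "('x \<Rightarrow> complex) \<Rightarrow> complex"
    and \<mu>\<^sub>0 :: "'x measure"
  assumes "compact (UNIV :: 'x set)"
    and "locally compact (UNIV :: 'g set)"
    and "unimodular TYPE('g)"
    and "amenable TYPE('g)"
    and "cstar_dynamical_system cont_alg \<theta>"
    and "uniquely_ergodic cont_alg \<theta>"
    and "invariant_state cont_alg \<theta> \<omega>\<^sub>0"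
    and "prob_space \<mu>\<^sub>0" and "sets \<mu>\<^sub>0 = sets borel"
    and "\<And>f. f \<in> carrier cont_alg \<Longrightarrow> \<omega>\<^sub>0 f = (LINT x|\<mu>\<^sub>0. f x)"
    and "star_automorphism cont_alg \<alpha>"
    and "\<And>g a. a \<in> carrier cont_alg \<Longrightarrow> \<alpha> (\<theta> g a) = \<theta> g (\<alpha> a)"
    and "continuous_cocycle \<theta> u"
  shows "uniquely_ergodic (crossed_product \<alpha>) (skew_product \<theta> \<alpha> u) \<and>
         invariant_state (crossed_product \<alpha>) (skew_product \<theta> \<alpha> u) (\<omega>\<^sub>0 \<circ> canonical_expectation)
     \<longleftrightarrow> (\<forall>n::int. n \<noteq> 0 \<longrightarrow> \<not> measurable_coboundary \<theta> \<mu>\<^sub>0 (cocycle_power \<alpha> u n))"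
proof -
  interpret skew_system \<alpha> \<theta> u \<omega>\<^sub>0 \<mu>\<^sub>0
    by (intro skew_system.intro cont_automorphism.intro skew_system_axioms.intro) (fact assms)+
  show ?thesis by (rule skew_product_uniquely_ergodic_iff)
qed

end
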